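(* Let $\mathcal H$ be a Hilbert space of finite dimension $d$, let $0\le p\le\frac{d^2}{d^2-1}$, and let $\Phi$ be the depolarizing channel $\Phi(\sigma)=(1-p)\sigma+\frac pdI_{\mathcal H}$ on $\mathfrak S(\mathcal H)$. Let $\mathcal K$ be a finite-dimensional Hilbert space. Then for every quantum channel $\Omega:\mathfrak S(\mathcal K)\to\mathfrak S(\mathcal K)$ and every $\rho\in\mathfrak S(\mathcal H\otimes\mathcal K)$, $$H_{\Phi\otimes\Omega}(\rho)\ge H_\Phi(\mathrm{Tr}_{\mathcal K}(\rho))+H_\Omega(\mathrm{Tr}_{\mathcal H}(\rho)).$$
   Context: $\mathfrak S(\cdot)$ denotes the set of density operators; a quantum channel is a completely positive trace-preserving linear map; $S(\sigma)=-\mathrm{Tr}(\sigma\log\sigma)$ is the von Neumann entropy. For a channel $\Psi$ with input space $\mathcal L$ and $\sigma\in\mathfrak S(\mathcal L)$, $H_\Psi(\sigma):=\min\sum_{j}\pi_jS(\Psi(\sigma_j))$, the minimum over all finite decompositions $\sigma=\sum_j\pi_j\sigma_j$ with $\{\pi_j\}$ a probability distribution and $\sigma_j\in\mathfrak S(\mathcal L)$. *)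

theory Defs
  imports "Jordan_Normal_Form.Jordan_Normal_Form"
begin

(* Operators on a Hilbert space of dimension n are complex n x n matrices.
   The tensor product space H (dim n) \<otimes> K (dim m) is C^(n*m) with basis index
   (i,k) \<mapsto> i*m + k (i < n, k < m), i.e. the Kronecker convention. *)

definition mtrace :: "complex mat \<Rightarrow> complex" where
  "mtrace A = (\<Sum>i<dim_row A. A $$ (i,i))"

definition psd :: "nat \<Rightarrow> complex mat \<Rightarrow> bool" where
  "psd n A \<longleftrightarrow> A \<in> carrier_mat n n \<and>
     (\<forall>v \<in> carrier_vec n. Im (conjugate v \<bullet> (A *\<^sub>v v)) = 0 \<and> Re (conjugate v \<bullet> (A *\<^sub>v v)) \<ge> 0)"

definition density :: "nat \<Rightarrow> complex mat \<Rightarrow> bool" where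
  "density n A \<longleftrightarrow> psd n A \<and> mtrace A = 1"

definition matunit :: "nat \<Rightarrow> nat \<Rightarrow> nat \<Rightarrow> complex mat" where
  "matunit n i j = mat n n (\<lambda>(a,b). if a = i \<and> b = j then 1 else 0)"

text \<open>Tensor product F \<otimes> G of linear maps F on n x n and G on m x m matrices,
  defined by linearity from (F \<otimes> G)(E_ij \<otimes> E_kl) = F(E_ij) \<otimes> G(E_kl).\<close>
definition tensor_map :: "nat \<Rightarrow> nat \<Rightarrow> (complex mat \<Rightarrow> complex mat) \<Rightarrow> (complex mat \<Rightarrow> complex mat)
    \<Rightarrow> complex mat \<Rightarrow> complex mat" where
  "tensor_map n m F G M = mat (n*m) (n*m) (\<lambda>(a,b).
     \<Sum>i<n. \<Sum>j<n. \<Sum>k<m. \<Sum>l<m. M $$ (i*m+k, j*m+l) *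
        (F (matunit n i j)) $$ (a div m, b div m) * (G (matunit m k l)) $$ (a mod m, b mod m))"

definition linear_map_on :: "nat \<Rightarrow> (complex mat \<Rightarrow> complex mat) \<Rightarrow> bool" where
  "linear_map_on n F \<longleftrightarrow> (\<forall>A \<in> carrier_mat n n. F A \<in> carrier_mat n n) \<and>
     (\<forall>A \<in> carrier_mat n n. \<forall>B \<in> carrier_mat n n. F (A + B) = F A + F B) \<and>
     (\<forall>c. \<forall>A \<in> carrier_mat n n. F (c \<cdot>\<^sub>m A) = c \<cdot>\<^sub>m F A)"

definition channel :: "nat \<Rightarrow> (complex mat \<Rightarrow> complex mat) \<Rightarrow> bool" where
  "channel n F \<longleftrightarrow> linear_map_on n F \<and>
     (\<forall>k. \<forall>A. psd (n*k) A \<longrightarrow> psd (n*k) (tensor_map n k F (\<lambda>X. X) A)) \<and>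
     (\<forall>A \<in> carrier_mat n n. mtrace (F A) = mtrace A)"

definition eigs :: "complex mat \<Rightarrow> complex list" where
  "eigs A = (SOME as. char_poly A = (\<Prod>a\<leftarrow>as. [:- a, 1:]))"

text \<open>von Neumann entropy S(s) = -Tr(s log s) = - sum of lambda log lambda (0 log 0 = 0).\<close>
definition vn_entropy :: "complex mat \<Rightarrow> real" where
  "vn_entropy A = - (\<Sum>a\<leftarrow>eigs A. Re a * ln (Re a))"

definition Hmin :: "nat \<Rightarrow> (complex mat \<Rightarrow> complex mat) \<Rightarrow> complex mat \<Rightarrow> real" where
  "Hmin n \<Psi> \<sigma> = Inf {\<Sum>j<N. \<pi> j * vn_entropy (\<Psi> (s j)) | (N::nat) \<pi> s.
      (\<forall>j<N. \<pi> j \<ge> 0 \<and> density n (s j)) \<and> (\<Sum>j<N. \<pi> j) = 1 \<and>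
      \<sigma> = mat n n (\<lambda>ab. \<Sum>j<N. complex_of_real (\<pi> j) * s j $$ ab)}"

definition ptrace2 :: "nat \<Rightarrow> nat \<Rightarrow> complex mat \<Rightarrow> complex mat" where
  "ptrace2 n m \<rho> = mat n n (\<lambda>(i,j). \<Sum>k<m. \<rho> $$ (i*m+k, j*m+k))"

definition ptrace1 :: "nat \<Rightarrow> nat \<Rightarrow> complex mat \<Rightarrow> complex mat" where
  "ptrace1 n m \<rho> = mat m m (\<lambda>(k,l). \<Sum>i<n. \<rho> $$ (i*m+k, i*m+l))"

text \<open>Depolarizing channel, linearly extended: (1-p) s + (p/d) Tr(s) I.\<close>
definition depol :: "nat \<Rightarrow> real \<Rightarrow> complex mat \<Rightarrow> complex mat" where
  "depol d p \<sigma> = complex_of_real (1 - p) \<cdot>\<^sub>m \<sigma> +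
     (complex_of_real (p / real d) * mtrace \<sigma>) \<cdot>\<^sub>m 1\<^sub>m d"

end

theory Submission
  imports Defs "Jordan_Normal_Form.Spectral_Radius"
begin

text \<open>
  Pure states have the same output entropy \<open>h\<close> under the depolarizing channel, so
  \<open>H\<^sub>\<Phi> \<le> h\<close>, and it suffices to bound \<open>S((\<Phi> \<otimes> \<Omega>)(\<sigma>)) \<ge> h + H\<^sub>\<Omega>(Tr\<^sub>H \<sigma>)\<close> for a single state \<open>\<sigma>\<close>.
  Put \<open>w = (id \<otimes> \<Omega>)(\<sigma>)\<close>. For an orthonormal basis \<open>f\<close> of \<open>H\<close> that is unbiased to the eigenbasis of
  \<open>Tr\<^sub>K \<sigma>\<close>, let \<open>D\<close> be the pinching in \<open>f\<close>; its blocks are \<open>\<Omega>\<close>-images of an ensemble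
  of \<open>d\<close> equiprobable states averaging to \<open>Tr\<^sub>H \<sigma>\<close>. The operator \<open>V = d D(w) - w\<close> is positive, so with
  \<open>q\<^sub>1 = p / d\<close> and \<open>q\<^sub>0 = 1 - p + q\<^sub>1\<close> both the phase damped state
  \<open>A = (1 - p) w + p D(w) = q\<^sub>0 w + q\<^sub>1 V\<close> and \<open>D(w) = (w + V) / d\<close> are positive
  combinations of \<open>w\<close> and \<open>V\<close>, and joint convexity of the relative entropy gives
  \<open>S(A) \<ge> S(D(w)) - ln d + h\<close>. A mixture of unitary conjugates of such \<open>A\<close>, over a suitable family of
  unbiased bases, equals \<open>(\<Phi> \<otimes> \<Omega>)(\<sigma>)\<close>; its weights are nonnegative because of the upper bound
  on \<open>p\<close>, and entropy is concave.
\<close>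

section \<open>Matrices over finite index sets\<close>

text \<open>The traces of \<open>w\<close> and \<open>V\<close>, namely 1 and \<open>d - 1\<close>,
  explain why no constant is lost: joint convexity compares A with D(w) as the output spectrum of a
  pure state (\<open>q0\<close> once, \<open>q1\<close> with multiplicity \<open>d - 1\<close>)
  compares with the uniform distribution, at relative entropy \<open>ln d - h\<close>. Unbiasedness
  pays the \<open>ln d\<close> back: each of the d blocks of D(w) has trace 1/d, so the entropy of
  D(w) is \<open>ln d\<close> plus the mean entropy of the normalised blocks. The obstacle is the
  averaging. Complete sets of mutually unbiased bases are known only in special dimensions; instead
  a Fourier basis is multiplied by diagonal phases. The averaged damped state then has the right
  diagonal blocks, but \<open>q0\<close> in place of \<open>q0 - q1\<close> on the off-diagonal
  ones. Conjugation by powers of one diagonal unitary supplies the missing factor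
  \<open>r = (q0 - q1) / q0\<close>, negative for \<open>p > 1\<close>. Its weights are nonnegative
  iff \<open>1 + (d - 1) * r >= 0\<close>, which is \<open>p * (d^2 - 1) <= d^2\<close>.\<close>

text \<open>Operators are functions of two indices from a finite index set, so that
  \<open>C\<^sup>d \<otimes> C\<^sup>m\<close> is indexed by pairs.\<close>

definition ip :: "'a set \<Rightarrow> ('a \<Rightarrow> complex) \<Rightarrow> ('a \<Rightarrow> complex) \<Rightarrow> complex" where
  "ip I v w = (\<Sum>x\<in>I. cnj (v x) * w x)"

definition form :: "'a set \<Rightarrow> ('a \<Rightarrow> 'a \<Rightarrow> complex) \<Rightarrow> ('a \<Rightarrow> complex) \<Rightarrow> ('a \<Rightarrow> complex) \<Rightarrow> complex" where
  "form I W v w = (\<Sum>x\<in>I. \<Sum>y\<in>I. cnj (v x) * W x y * w y)"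

definition psd_on :: "'a set \<Rightarrow> ('a \<Rightarrow> 'a \<Rightarrow> complex) \<Rightarrow> bool" where
  "psd_on I W \<longleftrightarrow> (\<forall>v. Im (form I W v v) = 0 \<and> Re (form I W v v) \<ge> 0)"

text \<open>Completeness is part of the notion and \<open>K\<close> need not be \<open>I\<close>, so
  no dimension count is needed and a matrix on \<open>{..<d * m}\<close> can keep eigenvectors
  labelled by pairs.\<close>

definition onb :: "'a set \<Rightarrow> 'k set \<Rightarrow> ('k \<Rightarrow> 'a \<Rightarrow> complex) \<Rightarrow> bool" where
  "onb I K \<phi> \<longleftrightarrow> finite I \<and> finite K \<and>
     (\<forall>k\<in>K. \<forall>l\<in>K. ip I (\<phi> k) (\<phi> l) = of_bool (k = l)) \<and>
     (\<forall>x\<in>I. \<forall>y\<in>I. (\<Sum>k\<in>K. \<phi> k x * cnj (\<phi> k y)) = of_bool (x = y))"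

definition spectral :: "'a set \<Rightarrow> 'k set \<Rightarrow> ('a \<Rightarrow> 'a \<Rightarrow> complex) \<Rightarrow> ('k \<Rightarrow> 'a \<Rightarrow> complex) \<Rightarrow> ('k \<Rightarrow> real) \<Rightarrow> bool" where
  "spectral I K W \<phi> a \<longleftrightarrow> onb I K \<phi> \<and>
     (\<forall>x\<in>I. \<forall>y\<in>I. W x y = (\<Sum>k\<in>K. of_real (a k) * \<phi> k x * cnj (\<phi> k y)))"

text \<open>These simp rules turn a sum with an \<open>of_bool\<close> factor into a sum over an
  intersection; the rules proved next evaluate it at the one surviving index.\<close>

declare sum_of_bool_mult_eq [simp del] sum_mult_of_bool_eq [simp del]

lemma sum_of_bool_delta [simp]:
  fixes f g :: "'a \<Rightarrow> 'b::semiring_1"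
  assumes "finite S" "s \<in> S"
  shows "(\<Sum>x\<in>S. of_bool (x = s) * f x) = f s" "(\<Sum>x\<in>S. of_bool (s = x) * f x) = f s"
    "(\<Sum>x\<in>S. f x * of_bool (x = s)) = f s" "(\<Sum>x\<in>S. f x * of_bool (s = x)) = f s"
    "(\<Sum>x\<in>S. g x * (of_bool (x = s) * f x)) = g s * f s" "(\<Sum>x\<in>S. g x * (of_bool (s = x) * f x)) = g s * f s"
    "(\<Sum>x\<in>S. g x * (f x * of_bool (x = s))) = g s * f s" "(\<Sum>x\<in>S. g x * (f x * of_bool (s = x))) = g s * f s"
    "(\<Sum>x\<in>S. g x * of_bool (x = s) * f x) = g s * f s" "(\<Sum>x\<in>S. g x * of_bool (s = x) * f x) = g s * f s"
  using assms by (simp_all add: of_bool_def if_distrib if_distribR sum.delta sum.delta' cong: if_cong)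

lemma cnj_of_bool [simp]: "cnj (of_bool P) = of_bool P"
  by (simp add: of_bool_def)

lemma ip_cnj: "cnj (ip I v w) = ip I w v"
  by (simp add: ip_def mult.commute)

lemma ip_self: "ip I v v = of_real (\<Sum>x\<in>I. (cmod (v x))\<^sup>2)"
  by (simp add: ip_def mult.commute[of "cnj _"] complex_norm_square[symmetric] del: of_real_power)

lemma ip_sum_right: "ip I v (\<lambda>x. \<Sum>k\<in>K. c k * w k x) = (\<Sum>k\<in>K. c k * ip I v (w k))"
  unfolding ip_def by (simp add: sum_distrib_left sum.swap[of _ K I] algebra_simps)

lemma ip_sum_left: "ip I (\<lambda>x. \<Sum>k\<in>K. c k * w k x) v = (\<Sum>k\<in>K. cnj (c k) * ip I (w k) v)"
  unfolding ip_def by (simp add: sum_distrib_left sum_distrib_right sum.swap[of _ K I] algebra_simps)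

lemma form_cong:
  "(\<And>x y. x \<in> I \<Longrightarrow> y \<in> I \<Longrightarrow> W x y = W' x y) \<Longrightarrow> (\<And>x. x \<in> I \<Longrightarrow> v x = v' x) \<Longrightarrow>
   (\<And>x. x \<in> I \<Longrightarrow> w x = w' x) \<Longrightarrow> form I W v w = form I W' v' w'"
  by (simp add: form_def)

lemma form_sum_right: "form I W v (\<lambda>x. \<Sum>k\<in>K. c k * w k x) = (\<Sum>k\<in>K. c k * form I W v (w k))"
  unfolding form_def
  by (simp add: sum_distrib_left sum.swap[of _ K I] algebra_simps)

lemma form_sum_left: "form I W (\<lambda>x. \<Sum>k\<in>K. c k * w k x) v = (\<Sum>k\<in>K. cnj (c k) * form I W (w k) v)"
  unfolding form_def
  by (simp add: sum_distrib_left sum_distrib_right sum.swap[of _ K I] algebra_simps)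

lemma form_diff_right: "form I W v (\<lambda>x. w x - w' x) = form I W v w - form I W v w'"
  unfolding form_def by (simp add: sum_subtractf algebra_simps)

lemma form_diff_left: "form I W (\<lambda>x. w x - w' x) v = form I W w v - form I W w' v"
  unfolding form_def by (simp add: sum_subtractf algebra_simps)

lemma form_scale_right: "form I W v (\<lambda>x. c * w x) = c * form I W v w"
  unfolding form_def by (simp add: sum_distrib_left algebra_simps)

lemma form_scale_left: "form I W (\<lambda>x. c * w x) v = cnj c * form I W w v"
  unfolding form_def by (simp add: sum_distrib_left algebra_simps)

lemma form_add_mat: "form I (\<lambda>x y. W x y + V x y) v w = form I W v w + form I V v w"
  unfolding form_def by (simp add: sum.distrib algebra_simps)

lemma form_scale_mat: "form I (\<lambda>x y. c * W x y) v w = c * form I W v w"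
  unfolding form_def by (simp add: sum_distrib_left algebra_simps)

lemma form_sum_mat: "form I (\<lambda>x y. \<Sum>s\<in>S. c s * W s x y) v w = (\<Sum>s\<in>S. c s * form I (W s) v w)"
  unfolding form_def
  by (simp add: sum_distrib_left sum_distrib_right sum.swap[of _ S I] algebra_simps)

lemma form_cnj: "cnj (form I W v w) = form I (\<lambda>x y. cnj (W y x)) w v"
  unfolding form_def by (subst sum.swap) (simp add: algebra_simps)

lemma form_of_bool:
  assumes "finite I" "s \<in> I" "t \<in> I"
  shows "form I W (\<lambda>x. of_bool (x = s)) (\<lambda>x. of_bool (x = t)) = W s t"
  using assms by (simp add: form_def mult.assoc)

text \<open>Polarisation: the form is real at e_s - c e_t, and c = 1 compares the imaginary parts of
  the two entries, c = i their real parts.\<close>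

lemma psd_on_hermitian:
  assumes "finite I" "psd_on I W" "s \<in> I" "t \<in> I"
  shows "W t s = cnj (W s t)"
proof -
  let ?e = "\<lambda>s x. of_bool (x = s) :: complex"
  have F: "form I W (\<lambda>x. ?e s x - c * ?e t x) (\<lambda>x. ?e s x - c * ?e t x)
      = W s s - c * W s t - cnj c * W t s + cnj c * c * W t t" for c
    using assms(1,3,4) unfolding form_diff_left form_diff_right form_scale_left form_scale_right
    by (simp add: form_of_bool algebra_simps)
  have I0: "Im (W s s) = 0" "Im (W t t) = 0"
    using assms(2)[unfolded psd_on_def, rule_format, of "?e s"] assms(2)[unfolded psd_on_def, rule_format, of "?e t"]
      assms(1,3,4) by (simp_all add: form_of_bool)
  have Z: "Im (W s s - c * W s t - cnj c * W t s + cnj c * c * W t t) = 0" for c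
    using assms(2) unfolding psd_on_def F[symmetric] by blast
  have "Im (W s t) + Im (W t s) = 0" using Z[of 1] I0 by simp
  moreover have "Re (W s t) = Re (W t s)" using Z[of \<i>] I0 by simp
  ultimately show ?thesis by (simp add: complex_eq_iff)
qed

lemma form_hermitian:
  assumes "finite I" "psd_on I W"
  shows "form I W w v = cnj (form I W v w)"
  unfolding form_cnj by (intro form_cong psd_on_hermitian[OF assms] refl)

lemma onb_ip: "onb I K \<phi> \<Longrightarrow> k \<in> K \<Longrightarrow> l \<in> K \<Longrightarrow> ip I (\<phi> k) (\<phi> l) = of_bool (k = l)"
  by (simp add: onb_def)

lemma onb_complete: "onb I K \<phi> \<Longrightarrow> x \<in> I \<Longrightarrow> y \<in> I \<Longrightarrow> (\<Sum>k\<in>K. \<phi> k x * cnj (\<phi> k y)) = of_bool (x = y)"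
  by (simp add: onb_def)

lemma onb_parseval:
  assumes "onb I K \<phi>"
  shows "ip I v w = (\<Sum>k\<in>K. ip I v (\<phi> k) * ip I (\<phi> k) w)"
proof -
  have fin: "finite I" "finite K" using assms by (auto simp: onb_def)
  have "(\<Sum>k\<in>K. ip I v (\<phi> k) * ip I (\<phi> k) w)
      = (\<Sum>x\<in>I. \<Sum>y\<in>I. cnj (v x) * (\<Sum>k\<in>K. \<phi> k x * cnj (\<phi> k y)) * w y)"
    unfolding ip_def sum_product
    by (simp add: sum_distrib_left sum_distrib_right sum.swap[of _ K I] algebra_simps)
  also have "\<dots> = ip I v w" using fin by (simp add: onb_complete[OF assms] ip_def mult.assoc)
  finally show ?thesis by simp
qed

text \<open>The double sum of the squared moduli of all components counts \<open>K\<close> by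
  normalisation and \<open>I\<close> by completeness.\<close>

lemma onb_card:
  assumes "onb I K \<phi>"
  shows "card K = card I"
proof -
  have "of_nat (card K) = (\<Sum>k\<in>K. ip I (\<phi> k) (\<phi> k))" by (simp add: onb_ip[OF assms])
  also have "\<dots> = (\<Sum>x\<in>I. \<Sum>k\<in>K. \<phi> k x * cnj (\<phi> k x))"
    unfolding ip_def by (subst sum.swap) (simp add: mult.commute)
  also have "\<dots> = of_nat (card I)" by (simp add: onb_complete[OF assms])
  finally show ?thesis using of_nat_eq_iff by blast
qed

lemma onb_trace:
  assumes "onb I K \<phi>"
  shows "(\<Sum>k\<in>K. form I W (\<phi> k) (\<phi> k)) = (\<Sum>x\<in>I. W x x)"
proof -
  have fin: "finite I" "finite K" using assms by (auto simp: onb_def)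
  have "(\<Sum>k\<in>K. form I W (\<phi> k) (\<phi> k)) = (\<Sum>x\<in>I. \<Sum>y\<in>I. W x y * (\<Sum>k\<in>K. \<phi> k y * cnj (\<phi> k x)))"
    unfolding form_def
    by (simp add: sum_distrib_left sum_distrib_right sum.swap[of _ K I] algebra_simps)
  also have "\<dots> = (\<Sum>x\<in>I. W x x)" using fin by (simp add: onb_complete[OF assms])
  finally show ?thesis .
qed

lemma spectral_form:
  assumes "spectral I K W \<phi> a"
  shows "form I W v w = (\<Sum>k\<in>K. of_real (a k) * ip I v (\<phi> k) * ip I (\<phi> k) w)"
proof -
  have "form I W v w = (\<Sum>x\<in>I. \<Sum>y\<in>I. cnj (v x) * (\<Sum>k\<in>K. of_real (a k) * \<phi> k x * cnj (\<phi> k y)) * w y)"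
    using assms by (simp add: form_def spectral_def)
  also have "\<dots> = (\<Sum>k\<in>K. of_real (a k) * ip I v (\<phi> k) * ip I (\<phi> k) w)"
    unfolding ip_def mult.assoc sum_product
    by (simp add: sum_distrib_left sum_distrib_right sum.swap[of _ K I] algebra_simps)
  finally show ?thesis .
qed

lemma ip_mult_cnj: "ip I v w * ip I w v = of_real ((cmod (ip I v w))\<^sup>2)"
  using complex_norm_square[of "ip I v w"] by (simp add: ip_cnj)

lemma spectral_form_self:
  assumes "spectral I K W \<phi> a"
  shows "form I W v v = of_real (\<Sum>k\<in>K. a k * (cmod (ip I v (\<phi> k)))\<^sup>2)"
  unfolding spectral_form[OF assms] mult.assoc ip_mult_cnj by simp

lemma spectral_eigenform:
  assumes "spectral I K W \<phi> a" "k \<in> K"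
  shows "form I W (\<phi> k) w = of_real (a k) * ip I (\<phi> k) w"
    and "form I W w (\<phi> k) = of_real (a k) * ip I w (\<phi> k)"
    and "form I W (\<phi> k) (\<phi> k) = of_real (a k)"
proof -
  have o: "onb I K \<phi>" and f: "finite K" using assms(1) by (auto simp: spectral_def onb_def)
  show 1: "form I W (\<phi> k) w = of_real (a k) * ip I (\<phi> k) w" for w
    using assms(2) f unfolding spectral_form[OF assms(1)]
    by (simp add: onb_ip[OF o] mult.assoc)
  show "form I W w (\<phi> k) = of_real (a k) * ip I w (\<phi> k)" for w
    using assms(2) f unfolding spectral_form[OF assms(1)]
    by (simp add: onb_ip[OF o] mult.assoc)
  show "form I W (\<phi> k) (\<phi> k) = of_real (a k)"
    using assms(2) by (simp add: 1 onb_ip[OF o])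
qed

lemma onb_compose:
  assumes \<eta>: "onb I L \<eta>" and \<phi>: "onb L K \<phi>"
  shows "onb I K (\<lambda>k x. \<Sum>y\<in>L. \<phi> k y * \<eta> y x)"
proof -
  have fin: "finite I" "finite L" "finite K" using assms by (auto simp: onb_def)
  have 1: "ip I (\<lambda>x. \<Sum>y\<in>L. \<phi> k y * \<eta> y x) (\<lambda>x. \<Sum>y\<in>L. \<phi> l y * \<eta> y x) = of_bool (k = l)"
    if "k \<in> K" "l \<in> K" for k l
    unfolding ip_sum_left ip_sum_right
    using that fin onb_ip[OF \<phi>, unfolded ip_def] by (simp add: onb_ip[OF \<eta>])
  have 2: "(\<Sum>k\<in>K. (\<Sum>y\<in>L. \<phi> k y * \<eta> y x) * cnj (\<Sum>y\<in>L. \<phi> k y * \<eta> y z)) = of_bool (x = z)"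
    if "x \<in> I" "z \<in> I" for x z
  proof -
    have "(\<Sum>k\<in>K. (\<Sum>y\<in>L. \<phi> k y * \<eta> y x) * cnj (\<Sum>y\<in>L. \<phi> k y * \<eta> y z))
       = (\<Sum>y\<in>L. \<Sum>y'\<in>L. \<eta> y x * cnj (\<eta> y' z) * (\<Sum>k\<in>K. \<phi> k y * cnj (\<phi> k y')))"
      unfolding cnj_sum sum_product
      by (simp add: sum_distrib_left sum_distrib_right sum.swap[of _ K L] algebra_simps)
    then show ?thesis using fin that by (simp add: onb_complete[OF \<phi>] onb_complete[OF \<eta>])
  qed
  show ?thesis unfolding onb_def using fin 1 2 by auto
qed

lemma form_onb_expand:
  assumes "onb I L \<eta>" "x \<in> I" "z \<in> I"
  shows "W x z = (\<Sum>y\<in>L. \<Sum>y'\<in>L. form I W (\<eta> y) (\<eta> y') * \<eta> y x * cnj (\<eta> y' z))"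
proof -
  have fin: "finite I" "finite L" using assms by (auto simp: onb_def)
  have "(\<Sum>y\<in>L. \<Sum>y'\<in>L. form I W (\<eta> y) (\<eta> y') * \<eta> y x * cnj (\<eta> y' z))
     = (\<Sum>y\<in>L. \<Sum>y'\<in>L. \<Sum>u\<in>I. \<Sum>v\<in>I. W u v * (\<eta> y x * cnj (\<eta> y u)) * (\<eta> y' v * cnj (\<eta> y' z)))"
    unfolding form_def by (simp add: sum_distrib_left sum_distrib_right algebra_simps)
  also have "\<dots> = (\<Sum>u\<in>I. \<Sum>v\<in>I. \<Sum>y\<in>L. \<Sum>y'\<in>L. W u v * (\<eta> y x * cnj (\<eta> y u)) * (\<eta> y' v * cnj (\<eta> y' z)))"
    by (simp add: sum.swap[of _ L I])
  also have "\<dots> = (\<Sum>u\<in>I. \<Sum>v\<in>I. W u v * (\<Sum>y\<in>L. \<eta> y x * cnj (\<eta> y u)) * (\<Sum>y'\<in>L. \<eta> y' v * cnj (\<eta> y' z)))"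
    by (simp add: sum_distrib_left sum_distrib_right algebra_simps)
  also have "\<dots> = W x z" using fin assms(2,3) by (simp add: onb_complete[OF assms(1)])
  finally show ?thesis by simp
qed

lemma spectral_rotate:
  assumes \<eta>: "onb I L \<eta>" and W': "\<And>y z. y \<in> L \<Longrightarrow> z \<in> L \<Longrightarrow> W' y z = form I W (\<eta> y) (\<eta> z)"
    and \<phi>: "spectral L K W' \<phi> a"
  shows "spectral I K W (\<lambda>k x. \<Sum>y\<in>L. \<phi> k y * \<eta> y x) a"
proof -
  have "W x z = (\<Sum>k\<in>K. of_real (a k) * (\<Sum>y\<in>L. \<phi> k y * \<eta> y x) * cnj (\<Sum>y\<in>L. \<phi> k y * \<eta> y z))"
    if "x \<in> I" "z \<in> I" for x z
  proof -
    have "W x z = (\<Sum>y\<in>L. \<Sum>y'\<in>L. W' y y' * \<eta> y x * cnj (\<eta> y' z))"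
      using form_onb_expand[OF \<eta> that, of W] W' by simp
    also have "\<dots> = (\<Sum>y\<in>L. \<Sum>y'\<in>L. (\<Sum>k\<in>K. of_real (a k) * \<phi> k y * cnj (\<phi> k y')) * \<eta> y x * cnj (\<eta> y' z))"
      using \<phi> by (simp add: spectral_def)
    also have "\<dots> = (\<Sum>k\<in>K. of_real (a k) * (\<Sum>y\<in>L. \<phi> k y * \<eta> y x) * cnj (\<Sum>y\<in>L. \<phi> k y * \<eta> y z))"
      unfolding cnj_sum mult.assoc sum_product
      by (simp add: sum_distrib_left sum_distrib_right sum.swap[of _ K L] algebra_simps)
    finally show ?thesis .
  qed
  then show ?thesis using onb_compose[OF \<eta>] \<phi> unfolding spectral_def by auto
qed

section \<open>Spectral theorem and entropy\<close>

lemma eigenvector_on_exists: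
  fixes W :: "'a \<Rightarrow> 'a \<Rightarrow> complex"
  assumes "finite I" "I \<noteq> {}"
  shows "\<exists>v c. ip I v v = 1 \<and> (\<forall>x\<in>I. (\<Sum>y\<in>I. W x y * v y) = c * v x)"
proof -
  define n where "n = card I"
  have n: "n > 0" using assms by (auto simp: n_def card_gt_0_iff)
  obtain h where h: "bij_betw h {0..<n} I" using ex_bij_betw_nat_finite[OF assms(1)] n_def by auto
  define A where "A = mat n n (\<lambda>(i,j). W (h i) (h j))"
  have A: "A \<in> carrier_mat n n" by (simp add: A_def)
  obtain c u where u: "eigenvector A u c"
    using spectrum_non_empty[OF A n] by (auto simp: spectrum_def eigenvalue_def)
  then have uc: "u \<in> carrier_vec n" and u0: "u \<noteq> 0\<^sub>v n" and Au: "A *\<^sub>v u = c \<cdot>\<^sub>v u"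
    using A by (auto simp: eigenvector_def)
  define g where "g = inv_into {0..<n} h"
  have gh: "g (h i) = i" if "i < n" for i
    using h that by (simp add: g_def bij_betw_def)
  define v where "v = (\<lambda>x. u $ g x)"
  have ev: "(\<Sum>y\<in>I. W x y * v y) = c * v x" if x: "x \<in> I" for x
  proof -
    obtain i where i: "i < n" "x = h i" using h x unfolding bij_betw_def by auto
    have "(\<Sum>y\<in>I. W x y * v y) = (\<Sum>j\<in>{0..<n}. W x (h j) * v (h j))"
      by (rule sum.reindex_bij_betw[OF h, symmetric])
    also have "\<dots> = (A *\<^sub>v u) $ i"
      using i uc by (simp add: A_def mult_mat_vec_def scalar_prod_def v_def gh)
    also have "\<dots> = c * v x" using i uc by (simp add: Au v_def gh)
    finally show ?thesis .
  qed
  obtain i where i: "i < n" "u $ i \<noteq> 0" using u0 uc by (metis eq_vecI carrier_vecD index_zero_vec(1,2))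
  have hi: "h i \<in> I" using h i by (auto simp: bij_betw_def)
  define N where "N = (\<Sum>x\<in>I. (cmod (v x))\<^sup>2)"
  have "(cmod (v (h i)))\<^sup>2 \<le> N" unfolding N_def using assms(1) hi by (intro member_le_sum) auto
  moreover have "(cmod (v (h i)))\<^sup>2 > 0" using i by (simp add: v_def gh)
  ultimately have N: "N > 0" by linarith
  define w where "w = (\<lambda>x. v x / of_real (sqrt N))"
  have "(\<Sum>x\<in>I. (cmod (w x))\<^sup>2) = N / N"
    using N by (simp add: w_def norm_divide power_divide sum_divide_distrib[symmetric] N_def)
  then have "ip I w w = 1" using N by (simp add: ip_self)
  moreover have "(\<Sum>y\<in>I. W x y * w y) = c * w x" if "x \<in> I" for x
    using ev[OF that] by (simp add: w_def sum_divide_distrib[symmetric])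
  ultimately show ?thesis by blast
qed

text \<open>The family is the list of columns of the Householder reflection exchanging \<open>v\<close> and the
  basis vector at \<open>x0\<close>.\<close>

lemma onb_extend:
  assumes I: "finite I" "x0 \<in> I" and v: "ip I v v = 1" "Im (v x0) = 0"
  shows "\<exists>\<eta>. onb I I \<eta> \<and> (\<forall>x\<in>I. \<eta> x0 x = v x)"
proof -
  define u where "u = (\<lambda>x. v x - of_bool (x = x0))"
  define N where "N = (\<Sum>x\<in>I. (cmod (u x))\<^sup>2)"
  define \<eta> where "\<eta> = (\<lambda>y x. of_bool (x = y) - 2 * u x * cnj (u y) / of_real N)"
  have uu: "ip I u u = of_real N" by (simp add: N_def ip_self)
  \<comment> \<open>A real inner product of \<open>v\<close> with the basis vector at
    \<open>x0\<close> is what allows one reflection to exchange the two.\<close>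
  have vr: "cnj (v x0) = v x0" using v(2) by (simp add: complex_eq_iff)
  have "ip I u u = ip I v v - v x0 - cnj (v x0) + 1"
    unfolding ip_def u_def using I
    by (simp add: algebra_simps sum.distrib sum_subtractf)
  then have Nv: "of_real N = 2 - 2 * v x0" using uu v(1) vr by simp
  have \<eta>0: "\<eta> x0 x = v x" if "x \<in> I" for x
  proof (cases "N = 0")
    \<comment> \<open>Here \<open>v\<close> already is the basis vector; division by zero turns
      \<open>\<eta>\<close> into the identity.\<close>
    case True
    then have "u x = 0" using I that by (auto simp: N_def sum_nonneg_eq_0_iff)
    then show ?thesis by (simp add: \<eta>_def u_def)
  next
    case False
    have "2 * cnj (u x0) = - of_real N" using vr by (simp add: u_def Nv)
    then have "2 * u x * cnj (u x0) = - of_real N * u x" by (metis mult.assoc mult.commute)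
    then show ?thesis using False by (simp add: \<eta>_def) (simp add: u_def)
  qed
  have sym: "cnj (\<eta> y x) = \<eta> x y" for x y by (simp add: \<eta>_def mult.commute mult.left_commute eq_commute)
  have prod: "(\<Sum>x\<in>I. \<eta> x y * \<eta> z x) = of_bool (y = z)" if yz: "y \<in> I" "z \<in> I" for y z
  proof -
    have "(\<Sum>x\<in>I. \<eta> x y * \<eta> z x) = (\<Sum>x\<in>I. of_bool (y = x) * of_bool (x = z))
       - (\<Sum>x\<in>I. of_bool (y = x) * (2 * u x * cnj (u z) / of_real N))
       - (\<Sum>x\<in>I. (2 * u y * cnj (u x) / of_real N) * of_bool (x = z))
       + (\<Sum>x\<in>I. 4 * u y * cnj (u z) / of_real N / of_real N * (cnj (u x) * u x))"
      by (simp add: \<eta>_def algebra_simps sum.distrib sum_subtractf)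
    also have "(\<Sum>x\<in>I. 4 * u y * cnj (u z) / of_real N / of_real N * (cnj (u x) * u x))
       = 4 * u y * cnj (u z) / of_real N / of_real N * of_real N"
      unfolding sum_distrib_left[symmetric] uu[symmetric] ip_def ..
    finally show ?thesis using I yz by (simp only: sum_of_bool_delta) simp
  qed
  have "onb I I \<eta>" unfolding onb_def ip_def sym using I prod by blast
  then show ?thesis using \<eta>0 by blast
qed

text \<open>Deflation: in an orthonormal basis whose member at \<open>x0\<close> is an eigenvector,
  row and column \<open>x0\<close> vanish off the diagonal, and the induction hypothesis
  diagonalises the remainder over \<open>J\<close>.\<close>

lemma spectral_theorem:
  fixes W :: "'a \<Rightarrow> 'a \<Rightarrow> complex"
  assumes "finite I" "\<And>x y. x \<in> I \<Longrightarrow> y \<in> I \<Longrightarrow> W y x = cnj (W x y)"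
  shows "\<exists>\<phi> a. spectral I I W \<phi> a"
  using assms
proof (induction I arbitrary: W rule: finite_induct)
  case empty
  show ?case by (simp add: spectral_def onb_def)
next
  case (insert x0 J)
  define I where "I = insert x0 J"
  have I: "finite I" "x0 \<in> I" using insert.hyps by (auto simp: I_def)
  have W: "\<And>x y. x \<in> I \<Longrightarrow> y \<in> I \<Longrightarrow> W y x = cnj (W x y)" unfolding I_def by (rule insert.prems)
  obtain u c where u: "ip I u u = 1" "\<And>x. x \<in> I \<Longrightarrow> (\<Sum>y\<in>I. W x y * u y) = c * u x"
    using eigenvector_on_exists[of I W] I by auto
  \<comment> \<open>The phase \<open>s\<close> makes the component at \<open>x0\<close> real, as
    \<open>onb_extend\<close> requires.\<close>
  define s where "s = (if u x0 = 0 then 1 else cnj (u x0) / of_real (cmod (u x0)))"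
  have s1: "cnj s * s = 1"
    using complex_norm_square[of "u x0"]
    by (auto simp: s_def field_simps power2_eq_square simp flip: of_real_mult)
  define v where "v = (\<lambda>x. s * u x)"
  have v1: "ip I v v = 1"
  proof -
    have "ip I v v = (cnj s * s) * ip I u u"
      by (simp add: ip_def v_def sum_distrib_left algebra_simps)
    then show ?thesis using s1 u(1) by simp
  qed
  have v0: "Im (v x0) = 0"
    using complex_norm_square[of "u x0"]
    by (auto simp: v_def s_def mult.commute[of "cnj _"] simp flip: of_real_power)
  have v: "(\<Sum>y\<in>I. W x y * v y) = c * v x" if "x \<in> I" for x
  proof -
    have "(\<Sum>y\<in>I. W x y * v y) = s * (\<Sum>y\<in>I. W x y * u y)"
      by (simp add: v_def sum_distrib_left algebra_simps)
    then show ?thesis using u(2)[OF that] by (simp add: v_def)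
  qed
  obtain \<eta> where \<eta>: "onb I I \<eta>" "\<And>x. x \<in> I \<Longrightarrow> \<eta> x0 x = v x"
    using onb_extend[OF I v1 v0] by blast
  define W' where "W' = (\<lambda>y z. form I W (\<eta> y) (\<eta> z))"
  have herm: "W' z y = cnj (W' y z)" for y z
    unfolding W'_def form_cnj by (intro form_cong W refl)
  have col: "W' y x0 = c * of_bool (y = x0)" if "y \<in> I" for y
  proof -
    have "W' y x0 = (\<Sum>x\<in>I. cnj (\<eta> y x) * (\<Sum>z\<in>I. W x z * v z))"
      unfolding W'_def form_def by (simp add: \<eta>(2) sum_distrib_left mult.assoc)
    also have "\<dots> = c * ip I (\<eta> y) (\<eta> x0)"
      unfolding ip_def sum_distrib_left[of c] by (intro sum.cong refl) (simp add: v \<eta>(2))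
    finally show ?thesis using that I by (simp add: onb_ip[OF \<eta>(1)])
  qed
  have "c = cnj c" using herm[of x0 x0] col[OF I(2)] by simp
  then have cr: "of_real (Re c) = c" by (simp add: complex_eq_iff)
  have row: "W' x0 y = c * of_bool (y = x0)" if "y \<in> I" for y
    using col[OF that] herm[of x0 y] cr by (metis complex_cnj_complex_of_real complex_cnj_mult cnj_of_bool)
  obtain \<phi> a where \<phi>: "spectral J J W' \<phi> a" using insert.IH[of W'] herm by blast
  have o: "onb J J \<phi>" using \<phi> by (simp add: spectral_def)
  define \<phi>' where "\<phi>' = (\<lambda>k x. if k = x0 then of_bool (x = x0) else if x = x0 then 0 else \<phi> k x)"
  define a' where "a' = a(x0 := Re c)"
  have xJ: "x \<noteq> x0" if "x \<in> J" for x using that insert.hyps by auto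
  have s: "(\<Sum>x\<in>I. f x) = f x0 + (\<Sum>x\<in>J. f x)" for f :: "'a \<Rightarrow> complex"
    using insert.hyps by (simp add: I_def)
  have S: "k \<in> I \<longleftrightarrow> k = x0 \<or> (k \<in> J \<and> k \<noteq> x0)" for k using insert.hyps by (auto simp: I_def)
  have \<phi>J: "\<phi>' k x = \<phi> k x" "\<phi>' k x0 = 0" "\<phi>' x0 x = 0" if "k \<in> J" "x \<in> J" for k x
    using that xJ by (auto simp: \<phi>'_def)
  have "onb I I \<phi>'"
    unfolding onb_def ip_def
  proof (intro conjI ballI I(1))
    fix k l assume "k \<in> I" "l \<in> I"
    then show "(\<Sum>x\<in>I. cnj (\<phi>' k x) * \<phi>' l x) = of_bool (k = l)"
      using onb_ip[OF o, unfolded ip_def, of k l] unfolding s S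
      by (auto simp: \<phi>'_def xJ cong: sum.cong_simp)
  next
    fix x y assume "x \<in> I" "y \<in> I"
    then show "(\<Sum>k\<in>I. \<phi>' k x * cnj (\<phi>' k y)) = of_bool (x = y)"
      using onb_complete[OF o, of x y] unfolding s S
      by (auto simp: \<phi>'_def xJ cong: sum.cong_simp)
  qed
  moreover have "W' x y = (\<Sum>k\<in>I. of_real (a' k) * \<phi>' k x * cnj (\<phi>' k y))" if "x \<in> I" "y \<in> I" for x y
  proof -
    have J: "W' x y = (\<Sum>k\<in>J. of_real (a' k) * \<phi>' k x * cnj (\<phi>' k y))" if "x \<in> J" "y \<in> J"
    proof -
      have "W' x y = (\<Sum>k\<in>J. of_real (a k) * \<phi> k x * cnj (\<phi> k y))"
        using \<phi> that by (simp add: spectral_def)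
      also have "\<dots> = (\<Sum>k\<in>J. of_real (a' k) * \<phi>' k x * cnj (\<phi>' k y))"
        by (rule sum.cong) (use that xJ in \<open>auto simp: \<phi>J a'_def\<close>)
      finally show ?thesis .
    qed
    have z: "(\<Sum>k\<in>J. of_real (a' k) * \<phi>' k x * cnj (\<phi>' k y)) = 0" if "x = x0 \<or> y = x0"
      by (rule sum.neutral) (use that xJ in \<open>auto simp: \<phi>'_def\<close>)
    show ?thesis
    proof (cases "x = x0 \<or> y = x0")
      case True
      then show ?thesis using z col row that cr unfolding s by (auto simp: \<phi>'_def a'_def)
    next
      case False
      then show ?thesis using J that unfolding s S by (auto simp: \<phi>'_def)
    qed
  qed
  ultimately have "spectral I I W' \<phi>' a'" by (simp add: spectral_def)
  from spectral_rotate[OF \<eta>(1) _ this, of W] show ?case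
    unfolding W'_def I_def[symmetric] by blast
qed

lemma psd_spectral:
  assumes "finite I" "psd_on I W"
  shows "\<exists>\<phi> a. spectral I I W \<phi> a \<and> (\<forall>k\<in>I. a k \<ge> 0)"
proof -
  obtain \<phi> a where s: "spectral I I W \<phi> a"
    using spectral_theorem[OF assms(1)] psd_on_hermitian[OF assms] by blast
  have "a k \<ge> 0" if "k \<in> I" for k
    using assms(2) spectral_eigenform(3)[OF s that] unfolding psd_on_def by (metis Re_complex_of_real)
  then show ?thesis using s by blast
qed

section \<open>Entropy as a function of the eigenvalues\<close>

lemma mset_linear_factors_eq:
  fixes as bs :: "complex list"
  assumes "(\<Prod>a\<leftarrow>as. [:- a, 1:]) = (\<Prod>b\<leftarrow>bs. [:- b, 1:])"
  shows "mset as = mset bs"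
proof -
  have "proots (\<Prod>a\<leftarrow>as. [:- a, 1:]) = mset as" for as :: "complex list"
  proof (induction as)
    case (Cons x xs)
    have "(\<Prod>a\<leftarrow>xs. [:- a, 1:]) \<noteq> 0" by (auto simp: prod_list_zero_iff)
    then show ?case using Cons by (simp add: proots_mult del: mult_pCons_left)
  qed simp
  then show ?thesis using assms by metis
qed

text \<open>\<open>eigs\<close> is an arbitrary choice of a list, but any two factorisations into
  linear factors agree as multisets, and the entropy sees only the multiset.\<close>

lemma vn_entropy_factors:
  assumes "char_poly A = (\<Prod>a\<leftarrow>as. [:- a, 1:])"
  shows "vn_entropy A = - (\<Sum>a\<leftarrow>as. Re a * ln (Re a))"
proof -
  have "char_poly A = (\<Prod>a\<leftarrow>eigs A. [:- a, 1:])"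
    unfolding eigs_def by (rule someI[where P = "\<lambda>as. char_poly A = (\<Prod>a\<leftarrow>as. [:- a, 1:])"], fact)
  then have m: "mset (eigs A) = mset as" using assms mset_linear_factors_eq by metis
  have "(\<Sum>a\<leftarrow>eigs A. Re a * ln (Re a)) = (\<Sum>a\<leftarrow>as. Re a * ln (Re a))"
    using arg_cong[OF m, of "\<lambda>M. sum_mset (image_mset (\<lambda>a. Re a * ln (Re a)) M)"]
    by (simp only: mset_map[symmetric] sum_mset_sum_list)
  then show ?thesis by (simp add: vn_entropy_def)
qed

text \<open>Spectral data make \<open>A\<close> similar to a diagonal matrix, whose characteristic
  polynomial shows the eigenvalues. All later entropies are computed through this.\<close>

lemma vn_entropy_spectral:
  assumes A: "A \<in> carrier_mat n n" and s: "spectral {..<n} K (\<lambda>x y. A $$ (x,y)) \<phi> a"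
  shows "vn_entropy A = - (\<Sum>k\<in>K. a k * ln (a k))"
proof -
  have o: "onb {..<n} K \<phi>" using s by (simp add: spectral_def)
  then have fK: "finite K" by (simp add: onb_def)
  have "card K = n" using onb_card[OF o] by simp
  then obtain h where h: "bij_betw h {0..<n} K" using ex_bij_betw_nat_finite[OF fK] by auto
  have hK: "h i \<in> K" if "i < n" for i using h that by (auto simp: bij_betw_def)
  have hinj: "h i = h j \<longleftrightarrow> i = j" if "i < n" "j < n" for i j
    using h that by (auto simp: bij_betw_def inj_on_def)
  define P where "P = mat n n (\<lambda>(x,i). \<phi> (h i) x)"
  define Q where "Q = mat n n (\<lambda>(i,x). cnj (\<phi> (h i) x))"
  define D where "D = mat n n (\<lambda>(i,j). if i = j then of_real (a (h i)) else (0::complex))"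
  have car: "P \<in> carrier_mat n n" "Q \<in> carrier_mat n n" "D \<in> carrier_mat n n"
    by (auto simp: P_def Q_def D_def)
  have sK: "(\<Sum>i=0..<n. f (h i)) = (\<Sum>k\<in>K. f k)" for f :: "'a \<Rightarrow> complex"
    by (rule sum.reindex_bij_betw[OF h])
  have PQ: "P * Q = 1\<^sub>m n"
  proof (rule eq_matI)
    fix i j assume "i < dim_row (1\<^sub>m n :: complex mat)" "j < dim_col (1\<^sub>m n :: complex mat)"
    then show "(P * Q) $$ (i,j) = 1\<^sub>m n $$ (i,j)"
      using onb_complete[OF o, of i j] sK[of "\<lambda>k. \<phi> k i * cnj (\<phi> k j)"]
      by (simp add: P_def Q_def scalar_prod_def)
  qed (simp_all add: P_def Q_def)
  have QP: "Q * P = 1\<^sub>m n"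
  proof (rule eq_matI)
    fix i j assume "i < dim_row (1\<^sub>m n :: complex mat)" "j < dim_col (1\<^sub>m n :: complex mat)"
    then show "(Q * P) $$ (i,j) = 1\<^sub>m n $$ (i,j)"
      using onb_ip[OF o hK hK, of i j] hinj
      by (simp add: P_def Q_def scalar_prod_def ip_def atLeast0LessThan)
  qed (simp_all add: P_def Q_def)
  have APD: "A = P * D * Q"
  proof (rule eq_matI)
    fix x y assume "x < dim_row (P * D * Q)" "y < dim_col (P * D * Q)"
    then have xy: "x < n" "y < n" by (auto simp: P_def Q_def)
    have "A $$ (x,y) = (\<Sum>i=0..<n. of_real (a (h i)) * \<phi> (h i) x * cnj (\<phi> (h i) y))"
      using s xy unfolding sK[of "\<lambda>k. of_real (a k) * \<phi> k x * cnj (\<phi> k y)"] by (simp add: spectral_def)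
    also have "\<dots> = (P * D * Q) $$ (x,y)"
      using xy by (simp add: P_def D_def Q_def scalar_prod_def if_distrib mult.commute cong: if_cong)
    finally show "A $$ (x,y) = (P * D * Q) $$ (x,y)" .
  qed (use A car in auto)
  have "similar_mat A D"
    unfolding similar_mat_def using similar_mat_witI[OF PQ QP APD A car(3,1,2)] by blast
  then have "char_poly A = char_poly D" by (rule char_poly_similar)
  also have "\<dots> = (\<Prod>a\<leftarrow>diag_mat D. [:- a, 1:])"
    by (rule char_poly_upper_triangular[OF car(3)]) (auto simp: upper_triangular_def D_def)
  finally have "vn_entropy A = - (\<Sum>a\<leftarrow>diag_mat D. Re a * ln (Re a))" by (rule vn_entropy_factors)
  also have "(\<Sum>a\<leftarrow>diag_mat D. Re a * ln (Re a)) = (\<Sum>i=0..<n. a (h i) * ln (a (h i)))"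
    by (simp add: diag_mat_def D_def sum_list_sum_nth)
  also have "\<dots> = (\<Sum>k\<in>K. a k * ln (a k))" by (rule sum.reindex_bij_betw[OF h])
  finally show ?thesis .
qed

section \<open>Relative entropy of mixtures\<close>

text \<open>The left side is the tangent of \<open>x * ln x\<close> at \<open>y\<close>; that it
  lies below is \<open>ln z <= z - 1\<close> at \<open>z = y / x\<close>.\<close>

lemma xlnx_tangent:
  fixes x y :: real
  assumes "x \<ge> 0" "y > 0"
  shows "x * ln y + (x - y) \<le> x * ln x"
proof (cases "x = 0")
  case False
  with assms have x: "x > 0" by simp
  have "ln (y / x) \<le> y / x - 1" using x assms by (intro ln_le_minus_one) simp
  then have "x * (ln y - ln x) \<le> x * (y / x - 1)" using x assms by (simp add: ln_div)
  then show ?thesis using x by (simp add: algebra_simps)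
qed (use assms in simp)

text \<open>The tangent inequality at the mean is averaged. There is no tangent at a zero mean, but
  then every \<open>p s * x s\<close> vanishes.\<close>

lemma xlnx_jensen:
  fixes p x :: "'s \<Rightarrow> real"
  assumes "finite S" "\<And>s. s \<in> S \<Longrightarrow> p s \<ge> 0" "(\<Sum>s\<in>S. p s) = 1" "\<And>s. s \<in> S \<Longrightarrow> x s \<ge> 0"
  shows "(\<Sum>s\<in>S. p s * x s) * ln (\<Sum>s\<in>S. p s * x s) \<le> (\<Sum>s\<in>S. p s * (x s * ln (x s)))"
proof -
  define y where "y = (\<Sum>s\<in>S. p s * x s)"
  have y0: "y \<ge> 0" unfolding y_def using assms by (intro sum_nonneg) auto
  show ?thesis
  proof (cases "y = 0")
    case True
    then have "p s * x s = 0" if "s \<in> S" for s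
      using assms that sum_nonneg_eq_0_iff[of S "\<lambda>s. p s * x s"] by (auto simp: y_def)
    then have "p s * (x s * ln (x s)) = 0" if "s \<in> S" for s using that by fastforce
    then show ?thesis using True unfolding y_def[symmetric] by simp
  next
    case False
    then have y: "y > 0" using y0 by simp
    have "y * ln y = (\<Sum>s\<in>S. p s * (x s * ln y + (x s - y)))"
    proof -
      have "(\<Sum>s\<in>S. p s * (x s * ln y + (x s - y)))
          = (\<Sum>s\<in>S. p s * x s) * ln y + (\<Sum>s\<in>S. p s * x s) - (\<Sum>s\<in>S. p s) * y"
        by (simp add: sum_distrib_left sum_distrib_right sum.distrib sum_subtractf algebra_simps)
      then show ?thesis using assms(3) by (simp add: y_def)
    qed
    also have "\<dots> \<le> (\<Sum>s\<in>S. p s * (x s * ln (x s)))"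
      using assms y by (intro sum_mono mult_left_mono xlnx_tangent) auto
    finally show ?thesis unfolding y_def .
  qed
qed

lemma onb_overlap_sum:
  assumes "onb I K \<phi>" "onb I L \<chi>"
  shows "k \<in> K \<Longrightarrow> (\<Sum>l\<in>L. (cmod (ip I (\<phi> k) (\<chi> l)))\<^sup>2) = 1"
    and "l \<in> L \<Longrightarrow> (\<Sum>k\<in>K. (cmod (ip I (\<phi> k) (\<chi> l)))\<^sup>2) = 1"
proof -
  assume "k \<in> K"
  then have "(1::complex) = (\<Sum>l\<in>L. ip I (\<phi> k) (\<chi> l) * ip I (\<chi> l) (\<phi> k))"
    using onb_ip[OF assms(1)] onb_parseval[OF assms(2), of "\<phi> k" "\<phi> k"] by simp
  then have "(1::complex) = of_real (\<Sum>l\<in>L. (cmod (ip I (\<phi> k) (\<chi> l)))\<^sup>2)"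
    unfolding ip_mult_cnj by simp
  then show "(\<Sum>l\<in>L. (cmod (ip I (\<phi> k) (\<chi> l)))\<^sup>2) = 1" by (metis of_real_eq_1_iff)
next
  assume "l \<in> L"
  then have "(1::complex) = (\<Sum>k\<in>K. ip I (\<phi> k) (\<chi> l) * ip I (\<chi> l) (\<phi> k))"
    using onb_ip[OF assms(2)] onb_parseval[OF assms(1), of "\<chi> l" "\<chi> l"] by (simp add: mult.commute)
  then have "(1::complex) = of_real (\<Sum>k\<in>K. (cmod (ip I (\<phi> k) (\<chi> l)))\<^sup>2)"
    unfolding ip_mult_cnj by simp
  then show "(\<Sum>k\<in>K. (cmod (ip I (\<phi> k) (\<chi> l)))\<^sup>2) = 1" by (metis of_real_eq_1_iff)
qed

text \<open>The squared overlaps form a doubly stochastic matrix that carries the eigenvalues to the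
  diagonal entries: Jensen uses its row sums, and the column sums then remove it.\<close>

lemma peierls:
  assumes o: "onb I K \<phi>" and s: "spectral I L A \<chi> a" and a: "\<And>l. l \<in> L \<Longrightarrow> a l \<ge> 0"
  shows "(\<Sum>k\<in>K. Re (form I A (\<phi> k) (\<phi> k)) * ln (Re (form I A (\<phi> k) (\<phi> k)))) \<le> (\<Sum>l\<in>L. a l * ln (a l))"
proof -
  have o': "onb I L \<chi>" and L: "finite L" using s by (auto simp: spectral_def onb_def)
  define c where "c = (\<lambda>k l. (cmod (ip I (\<phi> k) (\<chi> l)))\<^sup>2)"
  have f: "Re (form I A (\<phi> k) (\<phi> k)) = (\<Sum>l\<in>L. c k l * a l)" for k
    unfolding spectral_form_self[OF s] by (simp add: c_def mult.commute)
  have "(\<Sum>k\<in>K. Re (form I A (\<phi> k) (\<phi> k)) * ln (Re (form I A (\<phi> k) (\<phi> k))))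
     \<le> (\<Sum>k\<in>K. \<Sum>l\<in>L. c k l * (a l * ln (a l)))"
    unfolding f using L a onb_overlap_sum(1)[OF o o']
    by (intro sum_mono xlnx_jensen) (auto simp: c_def)
  also have "\<dots> = (\<Sum>l\<in>L. (\<Sum>k\<in>K. c k l) * (a l * ln (a l)))"
    by (subst sum.swap) (simp add: sum_distrib_right)
  also have "\<dots> = (\<Sum>l\<in>L. a l * ln (a l))"
    using onb_overlap_sum(2)[OF o o'] by (simp add: c_def)
  finally show ?thesis .
qed

text \<open>A primitive in \<open>T\<close> of \<open>(a - b)\<^sup>2 / ((b + T a) (1 + T)\<^sup>2)\<close>; its increment over \<open>[0, \<infinity>)\<close> is
  \<open>a ln (a / b) - a + b\<close>.\<close>

definition relent_primitive :: "real \<Rightarrow> real \<Rightarrow> real \<Rightarrow> real" where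
  "relent_primitive a b T = a * ln (b + T * a) - a * ln (1 + T) - (b - a) / (1 + T)"

text \<open>The alternative \<open>a = 0 \<and> b = 0\<close> serves eigenvector pairs in the
  kernels of both states; there the primitive is constantly 0.\<close>

lemma relent_primitive_deriv:
  assumes "a \<ge> 0" "b > 0 \<or> a = 0 \<and> b = 0" "T \<ge> 0"
  shows "(relent_primitive a b has_real_derivative (a - b)\<^sup>2 / (b + T * a) / (1 + T)\<^sup>2) (at T)"
proof (cases "b > 0")
  case True
  have p: "b + T * a > 0" "1 + T > 0" using True assms by (auto intro: add_pos_nonneg)
  have "((\<lambda>T. ln (b + T * a)) has_real_derivative a / (b + T * a)) (at T)"
    "((\<lambda>T. ln (1 + T)) has_real_derivative 1 / (1 + T)) (at T)"
    "((\<lambda>T. (b - a) / (1 + T)) has_real_derivative - ((b - a) / (1 + T)\<^sup>2)) (at T)"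
    using p by (auto intro!: derivative_eq_intros simp: power2_eq_square minus_divide_left)
  from DERIV_diff[OF DERIV_diff[OF DERIV_cmult[OF this(1)] DERIV_cmult[OF this(2)]] this(3)]
  have "(relent_primitive a b has_real_derivative
      a * (a / (b + T * a)) - a * (1 / (1 + T)) + (b - a) / (1 + T)\<^sup>2) (at T)"
    by (simp add: relent_primitive_def[abs_def])
  moreover have "a * (a / (b + T * a)) - a * (1 / (1 + T)) + (b - a) / (1 + T)\<^sup>2
     = (a - b)\<^sup>2 / (b + T * a) / (1 + T)\<^sup>2"
  proof -
    define D E where "D = b + T * a" and "E = 1 + T"
    have "a * (a / D) - a * (1 / E) + (b - a) / E\<^sup>2 = (a\<^sup>2 * E\<^sup>2 - a * D * E + (b - a) * D) / D / E\<^sup>2"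
      using p by (simp add: D_def[symmetric] E_def[symmetric] field_simps power2_eq_square)
    also have "a\<^sup>2 * E\<^sup>2 - a * D * E + (b - a) * D = (a - b)\<^sup>2"
      by (simp add: D_def E_def power2_eq_square algebra_simps)
    finally show ?thesis unfolding D_def E_def .
  qed
  ultimately show ?thesis by simp
next
  case False
  then have "relent_primitive a b = (\<lambda>T. 0)" using assms by (auto simp: relent_primitive_def)
  then show ?thesis using False assms by simp
qed

lemma relent_primitive_0: "relent_primitive a b 0 = a * ln b - (b - a)"
  by (simp add: relent_primitive_def)

text \<open>For \<open>a > 0\<close> the logarithms merge into
  \<open>ln ((b + T * a) / (1 + T))\<close>, whose argument is
  \<open>a + (b - a) / (1 + T)\<close>.\<close>

lemma relent_primitive_lim:
  assumes "a \<ge> 0" "b \<ge> 0"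
  shows "(relent_primitive a b \<longlongrightarrow> a * ln a) at_top"
proof -
  have i: "((\<lambda>T::real. 1 / (1 + T)) \<longlongrightarrow> 0) at_top"
    by (intro tendsto_divide_0[OF tendsto_const] filterlim_at_top_imp_at_infinity
        filterlim_tendsto_add_at_top[OF tendsto_const] filterlim_ident)
  have 2: "((\<lambda>T. (b - a) * (1 / (1 + T))) \<longlongrightarrow> 0) at_top"
    using tendsto_mult[OF tendsto_const i, of "b - a"] by simp
  show ?thesis
  proof (cases "a = 0")
    case True
    then show ?thesis using tendsto_minus[OF 2] by (simp add: relent_primitive_def[abs_def] True)
  next
    case False
    then have a: "a > 0" using assms by simp
    have "((\<lambda>T. ln (a + (b - a) * (1 / (1 + T)))) \<longlongrightarrow> ln (a + 0)) at_top"
      using a by (intro tendsto_ln tendsto_add tendsto_const 2) simp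
    then have 1: "((\<lambda>T. a * ln (a + (b - a) * (1 / (1 + T))) - (b - a) * (1 / (1 + T))) \<longlongrightarrow> a * ln (a + 0) - 0) at_top"
      by (intro tendsto_diff tendsto_mult tendsto_const 2)
    have "\<forall>\<^sub>F T in at_top. a * ln (a + (b - a) * (1 / (1 + T))) - (b - a) * (1 / (1 + T)) = relent_primitive a b T"
      using eventually_gt_at_top[of 0]
    proof eventually_elim
      case (elim T)
      have "b + T * a > 0" using a elim assms by (intro add_nonneg_pos) auto
      moreover have "a + (b - a) * (1 / (1 + T)) = (b + T * a) / (1 + T)"
        using elim by (simp add: field_simps)
      ultimately show ?case using elim by (simp add: relent_primitive_def ln_div algebra_simps)
    qed
    from Lim_transform_eventually[OF 1 this] show ?thesis by simp
  qed
qed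

section \<open>Joint convexity of the relative entropy\<close>

text \<open>Positivity at \<open>w - s v\<close> bounds a quadratic expression in \<open>w\<close>
  below by one that is linear in \<open>w\<close>, with a free parameter \<open>s\<close>.\<close>

lemma psd_polarized_bound:
  assumes "finite I" "psd_on I W"
  shows "2 * s * Re (form I W v w) - s\<^sup>2 * Re (form I W v v) \<le> Re (form I W w w)"
proof -
  have "0 \<le> Re (form I W (\<lambda>x. w x - of_real s * v x) (\<lambda>x. w x - of_real s * v x))"
    using assms by (simp add: psd_on_def)
  also have "\<dots> = Re (form I W w w) - 2 * s * Re (form I W v w) + s\<^sup>2 * Re (form I W v v)"
    unfolding form_diff_left form_diff_right form_scale_left form_scale_right
      form_hermitian[OF assms, of w v]
    by (simp add: power2_eq_square algebra_simps)
  finally show ?thesis by simp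
qed

text \<open>The quadratic form inside the integral representation of the relative entropy is a supremum
  over \<open>X\<close> of expressions that are linear in the pair of states; this linearity yields joint
  convexity.\<close>

lemma relent_integrand_bound:
  assumes A: "spectral I K A \<phi> a" and B: "spectral I L B \<psi> b"
    and a: "\<And>k. k \<in> K \<Longrightarrow> a k \<ge> 0" and b: "\<And>l. l \<in> L \<Longrightarrow> b l \<ge> 0"
    and S: "finite S" and W: "\<And>s. s \<in> S \<Longrightarrow> psd_on I (W s)"
    and q: "\<And>s. s \<in> S \<Longrightarrow> q s \<ge> 0" and u: "\<And>s. s \<in> S \<Longrightarrow> u s > 0"
    and AW: "\<And>x y. x \<in> I \<Longrightarrow> y \<in> I \<Longrightarrow> A x y = (\<Sum>s\<in>S. of_real (q s) * W s x y)"
    and BW: "\<And>x y. x \<in> I \<Longrightarrow> y \<in> I \<Longrightarrow> B x y = (\<Sum>s\<in>S. of_real (u s) * W s x y)"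
    and T: "T \<ge> 0"
  shows "(\<Sum>k\<in>K. \<Sum>l\<in>L. (cmod (ip I (\<phi> k) (\<psi> l)))\<^sup>2 * ((a k - b l)\<^sup>2 / (b l + T * a k)))
    \<le> (\<Sum>s\<in>S. Re (\<Sum>x\<in>I. W s x x) * ((q s - u s)\<^sup>2 / (u s + T * q s)))"
proof -
  have o\<phi>: "onb I K \<phi>" and o\<psi>: "onb I L \<psi>" using A B by (auto simp: spectral_def)
  have fin: "finite I" "finite K" "finite L" using o\<phi> o\<psi> by (auto simp: onb_def)
  have fA: "form I A v w = (\<Sum>s\<in>S. of_real (q s) * form I (W s) v w)" for v w
    unfolding form_sum_mat[symmetric] by (intro form_cong AW refl)
  have fB: "form I B v w = (\<Sum>s\<in>S. of_real (u s) * form I (W s) v w)" for v w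
    unfolding form_sum_mat[symmetric] by (intro form_cong BW refl)
  define c where "c = (\<lambda>k l. ip I (\<phi> k) (\<psi> l))"
  \<comment> \<open>\<open>y k l\<close> maximises
    \<open>2 * (a k - b l) * y - (b l + T * a k) * y\<^sup>2\<close>, with the fraction of the claim
    as maximum. If the denominator is 0, both \<open>y k l\<close> and the fraction are 0.\<close>
  define y where "y = (\<lambda>k l. (a k - b l) / (b l + T * a k))"
  \<comment> \<open>The test operator X is the sum of \<open>X k l\<close> |psi_l><phi_k|. Then
    \<open>\<xi> k\<close> is X phi_k, \<open>\<zeta> l\<close> is X^H psi_l, and
    \<open>P V\<close>, \<open>Y V\<close>, \<open>Z V\<close> are the real parts of Tr(X V), Tr(X^H
    V X), Tr(X V X^H). The functional \<open>2 * (P A - P B) - Y B - T * Z A\<close> is linear in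
    the pair of states.\<close>
  define X where "X = (\<lambda>k l. cnj (c k l) * of_real (y k l))"
  define \<xi> where "\<xi> = (\<lambda>k x. \<Sum>l\<in>L. X k l * \<psi> l x)"
  define \<zeta> where "\<zeta> = (\<lambda>l x. \<Sum>k\<in>K. cnj (X k l) * \<phi> k x)"
  define P where "P = (\<lambda>V. \<Sum>k\<in>K. \<Sum>l\<in>L. Re (X k l * form I V (\<phi> k) (\<psi> l)))"
  define Y where "Y = (\<lambda>V. \<Sum>k\<in>K. Re (form I V (\<xi> k) (\<xi> k)))"
  define Z where "Z = (\<lambda>V. \<Sum>l\<in>L. Re (form I V (\<zeta> l) (\<zeta> l)))"
  define \<tau> where "\<tau> = (\<lambda>V. Re (\<Sum>x\<in>I. V x x))"
  have X2: "(cmod (X k l))\<^sup>2 = (cmod (c k l))\<^sup>2 * (y k l)\<^sup>2" for k l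
    by (simp add: X_def norm_mult power_mult_distrib)
  \<comment> \<open>This expands Tr((X - r)^H V (X - r)) >= 0 for a scalar \<open>r\<close>;
    \<open>Z_bound\<close> does the same with the adjoint of X.\<close>
  have Y_bound: "2 * r * P V - r\<^sup>2 * \<tau> V \<le> Y V" if "psd_on I V" for V r
  proof -
    have "(\<Sum>k\<in>K. 2 * r * Re (form I V (\<phi> k) (\<xi> k)) - r\<^sup>2 * Re (form I V (\<phi> k) (\<phi> k))) \<le> Y V"
      unfolding Y_def by (intro sum_mono psd_polarized_bound fin that)
    moreover have "(\<Sum>k\<in>K. Re (form I V (\<phi> k) (\<xi> k))) = P V"
      unfolding P_def \<xi>_def form_sum_right by simp
    moreover have "(\<Sum>k\<in>K. Re (form I V (\<phi> k) (\<phi> k))) = \<tau> V"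
      unfolding \<tau>_def onb_trace[OF o\<phi>, symmetric] by simp
    ultimately show ?thesis by (simp add: sum_subtractf sum_distrib_left[symmetric])
  qed
  have Z_bound: "2 * r * P V - r\<^sup>2 * \<tau> V \<le> Z V" if "psd_on I V" for V r
  proof -
    have "(\<Sum>l\<in>L. 2 * r * Re (form I V (\<psi> l) (\<zeta> l)) - r\<^sup>2 * Re (form I V (\<psi> l) (\<psi> l))) \<le> Z V"
      unfolding Z_def by (intro sum_mono psd_polarized_bound fin that)
    moreover have "(\<Sum>l\<in>L. Re (form I V (\<psi> l) (\<zeta> l))) = P V"
    proof -
      have "Re (form I V (\<psi> l) (\<zeta> l)) = (\<Sum>k\<in>K. Re (X k l * form I V (\<phi> k) (\<psi> l)))" for l
        unfolding \<zeta>_def form_sum_right form_hermitian[OF fin(1) that, of "\<psi> l"] by simp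
      then show ?thesis unfolding P_def by (subst sum.swap) simp
    qed
    moreover have "(\<Sum>l\<in>L. Re (form I V (\<psi> l) (\<psi> l))) = \<tau> V"
      unfolding \<tau>_def onb_trace[OF o\<psi>, symmetric] by simp
    ultimately show ?thesis by (simp add: sum_subtractf sum_distrib_left[symmetric])
  qed
  have PA: "P A = (\<Sum>s\<in>S. q s * P (W s))"
    unfolding P_def fA by (simp add: sum_distrib_left sum.swap[of _ S K] sum.swap[of _ S L] algebra_simps)
  have PB: "P B = (\<Sum>s\<in>S. u s * P (W s))"
    unfolding P_def fB by (simp add: sum_distrib_left sum.swap[of _ S K] sum.swap[of _ S L] algebra_simps)
  have YB: "Y B = (\<Sum>s\<in>S. u s * Y (W s))"
    unfolding Y_def fB by (simp add: sum_distrib_left sum.swap[of _ S K])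
  have ZA: "Z A = (\<Sum>s\<in>S. q s * Z (W s))"
    unfolding Z_def fA by (simp add: sum_distrib_left sum.swap[of _ S L])
  have Xc: "X k l * c k l = of_real ((cmod (c k l))\<^sup>2 * y k l)" for k l
    using complex_norm_square[of "c k l"] by (simp add: X_def algebra_simps)
  have PA': "P A = (\<Sum>k\<in>K. \<Sum>l\<in>L. (cmod (c k l))\<^sup>2 * (a k * y k l))"
  proof -
    have "Re (X k l * form I A (\<phi> k) (\<psi> l)) = (cmod (c k l))\<^sup>2 * (a k * y k l)" if "k \<in> K" for k l
    proof -
      have "X k l * form I A (\<phi> k) (\<psi> l) = of_real (a k) * (X k l * c k l)"
        unfolding spectral_eigenform(1)[OF A that] c_def by simp
      then show ?thesis unfolding Xc by simp
    qed
    then show ?thesis by (simp add: P_def)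
  qed
  have PB': "P B = (\<Sum>k\<in>K. \<Sum>l\<in>L. (cmod (c k l))\<^sup>2 * (b l * y k l))"
  proof -
    have "Re (X k l * form I B (\<phi> k) (\<psi> l)) = (cmod (c k l))\<^sup>2 * (b l * y k l)" if "l \<in> L" for k l
    proof -
      have "X k l * form I B (\<phi> k) (\<psi> l) = of_real (b l) * (X k l * c k l)"
        unfolding spectral_eigenform(2)[OF B that] c_def by simp
      then show ?thesis unfolding Xc by simp
    qed
    then show ?thesis by (simp add: P_def)
  qed
  have YB': "Y B = (\<Sum>k\<in>K. \<Sum>l\<in>L. (cmod (c k l))\<^sup>2 * (b l * (y k l)\<^sup>2))"
  proof -
    have "ip I (\<xi> k) (\<psi> l) = cnj (X k l)" if "l \<in> L" for k l
      unfolding \<xi>_def ip_sum_left using that fin by (simp add: onb_ip[OF o\<psi>])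
    then show ?thesis unfolding Y_def spectral_form_self[OF B]
      by (simp add: X2 algebra_simps)
  qed
  have ZA': "Z A = (\<Sum>k\<in>K. \<Sum>l\<in>L. (cmod (c k l))\<^sup>2 * (a k * (y k l)\<^sup>2))"
  proof -
    have "ip I (\<zeta> l) (\<phi> k) = X k l" if "k \<in> K" for k l
      unfolding \<zeta>_def ip_sum_left using that fin by (simp add: onb_ip[OF o\<phi>])
    then show ?thesis unfolding Z_def spectral_form_self[OF A]
      by (subst sum.swap) (simp add: X2 algebra_simps)
  qed
  have "(\<Sum>k\<in>K. \<Sum>l\<in>L. (cmod (c k l))\<^sup>2 * ((a k - b l)\<^sup>2 / (b l + T * a k)))
      = 2 * (P A - P B) - Y B - T * Z A"
  proof -
    have "2 * (P A - P B) - Y B - T * Z A = (\<Sum>k\<in>K. \<Sum>l\<in>L. (cmod (c k l))\<^sup>2 *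
        (2 * (a k - b l) * y k l - (b l + T * a k) * (y k l)\<^sup>2))"
      unfolding PA' PB' YB' ZA'
      by (simp add: sum_subtractf[symmetric] sum_distrib_left algebra_simps)
    also have "\<dots> = (\<Sum>k\<in>K. \<Sum>l\<in>L. (cmod (c k l))\<^sup>2 * ((a k - b l)\<^sup>2 / (b l + T * a k)))"
      by (intro sum.cong refl arg_cong2[of _ _ _ _ "(*)"]) (simp add: y_def power2_eq_square)
    finally show ?thesis by simp
  qed
  also have "\<dots> = (\<Sum>s\<in>S. 2 * (q s - u s) * P (W s) - u s * Y (W s) - T * q s * Z (W s))"
    unfolding PA PB YB ZA by (simp add: sum_subtractf sum_distrib_left algebra_simps)
  also have "\<dots> \<le> (\<Sum>s\<in>S. \<tau> (W s) * ((q s - u s)\<^sup>2 / (u s + T * q s)))"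
  proof (rule sum_mono)
    fix s assume s: "s \<in> S"
    define D where "D = u s + T * q s"
    \<comment> \<open>For a single \<open>W s\<close> the functional is largest at a scalar test
      operator, and this \<open>r\<close> is the scalar maximiser for the numbers \<open>q s\<close>
      and \<open>u s\<close>.\<close>
    define r where "r = (q s - u s) / D"
    have D: "D > 0" unfolding D_def using s q u T by (intro add_pos_nonneg) auto
    have "u s * (2 * r * P (W s) - r\<^sup>2 * \<tau> (W s)) \<le> u s * Y (W s)"
      using u[OF s] Y_bound[OF W[OF s]] by (intro mult_left_mono) auto
    moreover have "T * q s * (2 * r * P (W s) - r\<^sup>2 * \<tau> (W s)) \<le> T * q s * Z (W s)"
      using q[OF s] T Z_bound[OF W[OF s]] by (intro mult_left_mono) auto
    ultimately have "2 * (q s - u s) * P (W s) - u s * Y (W s) - T * q s * Z (W s)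
        \<le> 2 * (q s - u s) * P (W s) - D * (2 * r * P (W s) - r\<^sup>2 * \<tau> (W s))"
      unfolding D_def by (simp add: algebra_simps)
    also have "\<dots> = \<tau> (W s) * ((q s - u s)\<^sup>2 / D)"
    proof -
      have 1: "D * r = q s - u s" using D by (simp add: r_def)
      have "D * (2 * r * P (W s) - r\<^sup>2 * \<tau> (W s)) = 2 * (D * r) * P (W s) - (D * r) * r * \<tau> (W s)"
        by (simp add: power2_eq_square algebra_simps)
      then show ?thesis unfolding 1 using D by (simp add: r_def power2_eq_square)
    qed
    finally show "2 * (q s - u s) * P (W s) - u s * Y (W s) - T * q s * Z (W s)
        \<le> \<tau> (W s) * ((q s - u s)\<^sup>2 / (u s + T * q s))" by (simp add: D_def)
  qed
  finally show ?thesis by (simp add: c_def \<tau>_def)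
qed

text \<open>The left side is Tr A (ln A - ln B), the right side the relative entropy of the weights
  with the traces of \<open>W s\<close> as multiplicities. \<open>relent_integrand_bound\<close> is
  integrated over \<open>T\<close> without an integral: the difference \<open>F\<close> of the
  primitives is nondecreasing, so its value at 0 is at most its limit.\<close>

lemma relent_mixture_bound:
  assumes A: "spectral I K A \<phi> a" and B: "spectral I L B \<psi> b"
    and a: "\<And>k. k \<in> K \<Longrightarrow> a k \<ge> 0" and b: "\<And>l. l \<in> L \<Longrightarrow> b l \<ge> 0"
    and S: "finite S" and W: "\<And>s. s \<in> S \<Longrightarrow> psd_on I (W s)"
    and q: "\<And>s. s \<in> S \<Longrightarrow> q s \<ge> 0" and u: "\<And>s. s \<in> S \<Longrightarrow> u s > 0"
    and AW: "\<And>x y. x \<in> I \<Longrightarrow> y \<in> I \<Longrightarrow> A x y = (\<Sum>s\<in>S. of_real (q s) * W s x y)"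
    and BW: "\<And>x y. x \<in> I \<Longrightarrow> y \<in> I \<Longrightarrow> B x y = (\<Sum>s\<in>S. of_real (u s) * W s x y)"
  shows "(\<Sum>k\<in>K. a k * ln (a k)) - (\<Sum>l\<in>L. Re (form I A (\<psi> l) (\<psi> l)) * ln (b l))
    \<le> (\<Sum>s\<in>S. Re (\<Sum>x\<in>I. W s x x) * (q s * ln (q s) - q s * ln (u s)))"
proof -
  have o\<phi>: "onb I K \<phi>" and o\<psi>: "onb I L \<psi>" using A B by (auto simp: spectral_def)
  have fin: "finite I" "finite K" "finite L" using o\<phi> o\<psi> by (auto simp: onb_def)
  have fA: "form I A v w = (\<Sum>s\<in>S. of_real (q s) * form I (W s) v w)" for v w
    unfolding form_sum_mat[symmetric] by (intro form_cong AW refl)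
  have fB: "form I B v w = (\<Sum>s\<in>S. of_real (u s) * form I (W s) v w)" for v w
    unfolding form_sum_mat[symmetric] by (intro form_cong BW refl)
  define c where "c = (\<lambda>k l. (cmod (ip I (\<phi> k) (\<psi> l)))\<^sup>2)"
  define \<tau> where "\<tau> = (\<lambda>s. Re (\<Sum>x\<in>I. W s x x))"
  have A\<psi>: "Re (form I A (\<psi> l) (\<psi> l)) = (\<Sum>k\<in>K. a k * c k l)" for l
    unfolding spectral_form_self[OF A] c_def by (simp add: ip_cnj[symmetric, of I "\<psi> l"])
  \<comment> \<open>Since all \<open>u s\<close> are positive, a null vector of \<open>B\<close> is
    one of every \<open>W s\<close> and so of \<open>A\<close>. Pairs with
    \<open>b l = 0 < a k\<close> therefore have no overlap, and the primitive is differentiated only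
    where it may be.\<close>
  have supp: "a k = 0" if k: "k \<in> K" and l: "l \<in> L" and "b l = 0" "c k l \<noteq> 0" for k l
  proof -
    have "(\<Sum>s\<in>S. u s * Re (form I (W s) (\<psi> l) (\<psi> l))) = 0"
      using arg_cong[OF fB[of "\<psi> l" "\<psi> l"], of Re] spectral_eigenform(3)[OF B l] \<open>b l = 0\<close> by simp
    then have "u s * Re (form I (W s) (\<psi> l) (\<psi> l)) = 0" if "s \<in> S" for s
      using W u S that by (subst (asm) sum_nonneg_eq_0_iff) (auto simp: psd_on_def less_imp_le)
    then have "Re (form I (W s) (\<psi> l) (\<psi> l)) = 0" if "s \<in> S" for s using u that by fastforce
    then have "(\<Sum>k\<in>K. a k * c k l) = 0" unfolding A\<psi>[symmetric] fA by simp
    then have "a k * c k l = 0"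
      using a fin k by (subst (asm) sum_nonneg_eq_0_iff) (auto simp: c_def)
    then show ?thesis using \<open>c k l \<noteq> 0\<close> by simp
  qed
  define F where "F = (\<lambda>T. (\<Sum>s\<in>S. \<tau> s * relent_primitive (q s) (u s) T)
     - (\<Sum>k\<in>K. \<Sum>l\<in>L. c k l * relent_primitive (a k) (b l) T))"
  define F' where "F' = (\<lambda>T. (\<Sum>s\<in>S. \<tau> s * ((q s - u s)\<^sup>2 / (u s + T * q s) / (1 + T)\<^sup>2))
     - (\<Sum>k\<in>K. \<Sum>l\<in>L. c k l * ((a k - b l)\<^sup>2 / (b l + T * a k) / (1 + T)\<^sup>2)))"
  have dc: "((\<lambda>T. c k l * relent_primitive (a k) (b l) T) has_real_derivative
      c k l * ((a k - b l)\<^sup>2 / (b l + T * a k) / (1 + T)\<^sup>2)) (at T)"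
    if "k \<in> K" "l \<in> L" "T \<ge> 0" for k l T
  proof (cases "c k l = 0")
    case False
    then have "b l > 0 \<or> a k = 0 \<and> b l = 0" using supp[OF that(1,2)] b[OF that(2)] by force
    then show ?thesis using a that by (intro DERIV_cmult relent_primitive_deriv) auto
  qed simp
  have dF: "(F has_real_derivative F' T) (at T)" if "T \<ge> 0" for T
    unfolding F_def F'_def using that q u
    by (intro DERIV_diff DERIV_sum dc DERIV_cmult relent_primitive_deriv) auto
  have F'0: "F' T \<ge> 0" if "T \<ge> 0" for T
  proof -
    have "F' T = ((\<Sum>s\<in>S. \<tau> s * ((q s - u s)\<^sup>2 / (u s + T * q s)))
       - (\<Sum>k\<in>K. \<Sum>l\<in>L. c k l * ((a k - b l)\<^sup>2 / (b l + T * a k)))) / (1 + T)\<^sup>2"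
      unfolding F'_def by (simp add: diff_divide_distrib sum_divide_distrib)
    then show ?thesis
      using relent_integrand_bound[OF A B a b S W q u AW BW that] by (simp add: \<tau>_def c_def)
  qed
  have mono: "F 0 \<le> F T" if "T \<ge> 0" for T
    using DERIV_nonneg_imp_nondecreasing[OF that, of F] dF F'0 by blast
  have lim: "(F \<longlongrightarrow> (\<Sum>s\<in>S. \<tau> s * (q s * ln (q s))) - (\<Sum>k\<in>K. \<Sum>l\<in>L. c k l * (a k * ln (a k)))) at_top"
    unfolding F_def using a b q u
    by (intro tendsto_diff tendsto_sum tendsto_mult tendsto_const relent_primitive_lim) (auto simp: less_imp_le)
  have "F 0 \<le> (\<Sum>s\<in>S. \<tau> s * (q s * ln (q s))) - (\<Sum>k\<in>K. \<Sum>l\<in>L. c k l * (a k * ln (a k)))"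
    by (rule tendsto_lowerbound[OF lim]) (rule eventually_mono[OF eventually_ge_at_top mono], simp_all)
  moreover have "F 0 = (\<Sum>s\<in>S. \<tau> s * (q s * ln (u s))) - (\<Sum>k\<in>K. \<Sum>l\<in>L. c k l * (a k * ln (b l)))"
  proof -
    \<comment> \<open>At \<open>T = 0\<close> the primitives also contribute the differences
      \<open>b l - a k\<close> and \<open>u s - q s\<close>; both totals equal Tr B - Tr A and
      cancel.\<close>
    have trA: "(\<Sum>k\<in>K. \<Sum>l\<in>L. c k l * a k) = (\<Sum>s\<in>S. \<tau> s * q s)"
    proof -
      have "(\<Sum>k\<in>K. \<Sum>l\<in>L. c k l * a k) = (\<Sum>k\<in>K. a k)"
        using onb_overlap_sum(1)[OF o\<phi> o\<psi>] by (simp add: c_def sum_distrib_right[symmetric])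
      also have "\<dots> = Re (\<Sum>k\<in>K. form I A (\<phi> k) (\<phi> k))" using spectral_eigenform(3)[OF A] by simp
      also have "\<dots> = (\<Sum>s\<in>S. \<tau> s * q s)"
        unfolding onb_trace[OF o\<phi>] \<tau>_def using AW
        by (simp add: sum_distrib_left sum.swap[of _ S I] mult.commute[of "sum _ _"])
      finally show ?thesis .
    qed
    have trB: "(\<Sum>k\<in>K. \<Sum>l\<in>L. c k l * b l) = (\<Sum>s\<in>S. \<tau> s * u s)"
    proof -
      have "(\<Sum>k\<in>K. \<Sum>l\<in>L. c k l * b l) = (\<Sum>l\<in>L. b l)"
        using onb_overlap_sum(2)[OF o\<phi> o\<psi>] by (subst sum.swap) (simp add: c_def sum_distrib_right[symmetric])
      also have "\<dots> = Re (\<Sum>l\<in>L. form I B (\<psi> l) (\<psi> l))" using spectral_eigenform(3)[OF B] by simp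
      also have "\<dots> = (\<Sum>s\<in>S. \<tau> s * u s)"
        unfolding onb_trace[OF o\<psi>] \<tau>_def using BW
        by (simp add: sum_distrib_left sum.swap[of _ S I] mult.commute[of "sum _ _"])
      finally show ?thesis .
    qed
    show ?thesis using trA trB
      by (simp add: F_def relent_primitive_0 right_diff_distrib sum_subtractf)
  qed
  moreover have "(\<Sum>k\<in>K. \<Sum>l\<in>L. c k l * (a k * ln (a k))) = (\<Sum>k\<in>K. a k * ln (a k))"
    using onb_overlap_sum(1)[OF o\<phi> o\<psi>] by (simp add: c_def sum_distrib_right[symmetric])
  moreover have "(\<Sum>k\<in>K. \<Sum>l\<in>L. c k l * (a k * ln (b l))) = (\<Sum>l\<in>L. Re (form I A (\<psi> l) (\<psi> l)) * ln (b l))"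
    unfolding A\<psi> by (subst sum.swap) (simp add: sum_distrib_left sum_distrib_right algebra_simps)
  moreover have "(\<Sum>s\<in>S. \<tau> s * (q s * ln (q s) - q s * ln (u s)))
     = (\<Sum>s\<in>S. \<tau> s * (q s * ln (q s))) - (\<Sum>s\<in>S. \<tau> s * (q s * ln (u s)))"
    by (simp add: right_diff_distrib sum_subtractf)
  ultimately show ?thesis unfolding \<tau>_def by linarith
qed

section \<open>Phase damping and depolarization\<close>

text \<open>A geometric sum whose ratio, by the bound on \<open>a\<close>, is 1 only at
  \<open>a = 0\<close>.\<close>

lemma sum_roots_of_unity:
  fixes a :: int
  assumes "\<bar>a\<bar> < int N"
  shows "(\<Sum>t<N. cis (2 * pi * (real t * of_int a / real N))) = of_nat N * of_bool (a = 0)"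
proof (cases "a = 0")
  case False
  define z where "z = cis (2 * pi * (of_int a / real N))"
  have N: "N > 0" using assms by auto
  have zt: "cis (2 * pi * (real t * of_int a / real N)) = z ^ t" for t
    unfolding z_def DeMoivre by (simp add: algebra_simps)
  have "z \<noteq> 1"
  proof
    assume "z = 1"
    then have "cos (2 * pi * (of_int a / real N)) = 1" unfolding z_def by (metis cis.sel(1) one_complex.sel(1))
    then obtain k :: int where "2 * pi * (of_int a / real N) = of_int k * 2 * pi"
      using cos_one_2pi_int by blast
    then have "of_int a = of_int k * real N" using N by (simp add: field_simps)
    then have "a = k * int N" by (metis of_int_eq_iff of_int_mult of_int_of_nat_eq)
    with assms False N show False by (auto simp: abs_mult)
  qed
  moreover have "z ^ N = 1"
  proof -
    have "real N * (2 * pi * (of_int a / real N)) = 2 * pi * of_int a" using N by simp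
    then show ?thesis unfolding z_def DeMoivre by (simp only: cis_multiple_2pi Ints_of_int)
  qed
  ultimately have "(\<Sum>t<N. z ^ t) = 0" using geometric_sum[of z N] by simp
  then show ?thesis unfolding zt using False by simp
qed simp

text \<open>The smaller exponent is the 3-adic valuation of the sum, because
  \<open>1 + 3 ^ r\<close> is never divisible by 3, not even at \<open>r = 0\<close>. The other
  exponent follows by cancellation.\<close>

lemma add_powers_of_3_unique:
  fixes a b c e :: nat
  assumes "(3::nat) ^ a + 3 ^ b = 3 ^ c + 3 ^ e"
  shows "a = c \<and> b = e \<or> a = e \<and> b = c"
proof -
  have mult: "multiplicity 3 ((3::nat) ^ a + 3 ^ b) = a" if "a \<le> b" for a b
  proof -
    have "(3::nat) ^ b = 3 ^ a * 3 ^ (b - a)" using that by (simp flip: power_add)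
    then have "(3::nat) ^ a + 3 ^ b = 3 ^ a * (1 + 3 ^ (b - a))" by (simp add: algebra_simps)
    moreover have "\<not> (3::nat) dvd 1 + 3 ^ (b - a)"
    proof (cases "b - a")
      case (Suc r)
      have "\<not> (3::nat) dvd 1 + 3 * 3 ^ r" by presburger
      then show ?thesis by (simp add: Suc)
    next
      case 0
      have "\<not> (3::nat) dvd 1 + 1" by presburger
      then show ?thesis unfolding 0 by simp
    qed
    ultimately show ?thesis by (metis multiplicity_decomposeI one_neq_zero power_eq_0_iff zero_neq_numeral add_is_0)
  qed
  have main: "a = c \<and> b = e" if "(3::nat) ^ a + 3 ^ b = 3 ^ c + 3 ^ e" "a \<le> b" "c \<le> e" for a b c e
  proof -
    have "a = c" using mult[OF that(2)] mult[OF that(3)] that(1) by simp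
    then show ?thesis using that(1) by simp
  qed
  show ?thesis
    using assms main[of a b c e] main[of a b e c] main[of b a c e] main[of b a e c]
    by (metis add.commute le_cases)
qed

text \<open>The phases \<open>3 ^ i\<close> make the bases average to a second moment without accidental
  coincidences: a sum of two powers of 3 determines its summands.\<close>

lemma unbiased_bases_exist:
  assumes d: "d \<ge> 1"
  shows "\<exists>(N::nat) f. N > 0 \<and> (\<forall>t. onb {..<d} {..<d} (f t)) \<and>
    (\<forall>t n i. (cmod (f t n i))\<^sup>2 = 1 / real d) \<and>
    (\<forall>i<d. \<forall>j<d. \<forall>i'<d. \<forall>j'<d.
      (\<Sum>t<N. \<Sum>n<d. f t n i * cnj (f t n j) * (cnj (f t n i') * f t n j'))
        = of_nat N / of_nat d * of_bool (i = j \<and> i' = j' \<or> i = i' \<and> j = j'))"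
proof -
  \<comment> \<open>The modulus must exceed every
    \<open>\<bar>3 ^ i - 3 ^ j - 3 ^ i' + 3 ^ j'\<bar>\<close>; two powers with exponents below
    \<open>d\<close> add up to less than \<open>2 * 3 ^ d\<close>.\<close>
  define N :: nat where "N = 2 * 3 ^ d"
  \<comment> \<open>The first summand is the Fourier phase that makes each family orthonormal; the
    second is a diagonal unitary depending on \<open>t\<close>, which preserves all moduli.\<close>
  define \<theta> where "\<theta> = (\<lambda>t n i. 2 * pi * (real n * real i / real d + real t * 3 ^ i / real N))"
  define f where "f = (\<lambda>t n i. cis (\<theta> t n i) / of_real (sqrt (real d)))"
  have N: "N > 0" by (simp add: N_def)
  have sd: "of_real (sqrt (real d)) * of_real (sqrt (real d)) = (of_nat d :: complex)"
    by (simp flip: of_real_mult)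
  have f2: "f t n i * cnj (f t n' j) = cis (\<theta> t n i - \<theta> t n' j) / of_nat d" for t n i n' j
    by (simp add: f_def cis_cnj cis_divide[symmetric] sd divide_simps mult.commute flip: cis_inverse)
  have f2': "cnj (f t n i) * f t n' j = cis (\<theta> t n' j - \<theta> t n i) / of_nat d" for t n i n' j
    using f2[of t n' j n i] by (simp add: mult.commute)
  have mod: "(cmod (f t n i))\<^sup>2 = 1 / real d" for t n i
    by (simp add: f_def norm_divide power_divide)
  have onb: "onb {..<d} {..<d} (f t)" for t
    unfolding onb_def
  proof (intro conjI ballI)
    fix n n' assume n: "n \<in> {..<d}" "n' \<in> {..<d}"
    have "ip {..<d} (f t n) (f t n') = (\<Sum>i<d. cis (2 * pi * (real i * of_int (int n' - int n) / real d))) / of_nat d"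
      unfolding ip_def f2' \<theta>_def sum_divide_distrib
      by (intro sum.cong refl arg_cong2[of _ _ _ _ "(/)"] arg_cong[of _ _ cis])
        (simp add: algebra_simps diff_divide_distrib)
    also have "\<dots> = of_bool (n = n')"
      using n d by (subst sum_roots_of_unity) auto
    finally show "ip {..<d} (f t n) (f t n') = of_bool (n = n')" .
  next
    fix i j assume n: "i \<in> {..<d}" "j \<in> {..<d}"
    have "(\<Sum>n<d. f t n i * cnj (f t n j)) = (\<Sum>n<d. cis (2 * pi * (real n * of_int (int i - int j) / real d))
        * cis (2 * pi * (real t * (3 ^ i - 3 ^ j) / real N))) / of_nat d"
      unfolding f2 \<theta>_def sum_divide_distrib cis_mult
      by (intro sum.cong refl arg_cong2[of _ _ _ _ "(/)"] arg_cong[of _ _ cis])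
        (simp add: algebra_simps diff_divide_distrib add_divide_distrib)
    also have "\<dots> = of_bool (i = j)"
      unfolding sum_distrib_right[symmetric] using n d by (subst sum_roots_of_unity) auto
    finally show "(\<Sum>n<d. f t n i * cnj (f t n j)) = of_bool (i = j)" .
  qed simp_all
  have avg: "(\<Sum>t<N. \<Sum>n<d. f t n i * cnj (f t n j) * (cnj (f t n i') * f t n j'))
        = of_nat N / of_nat d * of_bool (i = j \<and> i' = j' \<or> i = i' \<and> j = j')"
    if lt: "i < d" "j < d" "i' < d" "j' < d" for i j i' j'
  proof -
    define k :: int where "k = int i - int j - int i' + int j'"
    define l :: int where "l = 3 ^ i - 3 ^ j - 3 ^ i' + 3 ^ j'"
    have pw: "(3::int) ^ i < 3 ^ d" "(3::int) ^ j < 3 ^ d" "(3::int) ^ i' < 3 ^ d" "(3::int) ^ j' < 3 ^ d"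
      using lt by (auto intro: power_strict_increasing)
    have pos: "(3::int) ^ i > 0" "(3::int) ^ j > 0" "(3::int) ^ i' > 0" "(3::int) ^ j' > 0" by auto
    have lN: "\<bar>l\<bar> < int N" using pw pos unfolding l_def N_def abs_less_iff of_nat_mult of_nat_power of_nat_numeral by linarith
    have l0: "l = 0 \<longleftrightarrow> i = j \<and> i' = j' \<or> i = i' \<and> j = j'"
    proof
      assume "l = 0"
      then have "int (3 ^ i + 3 ^ j') = int (3 ^ j + 3 ^ i')" by (simp add: l_def)
      then have "(3::nat) ^ i + 3 ^ j' = 3 ^ j + 3 ^ i'" by (simp only: of_nat_eq_iff)
      from add_powers_of_3_unique[OF this] show "i = j \<and> i' = j' \<or> i = i' \<and> j = j'" by auto
    qed (auto simp: l_def)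
    \<comment> \<open>The sum over \<open>t\<close> leaves only \<open>l = 0\<close>; there
      \<open>k = 0\<close> as well, so the Fourier sum over \<open>n\<close> equals
      \<open>d\<close>.\<close>
    have k0: "k = 0" if "l = 0" using that l0 by (auto simp: k_def)
    have "f t n i * cnj (f t n j) * (cnj (f t n i') * f t n j')
       = cis (2 * pi * (real n * of_int k / real d)) * cis (2 * pi * (real t * of_int l / real N)) / (of_nat d)\<^sup>2" for t n
      unfolding f2 f2' times_divide_times_eq cis_mult power2_eq_square \<theta>_def k_def l_def
      by (intro arg_cong2[of _ _ _ _ "(/)"] arg_cong[of _ _ cis] refl)
        (simp add: algebra_simps diff_divide_distrib add_divide_distrib)
    then have "(\<Sum>t<N. \<Sum>n<d. f t n i * cnj (f t n j) * (cnj (f t n i') * f t n j'))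
       = (\<Sum>n<d. cis (2 * pi * (real n * of_int k / real d))) * (\<Sum>t<N. cis (2 * pi * (real t * of_int l / real N))) / (of_nat d)\<^sup>2"
      by (simp add: sum_product sum_divide_distrib sum.swap[of _ "{..<N}" "{..<d}"])
    also have "(\<Sum>t<N. cis (2 * pi * (real t * of_int l / real N))) = of_nat N * of_bool (l = 0)"
      by (rule sum_roots_of_unity[OF lN])
    finally show ?thesis using d k0 by (cases "l = 0") (auto simp: l0 power2_eq_square)
  qed
  show ?thesis using N onb mod avg by blast
qed

text \<open>\<open>block d w f\<close> is the partial matrix element \<open>\<langle>f|w|f\<rangle>\<close>, an operator on the second factor.\<close>

definition block :: "nat \<Rightarrow> (nat \<times> nat \<Rightarrow> nat \<times> nat \<Rightarrow> complex) \<Rightarrow> (nat \<Rightarrow> complex) \<Rightarrow> nat \<Rightarrow> nat \<Rightarrow> complex" where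
  "block d w f k l = (\<Sum>i<d. \<Sum>j<d. cnj (f i) * f j * w (i,k) (j,l))"

section \<open>Pinching in a basis of the first factor\<close>

definition pinch :: "nat \<Rightarrow> (nat \<Rightarrow> nat \<Rightarrow> complex) \<Rightarrow> (nat \<times> nat \<Rightarrow> nat \<times> nat \<Rightarrow> complex) \<Rightarrow> nat \<times> nat \<Rightarrow> nat \<times> nat \<Rightarrow> complex" where
  "pinch d f w x y = (\<Sum>n<d. f n (fst x) * cnj (f n (fst y)) * block d w (f n) (snd x) (snd y))"

definition tens :: "(nat \<Rightarrow> complex) \<Rightarrow> (nat \<Rightarrow> complex) \<Rightarrow> nat \<times> nat \<Rightarrow> complex" where
  "tens f u x = f (fst x) * u (snd x)"

lemma form_tens:
  "form ({..<d} \<times> {..<m}) w (tens f u) (tens f u') = form {..<m} (block d w f) u u'"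
  unfolding form_def block_def tens_def sum.cartesian_product'
  by (simp add: sum_distrib_left sum_distrib_right sum.swap[of _ "{..<d}" "{..<m}"] algebra_simps)

lemma psd_block:
  assumes "psd_on ({..<d} \<times> {..<m}) w"
  shows "psd_on {..<m} (block d w f)"
  using assms unfolding psd_on_def form_tens[symmetric] by blast

text \<open>The partial inner product of \<open>f\<close> with \<open>v\<close>, adjoint to
  \<open>tens f\<close>; so \<open>tens f (slice d f v)\<close> is |f><f| tensor 1 applied to
  \<open>v\<close>.\<close>

definition slice :: "nat \<Rightarrow> (nat \<Rightarrow> complex) \<Rightarrow> (nat \<times> nat \<Rightarrow> complex) \<Rightarrow> nat \<Rightarrow> complex" where
  "slice d f v k = (\<Sum>i<d. cnj (f i) * v (i,k))"

lemma form_pinch: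
  "form ({..<d} \<times> {..<m}) (pinch d f w) v v'
    = (\<Sum>n<d. form ({..<d} \<times> {..<m}) w (tens (f n) (slice d (f n) v)) (tens (f n) (slice d (f n) v')))"
proof -
  let ?W = "\<lambda>n x y. f n (fst x) * cnj (f n (fst y)) * block d w (f n) (snd x) (snd y)"
  have "form ({..<d} \<times> {..<m}) (pinch d f w) v v' = (\<Sum>n<d. form ({..<d} \<times> {..<m}) (?W n) v v')"
    using form_sum_mat[of "{..<d} \<times> {..<m}" "\<lambda>_. 1" ?W "{..<d}" v v'] by (simp add: pinch_def[abs_def])
  also have "\<dots> = (\<Sum>n<d. form {..<m} (block d w (f n)) (slice d (f n) v) (slice d (f n) v'))"
    unfolding form_def slice_def sum.cartesian_product'
    by (rule sum.cong[OF refl])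
      (simp add: sum_distrib_left sum_distrib_right sum.swap[of _ "{..<d}" "{..<m}"] algebra_simps)
  finally show ?thesis unfolding form_tens .
qed

lemma tens_reconstruct:
  assumes "onb {..<d} {..<d} f" "x \<in> {..<d} \<times> {..<m}"
  shows "v x = (\<Sum>n<d. 1 * tens (f n) (slice d (f n) v) x)"
proof -
  have "(\<Sum>n<d. 1 * tens (f n) (slice d (f n) v) x)
     = (\<Sum>i<d. (\<Sum>n<d. f n (fst x) * cnj (f n i)) * v (i, snd x))"
    unfolding tens_def slice_def sum_distrib_left sum_distrib_right by (subst sum.swap) (simp add: mult.assoc)
  also have "\<dots> = v x" using assms(2) by (auto simp: onb_complete[OF assms(1)])
  finally show ?thesis by simp
qed

text \<open>A Cauchy-Schwarz inequality for the form, obtained by summing its nonnegative values at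
  all differences \<open>p n - p n'\<close>.\<close>

lemma psd_form_sum_le:
  assumes "finite I" "psd_on I w"
  shows "Re (form I w (\<lambda>x. \<Sum>n<d. 1 * p n x) (\<lambda>x. \<Sum>n<d. 1 * p n x))
    \<le> real d * (\<Sum>n<d. Re (form I w (p n) (p n)))"
proof -
  define g where "g = (\<lambda>n n'. Re (form I w (p n) (p n')))"
  have sym: "g n n' = g n' n" for n n'
    unfolding g_def by (metis form_hermitian[OF assms] cnj.sel(1))
  have "0 \<le> g n n + g n' n' - 2 * g n n'" for n n'
    using psd_polarized_bound[OF assms, of 1 "p n" "p n'"] by (simp add: g_def)
  then have "0 \<le> (\<Sum>n<d. \<Sum>n'<d. g n n + g n' n' - 2 * g n n')" by (intro sum_nonneg) auto
  also have "\<dots> = 2 * (real d * (\<Sum>n<d. g n n) - (\<Sum>n<d. \<Sum>n'<d. g n n'))"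
    by (simp add: sum.distrib sum_subtractf sum_distrib_left)
  also have "(\<Sum>n<d. \<Sum>n'<d. g n n') = Re (form I w (\<lambda>x. \<Sum>n<d. 1 * p n x) (\<lambda>x. \<Sum>n<d. 1 * p n x))"
    unfolding form_sum_left form_sum_right g_def by simp
  finally show ?thesis by (simp add: g_def)
qed

text \<open>The pinching inequality: \<open>v\<close> is the sum of its \<open>d\<close> projections
  along the basis \<open>f\<close>, and the pinching adds up the forms of \<open>w\<close> at these
  projections.\<close>

lemma psd_pinch:
  assumes "onb {..<d} {..<d} f" "psd_on ({..<d} \<times> {..<m}) w"
  shows "psd_on ({..<d} \<times> {..<m}) (\<lambda>x y. of_nat d * pinch d f w x y - w x y)"
proof -
  let ?I = "{..<d} \<times> {..<m}"
  have F: "form ?I (\<lambda>x y. of_nat d * pinch d f w x y - w x y) v v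
     = of_nat d * form ?I (pinch d f w) v v - form ?I w v v" for v
    using form_add_mat[of ?I "\<lambda>x y. of_nat d * pinch d f w x y" "\<lambda>x y. (-1) * w x y" v v]
    unfolding form_scale_mat by simp
  have R: "form ?I w v v = form ?I w (\<lambda>x. \<Sum>n<d. 1 * tens (f n) (slice d (f n) v) x)
     (\<lambda>x. \<Sum>n<d. 1 * tens (f n) (slice d (f n) v) x)" for v
    by (intro form_cong tens_reconstruct[OF assms(1)] refl)
  have "Im (form ?I (pinch d f w) v v) = 0" for v
    unfolding form_pinch using assms(2) by (simp add: psd_on_def)
  moreover have "Re (form ?I w v v) \<le> real d * Re (form ?I (pinch d f w) v v)" for v
    unfolding form_pinch R[of v] Re_sum by (intro psd_form_sum_le) (use assms(2) in auto)
  ultimately show ?thesis using assms(2) unfolding psd_on_def F by simp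
qed

lemma spectral_pinch:
  assumes f: "onb {..<d} {..<d} f"
    and \<chi>: "\<And>n. n < d \<Longrightarrow> spectral {..<m} {..<m} (block d w (f n)) (\<chi> n) (\<beta> n)"
  shows "spectral ({..<d} \<times> {..<m}) ({..<d} \<times> {..<m}) (pinch d f w)
    (\<lambda>nl. tens (f (fst nl)) (\<chi> (fst nl) (snd nl))) (\<lambda>nl. \<beta> (fst nl) (snd nl))"
proof -
  let ?I = "{..<d} \<times> {..<m}"
  have o: "onb {..<m} {..<m} (\<chi> n)" if "n < d" for n using \<chi>[OF that] by (simp add: spectral_def)
  have "onb ?I ?I (\<lambda>nl. tens (f (fst nl)) (\<chi> (fst nl) (snd nl)))"
    unfolding onb_def
  proof (intro conjI ballI)
    fix a b assume ab: "a \<in> ?I" "b \<in> ?I"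
    have "ip ?I (tens (f (fst a)) (\<chi> (fst a) (snd a))) (tens (f (fst b)) (\<chi> (fst b) (snd b)))
       = ip {..<d} (f (fst a)) (f (fst b)) * ip {..<m} (\<chi> (fst a) (snd a)) (\<chi> (fst b) (snd b))"
      unfolding ip_def sum.cartesian_product' sum_product tens_def by (simp add: algebra_simps)
    then show "ip ?I (tens (f (fst a)) (\<chi> (fst a) (snd a))) (tens (f (fst b)) (\<chi> (fst b) (snd b))) = of_bool (a = b)"
      using ab onb_ip[OF f, of "fst a" "fst b"] onb_ip[OF o, of "fst a" "snd a" "snd b"]
      by (auto simp: prod_eq_iff)
  next
    fix x y assume xy: "x \<in> ?I" "y \<in> ?I"
    have "(\<Sum>k\<in>?I. tens (f (fst k)) (\<chi> (fst k) (snd k)) x * cnj (tens (f (fst k)) (\<chi> (fst k) (snd k)) y))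
       = (\<Sum>n<d. f n (fst x) * cnj (f n (fst y)) * (\<Sum>l<m. \<chi> n l (snd x) * cnj (\<chi> n l (snd y))))"
      unfolding sum.cartesian_product' tens_def by (simp add: sum_distrib_left algebra_simps)
    also have "\<dots> = (\<Sum>n<d. f n (fst x) * cnj (f n (fst y)) * of_bool (snd x = snd y))"
      using xy by (intro sum.cong refl arg_cong2[of _ _ _ _ "(*)"] onb_complete[OF o]) auto
    also have "\<dots> = of_bool (x = y)"
      unfolding sum_distrib_right[symmetric] using xy
      by (subst onb_complete[OF f]) (auto simp: prod_eq_iff)
    finally show "(\<Sum>k\<in>?I. tens (f (fst k)) (\<chi> (fst k) (snd k)) x * cnj (tens (f (fst k)) (\<chi> (fst k) (snd k)) y)) = of_bool (x = y)" .
  qed simp_all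
  moreover have "pinch d f w x y = (\<Sum>k\<in>?I. of_real (\<beta> (fst k) (snd k)) * tens (f (fst k)) (\<chi> (fst k) (snd k)) x * cnj (tens (f (fst k)) (\<chi> (fst k) (snd k)) y))"
    if xy: "x \<in> ?I" "y \<in> ?I" for x y
  proof -
    have "pinch d f w x y = (\<Sum>n<d. f n (fst x) * cnj (f n (fst y)) * (\<Sum>l<m. of_real (\<beta> n l) * \<chi> n l (snd x) * cnj (\<chi> n l (snd y))))"
      unfolding pinch_def using xy \<chi>
      by (intro sum.cong refl arg_cong2[of _ _ _ _ "(*)"]) (auto simp: spectral_def)
    then show ?thesis
      unfolding sum.cartesian_product' tens_def by (simp add: sum_distrib_left algebra_simps)
  qed
  ultimately show ?thesis by (simp add: spectral_def)
qed

text \<open>The relative entropy of \<open>A\<close> to D(w) is S(D(w)) - S(A), because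
  \<open>A\<close> and \<open>w\<close> have the same pinching. The weights on \<open>w\<close> and
  \<open>V\<close> are \<open>q0\<close>, \<open>q1\<close> for \<open>A\<close> and twice
  \<open>1 / d\<close> for D(w), and \<open>\<beta>\<close> lists the eigenvalues of D(w).\<close>

lemma phase_damping_entropy:
  assumes d: "d \<ge> 1" and f: "onb {..<d} {..<d} f" and w: "psd_on ({..<d} \<times> {..<m}) w"
    and tr: "(\<Sum>x\<in>{..<d} \<times> {..<m}. w x x) = 1"
    and \<chi>: "\<And>n. n < d \<Longrightarrow> spectral {..<m} {..<m} (block d w (f n)) (\<chi> n) (\<beta> n)"
    and \<beta>: "\<And>n l. n < d \<Longrightarrow> l < m \<Longrightarrow> \<beta> n l \<ge> 0"
    and q: "q0 \<ge> 0" "q1 \<ge> 0" "q0 + (real d - 1) * q1 = 1"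
    and A: "spectral ({..<d} \<times> {..<m}) K A \<phi> a" and a: "\<And>k. k \<in> K \<Longrightarrow> a k \<ge> 0"
    and Aw: "\<And>x y. A x y = of_real (q0 - q1) * w x y + of_real (q1 * real d) * pinch d f w x y"
  shows "(\<Sum>k\<in>K. a k * ln (a k))
    \<le> (\<Sum>n<d. \<Sum>l<m. \<beta> n l * ln (\<beta> n l)) + (q0 * ln q0 + (real d - 1) * (q1 * ln q1) + ln (real d))"
proof -
  let ?I = "{..<d} \<times> {..<m}"
  let ?\<psi> = "\<lambda>nl. tens (f (fst nl)) (\<chi> (fst nl) (snd nl))"
  let ?b = "\<lambda>nl. \<beta> (fst nl) (snd nl)"
  define V where "V = (\<lambda>x y. of_nat d * pinch d f w x y - w x y)"
  define W where "W = (\<lambda>s. if s then w else V)"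
  define qs where "qs = (\<lambda>s. if s then q0 else q1)"
  note B = spectral_pinch[OF f \<chi>]
  have o: "onb ?I ?I ?\<psi>" using B by (simp add: spectral_def)
  have fw: "form ?I w (?\<psi> nl) (?\<psi> nl) = of_real (?b nl)" if "nl \<in> ?I" for nl
    unfolding form_tens using that by (intro spectral_eigenform(3)[OF \<chi>]) auto
  have fB: "form ?I (pinch d f w) (?\<psi> nl) (?\<psi> nl) = of_real (?b nl)" if "nl \<in> ?I" for nl
    by (rule spectral_eigenform(3)[OF B that])
  \<comment> \<open>In the eigenbasis of the pinching, \<open>w\<close> and its pinching have equal
    diagonals, and the coefficients \<open>q0 - q1\<close> and \<open>q1 * d\<close> add up to
    1.\<close>
  have fA: "Re (form ?I A (?\<psi> nl) (?\<psi> nl)) = ?b nl" if "nl \<in> ?I" for nl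
  proof -
    have "form ?I A (?\<psi> nl) (?\<psi> nl) = of_real (q0 - q1) * form ?I w (?\<psi> nl) (?\<psi> nl)
       + of_real (q1 * real d) * form ?I (pinch d f w) (?\<psi> nl) (?\<psi> nl)"
      unfolding form_scale_mat[symmetric] form_add_mat[symmetric] Aw[symmetric] ..
    also have "\<dots> = of_real ((q0 + (real d - 1) * q1) * ?b nl)"
      unfolding fw[OF that] fB[OF that] by (simp add: algebra_simps)
    finally show ?thesis using q(3) by simp
  qed
  have trB: "(\<Sum>x\<in>?I. pinch d f w x x) = 1"
    unfolding onb_trace[OF o, symmetric] tr[symmetric] by (intro sum.cong refl) (simp only: fw fB)
  have trV: "(\<Sum>x\<in>?I. V x x) = of_nat d - 1"
    unfolding V_def sum_subtractf sum_distrib_left[symmetric] trB tr by simp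
  have "(\<Sum>k\<in>K. a k * ln (a k)) - (\<Sum>nl\<in>?I. Re (form ?I A (?\<psi> nl) (?\<psi> nl)) * ln (?b nl))
     \<le> (\<Sum>s\<in>UNIV. Re (\<Sum>x\<in>?I. W s x x) * (qs s * ln (qs s) - qs s * ln (1 / real d)))"
  proof (rule relent_mixture_bound[where W = W and q = qs and u = "\<lambda>_. 1 / real d", OF A B a])
    show "psd_on ?I (W s)" for s using w psd_pinch[OF f w] by (simp add: W_def V_def)
    show "A x y = (\<Sum>s\<in>UNIV. of_real (qs s) * W s x y)" for x y
      unfolding Aw by (simp add: UNIV_bool qs_def W_def V_def algebra_simps)
    show "pinch d f w x y = (\<Sum>s\<in>UNIV. of_real (1 / real d) * W s x y)" for x y
      using d by (simp add: UNIV_bool W_def V_def field_simps)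
  qed (use d q \<beta> in \<open>auto simp: qs_def\<close>)
  also have "\<dots> = q0 * ln q0 + (real d - 1) * (q1 * ln q1) + (q0 + (real d - 1) * q1) * ln (real d)"
    using d by (simp add: UNIV_bool qs_def W_def tr trV ln_div algebra_simps del: Re_sum)
  finally have "(\<Sum>k\<in>K. a k * ln (a k)) - (\<Sum>nl\<in>?I. ?b nl * ln (?b nl))
     \<le> q0 * ln q0 + (real d - 1) * (q1 * ln q1) + ln (real d)"
    unfolding q(3) by (simp add: fA)
  then show ?thesis by (simp add: sum.cartesian_product')
qed

section \<open>From phase damping to depolarization\<close>

lemma onb_twist:
  assumes "onb I K \<phi>" "\<And>x. x \<in> I \<Longrightarrow> cmod (g x) = 1"
  shows "onb I K (\<lambda>k x. cnj (g x) * \<phi> k x)"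
proof -
  have g: "cnj (g x) * g x = 1" if "x \<in> I" for x
    using complex_norm_square[of "g x"] assms(2)[OF that] by (simp add: mult.commute)
  have 1: "ip I (\<lambda>x. cnj (g x) * \<phi> k x) (\<lambda>x. cnj (g x) * \<phi> l x) = ip I (\<phi> k) (\<phi> l)" for k l
    unfolding ip_def
  proof (rule sum.cong[OF refl])
    fix x assume "x \<in> I"
    have "cnj (cnj (g x) * \<phi> k x) * (cnj (g x) * \<phi> l x) = (cnj (g x) * g x) * (cnj (\<phi> k x) * \<phi> l x)"
      by (simp add: algebra_simps)
    then show "cnj (cnj (g x) * \<phi> k x) * (cnj (g x) * \<phi> l x) = cnj (\<phi> k x) * \<phi> l x"
      using g[OF \<open>x \<in> I\<close>] by simp
  qed
  have 2: "(\<Sum>k\<in>K. cnj (g x) * \<phi> k x * cnj (cnj (g y) * \<phi> k y)) = of_bool (x = y)" if "x \<in> I" "y \<in> I" for x y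
  proof -
    have "(\<Sum>k\<in>K. cnj (g x) * \<phi> k x * cnj (cnj (g y) * \<phi> k y))
       = cnj (g x) * g y * (\<Sum>k\<in>K. \<phi> k x * cnj (\<phi> k y))"
      by (simp add: sum_distrib_left algebra_simps)
    then show ?thesis using that g by (simp add: onb_complete[OF assms(1)])
  qed
  show ?thesis using assms(1) 1 2 unfolding onb_def by simp
qed

lemma pinch_average:
  assumes x: "i < d" "j < d" and d: "d \<ge> 1"
    and f: "\<And>i j i' j'. i < d \<Longrightarrow> j < d \<Longrightarrow> i' < d \<Longrightarrow> j' < d \<Longrightarrow>
      (\<Sum>t<N. \<Sum>n<d. f t n i * cnj (f t n j) * (cnj (f t n i') * f t n j'))
        = of_nat N / of_nat d * of_bool (i = j \<and> i' = j' \<or> i = i' \<and> j = j')"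
  shows "(\<Sum>t<N. pinch d (f t) w (i,k) (j,l)) = of_nat N / of_nat d *
    (of_bool (i = j) * (\<Sum>i'<d. w (i',k) (i',l)) + w (i,k) (j,l) - of_bool (i = j) * w (i,k) (j,l))"
proof -
  have "(\<Sum>t<N. pinch d (f t) w (i,k) (j,l)) = (\<Sum>i'<d. \<Sum>j'<d.
      (\<Sum>t<N. \<Sum>n<d. f t n i * cnj (f t n j) * (cnj (f t n i') * f t n j')) * w (i',k) (j',l))"
  proof -
    have "pinch d (f t) w (i,k) (j,l) = (\<Sum>i'<d. \<Sum>j'<d. \<Sum>n<d.
        f t n i * cnj (f t n j) * (cnj (f t n i') * f t n j') * w (i',k) (j',l))" for t
      unfolding pinch_def block_def fst_conv snd_conv sum_distrib_left
      by (subst sum.swap, rule sum.cong[OF refl], subst sum.swap) (simp add: mult.assoc)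
    then have "(\<Sum>t<N. pinch d (f t) w (i,k) (j,l)) = (\<Sum>t<N. \<Sum>i'<d. \<Sum>j'<d. \<Sum>n<d.
        f t n i * cnj (f t n j) * (cnj (f t n i') * f t n j') * w (i',k) (j',l))" by simp
    also have "\<dots> = (\<Sum>i'<d. \<Sum>j'<d. \<Sum>t<N. \<Sum>n<d.
        f t n i * cnj (f t n j) * (cnj (f t n i') * f t n j') * w (i',k) (j',l))"
      by (subst sum.swap, rule sum.cong[OF refl], subst sum.swap) simp
    finally show ?thesis by (simp add: sum_distrib_right)
  qed
  also have "\<dots> = (\<Sum>i'<d. \<Sum>j'<d. of_nat N / of_nat d *
      (of_bool (i = j \<and> i' = j' \<or> i = i' \<and> j = j') * w (i',k) (j',l)))"
    using x by (intro sum.cong refl, subst f) (simp_all add: mult.assoc)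
  \<comment> \<open>Inclusion and exclusion: the two index patterns overlap exactly when all four
    indices agree.\<close>
  also have "\<dots> = of_nat N / of_nat d * (\<Sum>i'<d. \<Sum>j'<d. of_bool (i = j) * (of_bool (i' = j') * w (i',k) (j',l))
      + of_bool (i = i') * (of_bool (j = j') * w (i',k) (j',l))
      - of_bool (i = j) * (of_bool (i = i') * (of_bool (j = j') * w (i',k) (j',l))))"
    unfolding sum_distrib_left by (intro sum.cong refl) auto
  also have "(\<Sum>i'<d. \<Sum>j'<d. of_bool (i = j) * (of_bool (i' = j') * w (i',k) (j',l))
      + of_bool (i = i') * (of_bool (j = j') * w (i',k) (j',l))
      - of_bool (i = j) * (of_bool (i = i') * (of_bool (j = j') * w (i',k) (j',l))))
    = of_bool (i = j) * (\<Sum>i'<d. w (i',k) (i',l)) + w (i,k) (j,l) - of_bool (i = j) * w (i,k) (j,l)"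
    using x by (simp add: sum.distrib sum_subtractf sum_distrib_left[symmetric])
  finally show ?thesis .
qed

text \<open>Concavity bounds the entropy of \<open>C\<close> by an average over \<open>t\<close> of
  the bounds from \<open>phase_damping_entropy\<close>, so some \<open>t\<close> does at least as
  well as the average. A single \<open>t\<close> is wanted because its blocks give one ensemble of
  \<open>d\<close> states.\<close>

lemma depolarized_entropy:
  assumes d: "d \<ge> 1" and w: "psd_on ({..<d} \<times> {..<m}) w"
    and tr: "(\<Sum>x\<in>{..<d} \<times> {..<m}. w x x) = 1"
    and q: "q0 > 0" "q1 \<ge> 0" "q0 + (real d - 1) * q1 = 1"
    and cp: "q0 + (real d - 1) * (q0 - q1) \<ge> 0"
    and N: "N > 0" and f: "\<And>t. onb {..<d} {..<d} (f t)"
    and avg: "\<And>i j i' j'. i < d \<Longrightarrow> j < d \<Longrightarrow> i' < d \<Longrightarrow> j' < d \<Longrightarrow>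
      (\<Sum>t<N. \<Sum>n<d. f t n i * cnj (f t n j) * (cnj (f t n i') * f t n j'))
        = of_nat N / of_nat d * of_bool (i = j \<and> i' = j' \<or> i = i' \<and> j = j')"
    and \<chi>: "\<And>t n. n < d \<Longrightarrow> spectral {..<m} {..<m} (block d w (f t n)) (\<chi> t n) (\<beta> t n)"
    and \<beta>: "\<And>t n l. n < d \<Longrightarrow> l < m \<Longrightarrow> \<beta> t n l \<ge> 0"
    and C: "spectral ({..<d} \<times> {..<m}) K C \<phi> c"
    and Cw: "\<And>i k j l. i < d \<Longrightarrow> j < d \<Longrightarrow> k < m \<Longrightarrow> l < m \<Longrightarrow>
      C (i,k) (j,l) = of_real (q0 - q1) * w (i,k) (j,l) + of_real q1 * of_bool (i = j) * (\<Sum>i'<d. w (i',k) (i',l))"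
  shows "\<exists>t<N. (\<Sum>k\<in>K. c k * ln (c k)) \<le> (\<Sum>n<d. \<Sum>l<m. \<beta> t n l * ln (\<beta> t n l))
     + (q0 * ln q0 + (real d - 1) * (q1 * ln q1) + ln (real d))"
proof -
  let ?I = "{..<d} \<times> {..<m}"
  \<comment> \<open>\<open>r\<close> is the damping that the off-diagonal blocks still lack after
    averaging over \<open>t\<close>. With the weights \<open>p\<close>, conjugation by the
    \<open>g b\<close> multiplies these blocks by \<open>r\<close> and fixes the diagonal ones (fact
    \<open>Z\<close>).\<close>
  define r where "r = (q0 - q1) / q0"
  define p where "p = (\<lambda>b::nat. (1 - r) / real d + r * of_bool (b = 0))"
  define g where "g = (\<lambda>b i. cis (2 * pi * (real b * real i / real d)))"
  define A where "A = (\<lambda>t x y. of_real (q0 - q1) * w x y + of_real (q1 * real d) * pinch d (f t) w x y)"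
  have r1: "r \<le> 1" using q by (simp add: r_def)
  \<comment> \<open>Since \<open>r <= 1\<close>, only \<open>p 0\<close> could be negative, when
    \<open>q0 < q1\<close>; its numerator is the quantity in \<open>cp\<close>.\<close>
  have p0: "p b \<ge> 0" for b
  proof (cases "b = 0")
    case True
    have "p b = (q0 + (real d - 1) * (q0 - q1)) / (real d * q0)"
      using True q d by (simp add: p_def r_def field_simps)
    then show ?thesis using cp q by simp
  qed (use r1 in \<open>simp add: p_def\<close>)
  have p1: "(\<Sum>b<d. p b) = 1" using d by (simp add: p_def sum.distrib sum_distrib_left[symmetric])
  have gg: "g b i * cnj (g b j) = cis (2 * pi * (real b * of_int (int i - int j) / real d))" for b i j
    by (simp add: g_def cis_cnj cis_mult algebra_simps diff_divide_distrib)
  have Z: "(\<Sum>b<d. of_real (p b) * (g b i * cnj (g b j))) = (1 - of_real r) * of_bool (i = j) + of_real r"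
    if "i < d" "j < d" for i j
  proof -
    have "(\<Sum>b<d. of_real (p b) * (g b i * cnj (g b j)))
       = (1 - of_real r) / of_nat d * (\<Sum>b<d. g b i * cnj (g b j)) + of_real r * (\<Sum>b<d. of_bool (b = 0) * (g b i * cnj (g b j)))"
      unfolding sum_distrib_left sum.distrib[symmetric]
      by (intro sum.cong refl) (simp add: p_def of_bool_def algebra_simps)
    also have "(\<Sum>b<d. of_bool (b = 0) * (g b i * cnj (g b j))) = 1"
      using d by (simp add: g_def)
    also have "(\<Sum>b<d. g b i * cnj (g b j)) = of_nat d * of_bool (i = j)"
      unfolding gg using that by (subst sum_roots_of_unity) auto
    finally show ?thesis using d by simp
  qed
  have Apsd: "psd_on ?I (A t)" for t
  proof -
    have "form ?I (A t) v v = of_real q0 * form ?I w v v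
        + of_real q1 * form ?I (\<lambda>x y. of_nat d * pinch d (f t) w x y - w x y) v v" for v
      unfolding form_scale_mat[symmetric] form_add_mat[symmetric]
      by (intro form_cong) (simp_all add: A_def algebra_simps)
    then show ?thesis using w psd_pinch[OF f w, of t] q unfolding psd_on_def by simp
  qed
  have "\<forall>t. \<exists>\<eta> a. spectral ?I ?I (A t) \<eta> a \<and> (\<forall>k\<in>?I. a k \<ge> 0)"
    using psd_spectral[OF _ Apsd] by blast
  then obtain \<eta> a where a: "\<And>t. spectral ?I ?I (A t) (\<eta> t) (a t)" "\<And>t k. k \<in> ?I \<Longrightarrow> a t k \<ge> 0"
    by metis
  define E where "E = q0 * ln q0 + (real d - 1) * (q1 * ln q1) + ln (real d)"
  define R where "R = (\<lambda>t. \<Sum>n<d. \<Sum>l<m. \<beta> t n l * ln (\<beta> t n l))"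
  have damp: "(\<Sum>k\<in>?I. a t k * ln (a t k)) \<le> R t + E" for t
    unfolding E_def R_def
    by (rule phase_damping_entropy[OF d f w tr \<chi> \<beta> _ q(2,3) a(1)]) (use q a(2) in \<open>auto simp: A_def\<close>)
  have oC: "onb ?I K \<phi>" using C by (simp add: spectral_def)
  \<comment> \<open>The diagonal unitary is moved from \<open>A\<close> to the vectors, so that
    \<open>peierls\<close> applies to \<open>A\<close> itself in a twisted basis.\<close>
  define \<phi>' where "\<phi>' = (\<lambda>b k x. cnj (g b (fst x)) * \<phi> k x)"
  have o': "onb ?I K (\<phi>' b)" for b
    unfolding \<phi>'_def by (rule onb_twist[OF oC]) (simp add: g_def)
  define J where "J = {..<d} \<times> {..<N}"
  have CA: "C x y = (\<Sum>s\<in>J. of_real (p (fst s) / real N) * (g (fst s) (fst x) * cnj (g (fst s) (fst y)) * A (snd s) x y))"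
    if "x \<in> ?I" "y \<in> ?I" for x y
  proof -
    obtain i k j l where x: "x = (i,k)" "y = (j,l)" by (metis surj_pair)
    have lt: "i < d" "j < d" "k < m" "l < m" using that x by auto
    have "(\<Sum>s\<in>J. of_real (p (fst s) / real N) * (g (fst s) (fst x) * cnj (g (fst s) (fst y)) * A (snd s) x y))
       = (\<Sum>b<d. of_real (p b) * (g b i * cnj (g b j))) * ((\<Sum>t<N. A t x y) / of_nat N)"
      unfolding J_def sum.cartesian_product' sum_divide_distrib sum_product by (simp add: x algebra_simps)
    also have "(\<Sum>t<N. A t x y) = of_nat N * of_real (q0 - q1) * w x y + of_real (q1 * real d) * (\<Sum>t<N. pinch d (f t) w x y)"
      unfolding A_def sum.distrib sum_distrib_left[symmetric] by simp
    also have "(\<Sum>t<N. pinch d (f t) w x y) = of_nat N / of_nat d *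
        (of_bool (i = j) * (\<Sum>i'<d. w (i',k) (i',l)) + w (i,k) (j,l) - of_bool (i = j) * w (i,k) (j,l))"
      unfolding x by (rule pinch_average[OF lt(1,2) d avg])
    also have "(of_nat N * of_real (q0 - q1) * w x y + of_real (q1 * real d) * (of_nat N / of_nat d *
        (of_bool (i = j) * (\<Sum>i'<d. w (i',k) (i',l)) + w (i,k) (j,l) - of_bool (i = j) * w (i,k) (j,l)))) / of_nat N
      = of_real q0 * w x y + of_real q1 * of_bool (i = j) * ((\<Sum>i'<d. w (i',k) (i',l)) - w x y)"
      using d N by (simp add: x field_simps)
    also have "(\<Sum>b<d. of_real (p b) * (g b i * cnj (g b j))) = (1 - of_real r) * of_bool (i = j) + of_real r"
      by (rule Z[OF lt(1,2)])
    also have "((1 - of_real r) * of_bool (i = j) + of_real r) *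
        (of_real q0 * w x y + of_real q1 * of_bool (i = j) * ((\<Sum>i'<d. w (i',k) (i',l)) - w x y)) = C x y"
    proof -
      have "of_real r * of_real q0 = (of_real (q0 - q1) :: complex)" using q by (simp add: r_def)
      then have "of_real r * (of_real q0 * z) = of_real (q0 - q1) * z" for z :: complex
        by (metis mult.assoc)
      then show ?thesis unfolding x Cw[OF lt]
        by (cases "i = j") (simp add: algebra_simps, simp add: distrib_left distrib_right mult.assoc)
    qed
    finally show ?thesis by simp
  qed
  have c: "c k = (\<Sum>s\<in>J. p (fst s) / real N * Re (form ?I (A (snd s)) (\<phi>' (fst s) k) (\<phi>' (fst s) k)))" if "k \<in> K" for k
  proof -
    have "form ?I C (\<phi> k) (\<phi> k) = (\<Sum>s\<in>J. of_real (p (fst s) / real N) *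
        form ?I (\<lambda>x y. g (fst s) (fst x) * cnj (g (fst s) (fst y)) * A (snd s) x y) (\<phi> k) (\<phi> k))"
      unfolding form_sum_mat[symmetric] by (intro form_cong CA refl)
    also have "\<dots> = (\<Sum>s\<in>J. of_real (p (fst s) / real N) * form ?I (A (snd s)) (\<phi>' (fst s) k) (\<phi>' (fst s) k))"
      unfolding form_def \<phi>'_def by (simp add: algebra_simps)
    finally have "c k = Re (\<Sum>s\<in>J. of_real (p (fst s) / real N) * form ?I (A (snd s)) (\<phi>' (fst s) k) (\<phi>' (fst s) k))"
      unfolding spectral_eigenform(3)[OF C that] by (metis Re_complex_of_real)
    then show ?thesis by (simp add: Re_sum)
  qed
  have J: "finite J" "(\<Sum>s\<in>J. p (fst s) / real N) = 1"
    using p1 N by (auto simp: J_def sum.cartesian_product')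
  let ?e = "\<lambda>s k. Re (form ?I (A (snd s)) (\<phi>' (fst s) k) (\<phi>' (fst s) k))"
  \<comment> \<open>Concavity of the entropy in two moves: by \<open>c\<close> each eigenvalue of
    \<open>C\<close> is a convex combination of diagonal entries of the \<open>A t\<close>, to which
    Jensen applies; Peierls then replaces diagonals by spectra.\<close>
  have "(\<Sum>k\<in>K. c k * ln (c k)) \<le> (\<Sum>k\<in>K. \<Sum>s\<in>J. p (fst s) / real N * (?e s k * ln (?e s k)))"
  proof (rule sum_mono)
    fix k assume k: "k \<in> K"
    show "c k * ln (c k) \<le> (\<Sum>s\<in>J. p (fst s) / real N * (?e s k * ln (?e s k)))"
      unfolding c[OF k] using J p0 Apsd by (intro xlnx_jensen) (auto simp: psd_on_def)
  qed
  also have "\<dots> = (\<Sum>s\<in>J. p (fst s) / real N * (\<Sum>k\<in>K. ?e s k * ln (?e s k)))"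
    unfolding sum_distrib_left by (rule sum.swap)
  also have "\<dots> \<le> (\<Sum>s\<in>J. p (fst s) / real N * (R (snd s) + E))"
    using p0 by (intro sum_mono mult_left_mono order_trans[OF peierls[OF o' a(1) a(2)] damp]) auto
  finally have le: "(\<Sum>k\<in>K. c k * ln (c k)) \<le> (\<Sum>s\<in>J. p (fst s) / real N * (R (snd s) + E))" .
  show ?thesis
  proof (rule ccontr)
    assume "\<not> ?thesis"
    then have lt: "R t + E < (\<Sum>k\<in>K. c k * ln (c k))" if "t < N" for t
      using that unfolding R_def E_def by force
    have "(\<Sum>s\<in>J. p (fst s) / real N * (R (snd s) + E)) = (\<Sum>b<d. p b) * (\<Sum>t<N. (R t + E) / real N)"
      unfolding J_def sum.cartesian_product' sum_product by (simp add: algebra_simps)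
    also have "\<dots> = (\<Sum>t<N. R t + E) / real N" unfolding p1 sum_divide_distrib by simp
    also have "\<dots> < (\<Sum>t<N. (\<Sum>k\<in>K. c k * ln (c k))) / real N"
      using N lt by (intro divide_strict_right_mono sum_strict_mono) auto
    also have "\<dots> = (\<Sum>k\<in>K. c k * ln (c k))" using N by simp
    finally show False using le by simp
  qed
qed

section \<open>Channels on density matrices\<close>

lemma bij_pair_index: "bij_betw (\<lambda>(i,k). i * m + k) ({..<d} \<times> {..<m}) {..<d * (m::nat)}"
proof (rule bij_betw_byWitness[where f' = "\<lambda>a. (a div m, a mod m)"])
  have "i * m + k < d * m" if "i < d" "k < m" for i k :: nat
  proof -
    have "i * m + k < (i + 1) * m" using that by simp
    also have "\<dots> \<le> d * m" using that by (intro mult_right_mono) auto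
    finally show ?thesis .
  qed
  then show "(\<lambda>(i,k). i * m + k) ` ({..<d} \<times> {..<m}) \<subseteq> {..<d * m}" by auto
  show "(\<lambda>a. (a div m, a mod m)) ` {..<d * m} \<subseteq> {..<d} \<times> {..<m}"
    using less_mult_imp_div_less by (auto intro!: mod_less_divisor gr0I)
qed auto

lemma pair_index_less: "i < d \<Longrightarrow> k < m \<Longrightarrow> i * m + k < d * (m::nat)"
  using bij_betwE[OF bij_pair_index[where d = d and m = m]] by force

lemma sum_pair_index: "(\<Sum>a<d * m. g a) = (\<Sum>i<d. \<Sum>k<m. g (i * m + k))" for g :: "nat \<Rightarrow> 'b::comm_monoid_add"
  using sum.reindex_bij_betw[OF bij_pair_index[where d = d and m = m], of g]
  by (simp add: sum.cartesian_product' case_prod_unfold)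

lemma form_reindex:
  assumes "bij_betw h I J"
  shows "form I (\<lambda>x y. W (h x) (h y)) (\<lambda>x. v (h x)) (\<lambda>x. w (h x)) = form J W v w"
  unfolding form_def
  by (simp add: sum.reindex_bij_betw[OF assms, of "\<lambda>y. cnj (v z) * W z y * w y" for z]
      sum.reindex_bij_betw[OF assms, of "\<lambda>x. \<Sum>y\<in>J. cnj (v x) * W x y * w y"])

lemma psd_on_reindex:
  assumes "bij_betw h I J"
  shows "psd_on I (\<lambda>x y. W (h x) (h y)) \<longleftrightarrow> psd_on J W"
proof
  assume "psd_on I (\<lambda>x y. W (h x) (h y))"
  then show "psd_on J W" unfolding psd_on_def form_reindex[OF assms, symmetric] by blast
next
  assume J: "psd_on J W"
  have "form I (\<lambda>x y. W (h x) (h y)) v v = form J W (\<lambda>y. v (inv_into I h y)) (\<lambda>y. v (inv_into I h y))" for v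
    unfolding form_reindex[OF assms, symmetric]
    using assms by (intro form_cong) (auto simp: bij_betw_def)
  then show "psd_on I (\<lambda>x y. W (h x) (h y))" using J unfolding psd_on_def by simp
qed

lemma psd_on_cong: "(\<And>x y. x \<in> I \<Longrightarrow> y \<in> I \<Longrightarrow> W x y = W' x y) \<Longrightarrow> psd_on I W \<longleftrightarrow> psd_on I W'"
  unfolding psd_on_def using form_cong[of I W W'] by metis

lemma spectral_reindex:
  assumes h: "bij_betw h I J" and s: "spectral I K (\<lambda>x y. W (h x) (h y)) \<phi> a"
  shows "spectral J K W (\<lambda>k y. \<phi> k (inv_into I h y)) a"
proof -
  define g where "g = inv_into I h"
  have g: "bij_betw g J I" unfolding g_def by (rule bij_betw_inv_into[OF h])
  have hg: "h (g y) = y" "g y \<in> I" if "y \<in> J" for y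
    using h that by (auto simp: g_def bij_betw_def f_inv_into_f inv_into_into)
  have gi: "g x = g y \<longleftrightarrow> x = y" if "x \<in> J" "y \<in> J" for x y using hg that by metis
  have o: "onb I K \<phi>" using s by (simp add: spectral_def)
  have "ip J (\<lambda>y. \<phi> k (g y)) (\<lambda>y. \<phi> l (g y)) = ip I (\<phi> k) (\<phi> l)" for k l
    unfolding ip_def by (rule sum.reindex_bij_betw[OF g])
  then have "onb J K (\<lambda>k y. \<phi> k (g y))"
    using o hg gi bij_betw_finite[OF h] unfolding onb_def by simp
  moreover have "W x y = (\<Sum>k\<in>K. of_real (a k) * \<phi> k (g x) * cnj (\<phi> k (g y)))" if "x \<in> J" "y \<in> J" for x y
    using s hg[OF that(1)] hg[OF that(2)] unfolding spectral_def by metis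
  ultimately show ?thesis by (simp add: spectral_def g_def)
qed

lemma psd_iff_psd_on: "psd n A \<longleftrightarrow> A \<in> carrier_mat n n \<and> psd_on {..<n} (\<lambda>x y. A $$ (x,y))"
proof -
  have eq: "conjugate v \<bullet> (A *\<^sub>v v) = form {..<n} (\<lambda>x y. A $$ (x,y)) (\<lambda>x. v $ x) (\<lambda>x. v $ x)"
    if "A \<in> carrier_mat n n" "v \<in> carrier_vec n" for v
    using that unfolding form_def
    by (simp add: scalar_prod_def mult_mat_vec_def atLeast0LessThan sum_distrib_left mult.assoc)
  have "psd_on {..<n} (\<lambda>x y. A $$ (x,y))" if "psd n A"
    unfolding psd_on_def
  proof
    fix v
    have "form {..<n} (\<lambda>x y. A $$ (x,y)) v v = conjugate (vec n v) \<bullet> (A *\<^sub>v vec n v)"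
      using that by (subst eq) (auto simp: psd_def intro!: form_cong)
    then show "Im (form {..<n} (\<lambda>x y. A $$ (x,y)) v v) = 0 \<and> 0 \<le> Re (form {..<n} (\<lambda>x y. A $$ (x,y)) v v)"
      using that by (auto simp: psd_def)
  qed
  then show ?thesis using eq unfolding psd_def psd_on_def by auto
qed

lemma linear_map_on_sum:
  assumes F: "linear_map_on m F" and S: "finite S" and M: "\<And>s. s \<in> S \<Longrightarrow> M s \<in> carrier_mat m m"
  shows "F (mat m m (\<lambda>ab. \<Sum>s\<in>S. c s * M s $$ ab)) = mat m m (\<lambda>ab. \<Sum>s\<in>S. c s * F (M s) $$ ab)"
  using S M
proof (induction S rule: finite_induct)
  case empty
  have "F (0 \<cdot>\<^sub>m 0\<^sub>m m m) = 0 \<cdot>\<^sub>m F (0\<^sub>m m m)" "F (0\<^sub>m m m) \<in> carrier_mat m m"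
    using F unfolding linear_map_on_def by (blast intro: zero_carrier_mat)+
  moreover have "mat m m (\<lambda>ab. 0) = 0 \<cdot>\<^sub>m (0\<^sub>m m m :: complex mat)" by auto
  moreover have "0 \<cdot>\<^sub>m X = mat m m (\<lambda>ab. 0)" if "X \<in> carrier_mat m m" for X :: "complex mat"
    using that by (intro eq_matI) auto
  ultimately show ?case by simp
next
  case (insert t S)
  let ?A = "mat m m (\<lambda>ab. \<Sum>s\<in>S. c s * M s $$ ab)"
  have Mt: "M t \<in> carrier_mat m m" using insert.prems by simp
  have FM: "F (M t) \<in> carrier_mat m m" using F Mt by (simp add: linear_map_on_def)
  have "mat m m (\<lambda>ab. \<Sum>s\<in>insert t S. c s * M s $$ ab) = c t \<cdot>\<^sub>m M t + ?A"
    using insert.hyps Mt by (intro eq_matI) auto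
  then have "F (mat m m (\<lambda>ab. \<Sum>s\<in>insert t S. c s * M s $$ ab)) = c t \<cdot>\<^sub>m F (M t) + F ?A"
    using F Mt by (simp add: linear_map_on_def)
  also have "F ?A = mat m m (\<lambda>ab. \<Sum>s\<in>S. c s * F (M s) $$ ab)" using insert by simp
  finally show ?case using insert.hyps FM by (auto intro!: eq_matI)
qed

lemma linear_map_on_expand:
  assumes F: "linear_map_on m F" and A: "A \<in> carrier_mat m m" and ab: "a < m" "b < m"
  shows "F A $$ (a,b) = (\<Sum>k<m. \<Sum>l<m. A $$ (k,l) * F (matunit m k l) $$ (a,b))"
proof -
  have "A = mat m m (\<lambda>ab. \<Sum>s\<in>{..<m} \<times> {..<m}. A $$ s * matunit m (fst s) (snd s) $$ ab)"
  proof (rule eq_matI)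
    fix i j assume "i < dim_row (mat m m (\<lambda>ab. \<Sum>s\<in>{..<m} \<times> {..<m}. A $$ s * matunit m (fst s) (snd s) $$ ab))"
      "j < dim_col (mat m m (\<lambda>ab. \<Sum>s\<in>{..<m} \<times> {..<m}. A $$ s * matunit m (fst s) (snd s) $$ ab))"
    then have ij: "i < m" "j < m" by auto
    have "(\<Sum>s\<in>{..<m} \<times> {..<m}. A $$ s * matunit m (fst s) (snd s) $$ (i,j))
       = (\<Sum>s\<in>{..<m} \<times> {..<m}. A $$ s * of_bool (s = (i,j)))"
      using ij by (intro sum.cong refl) (auto simp: matunit_def)
    then show "A $$ (i,j) = mat m m (\<lambda>ab. \<Sum>s\<in>{..<m} \<times> {..<m}. A $$ s * matunit m (fst s) (snd s) $$ ab) $$ (i,j)"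
      using ij by simp
  qed (use A in auto)
  then have "F A = F (mat m m (\<lambda>ab. \<Sum>s\<in>{..<m} \<times> {..<m}. A $$ s * matunit m (fst s) (snd s) $$ ab))" by simp
  also have "\<dots> = mat m m (\<lambda>ab. \<Sum>s\<in>{..<m} \<times> {..<m}. A $$ s * F (matunit m (fst s) (snd s)) $$ ab)"
    by (rule linear_map_on_sum[OF F]) (auto simp: matunit_def)
  finally show ?thesis using ab by (simp add: sum.cartesian_product')
qed

text \<open>\<open>ampl m F \<sigma>\<close> is \<open>(id \<otimes> F)(\<sigma>)\<close>, computed blockwise.\<close>

definition ampl :: "nat \<Rightarrow> (complex mat \<Rightarrow> complex mat) \<Rightarrow> complex mat \<Rightarrow> nat \<times> nat \<Rightarrow> nat \<times> nat \<Rightarrow> complex" where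
  "ampl m F \<sigma> x y = F (mat m m (\<lambda>(k,l). \<sigma> $$ (fst x * m + k, fst y * m + l))) $$ (snd x, snd y)"

lemma ampl_expand:
  assumes "linear_map_on m F" "k < m" "l < m"
  shows "ampl m F \<sigma> (i,k) (j,l) = (\<Sum>k'<m. \<Sum>l'<m. \<sigma> $$ (i * m + k', j * m + l') * F (matunit m k' l') $$ (k,l))"
  unfolding ampl_def using assms by (simp add: linear_map_on_expand[OF assms(1)])

lemma matunit_index: "a < n \<Longrightarrow> b < n \<Longrightarrow> matunit n i j $$ (a,b) = of_bool (i = a) * of_bool (j = b)"
  by (auto simp: matunit_def)

text \<open>\<open>channel\<close> states complete positivity with the ancilla as second tensor
  factor, while here it is the first; the bijection \<open>h\<close> exchanges the factors.\<close>

lemma ampl_psd: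
  assumes ch: "channel m F" and \<sigma>: "psd (d * m) \<sigma>"
  shows "psd_on ({..<d} \<times> {..<m}) (ampl m F \<sigma>)"
proof -
  let ?I = "{..<d} \<times> {..<m}"
  have lin: "linear_map_on m F" using ch by (simp add: channel_def)
  define h :: "nat \<times> nat \<Rightarrow> nat" where "h = (\<lambda>(i,k). k * d + i)"
  have h: "bij_betw h ?I {..<m * d}"
  proof -
    have "bij_betw prod.swap ?I ({..<m} \<times> {..<d})"
      by (rule bij_betw_byWitness[where f' = prod.swap]) auto
    from bij_betw_trans[OF this bij_pair_index] show ?thesis
      by (simp add: h_def comp_def case_prod_unfold)
  qed
  define A where "A = mat (m * d) (m * d) (\<lambda>(a,b). \<sigma> $$ ((a mod d) * m + a div d, (b mod d) * m + b div d))"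
  have hI: "h x < m * d" if "x \<in> ?I" for x using h that by (auto simp: bij_betw_def)
  have Ah: "A $$ (h x, h y) = \<sigma> $$ ((\<lambda>(i,k). i * m + k) x, (\<lambda>(i,k). i * m + k) y)" if "x \<in> ?I" "y \<in> ?I" for x y
    using hI[OF that(1)] hI[OF that(2)] that by (auto simp: A_def h_def)
  have "psd_on ?I (\<lambda>x y. \<sigma> $$ ((\<lambda>(i,k). i * m + k) x, (\<lambda>(i,k). i * m + k) y))"
    using psd_on_reindex[OF bij_pair_index[where d = d and m = m], of "\<lambda>x y. \<sigma> $$ (x,y)"] \<sigma> by (simp add: psd_iff_psd_on)
  then have "psd_on ?I (\<lambda>x y. A $$ (h x, h y))"
    by (subst psd_on_cong[OF Ah])
  then have "psd (m * d) A"
    using psd_on_reindex[OF h, of "\<lambda>x y. A $$ (x,y)"] by (simp add: psd_iff_psd_on A_def)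
  then have "psd (m * d) (tensor_map m d F (\<lambda>X. X) A)" using ch by (simp add: channel_def)
  then have "psd_on ?I (\<lambda>x y. tensor_map m d F (\<lambda>X. X) A $$ (h x, h y))"
    using psd_on_reindex[OF h, of "\<lambda>x y. tensor_map m d F (\<lambda>X. X) A $$ (x,y)"] by (simp add: psd_iff_psd_on)
  moreover have "tensor_map m d F (\<lambda>X. X) A $$ (h x, h y) = ampl m F \<sigma> x y" if xy: "x \<in> ?I" "y \<in> ?I" for x y
  proof -
    obtain i k j l where x: "x = (i,k)" "y = (j,l)" by (metis surj_pair)
    have lt: "i < d" "j < d" "k < m" "l < m" using xy x by auto
    have "tensor_map m d F (\<lambda>X. X) A $$ (h x, h y) = (\<Sum>k'<m. \<Sum>l'<m. \<Sum>i'<d. \<Sum>j'<d.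
        A $$ (k' * d + i', l' * d + j') * F (matunit m k' l') $$ (k,l) * (of_bool (i' = i) * of_bool (j' = j)))"
      using hI[OF xy(1)] hI[OF xy(2)] lt unfolding tensor_map_def
      by (simp add: x h_def matunit_index)
    also have "\<dots> = (\<Sum>k'<m. \<Sum>l'<m. A $$ (k' * d + i, l' * d + j) * F (matunit m k' l') $$ (k,l))"
      using lt by (simp add: mult.left_commute[of _ "of_bool _"] sum_distrib_left[symmetric])
    also have "\<dots> = (\<Sum>k'<m. \<Sum>l'<m. \<sigma> $$ (i * m + k', j * m + l') * F (matunit m k' l') $$ (k,l))"
    proof (intro sum.cong refl)
      fix k' l' assume "k' \<in> {..<m}" "l' \<in> {..<m}"
      then have "A $$ (k' * d + i, l' * d + j) = \<sigma> $$ (i * m + k', j * m + l')"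
        using Ah[of "(i,k')" "(j,l')"] lt by (simp add: h_def)
      then show "A $$ (k' * d + i, l' * d + j) * F (matunit m k' l') $$ (k,l)
          = \<sigma> $$ (i * m + k', j * m + l') * F (matunit m k' l') $$ (k,l)" by simp
    qed
    also have "\<dots> = ampl m F \<sigma> x y" unfolding x by (rule ampl_expand[OF lin lt(3,4), symmetric])
    finally show ?thesis .
  qed
  ultimately show ?thesis by (subst (asm) psd_on_cong)
qed

lemma ampl_trace:
  assumes ch: "channel m F" and \<sigma>: "\<sigma> \<in> carrier_mat (d * m) (d * m)"
  shows "(\<Sum>x\<in>{..<d} \<times> {..<m}. ampl m F \<sigma> x x) = mtrace \<sigma>"
proof -
  have "(\<Sum>x\<in>{..<d} \<times> {..<m}. ampl m F \<sigma> x x) = (\<Sum>i<d. mtrace (F (mat m m (\<lambda>(k,l). \<sigma> $$ (i * m + k, i * m + l)))))"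
    unfolding sum.cartesian_product' ampl_def mtrace_def
    using ch unfolding channel_def linear_map_on_def
    by (intro sum.cong refl arg_cong[of _ _ lessThan]) (metis carrier_matD(1) mat_carrier, simp)
  also have "\<dots> = (\<Sum>i<d. mtrace (mat m m (\<lambda>(k,l). \<sigma> $$ (i * m + k, i * m + l))))"
    using ch by (simp add: channel_def)
  also have "\<dots> = mtrace \<sigma>" using \<sigma> by (simp add: mtrace_def sum_pair_index)
  finally show ?thesis .
qed

section \<open>The depolarized output and rotations of the first factor\<close>

lemma depol_matunit:
  assumes "a < d" "b < d" "i < d" "j < d"
  shows "depol d p (matunit d i j) $$ (a,b) = of_real (1 - p) * (of_bool (i = a) * of_bool (j = b))
    + of_real (p / real d) * (of_bool (i = j) * of_bool (a = b))"
proof -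
  have "mtrace (matunit d i j) = (\<Sum>x<d. of_bool (i = x) * of_bool (j = x))"
    by (simp add: mtrace_def matunit_def) (intro sum.cong, auto)
  also have "\<dots> = of_bool (i = j)" using assms by (cases "i = j") auto
  finally show ?thesis using assms by (simp add: depol_def matunit_index) (simp add: matunit_def)
qed

lemma tensor_depol:
  assumes lin: "linear_map_on m F" and lt: "i < d" "j < d" "k < m" "l < m"
  shows "tensor_map d m (depol d p) F \<sigma> $$ (i * m + k, j * m + l)
    = of_real (1 - p) * ampl m F \<sigma> (i,k) (j,l) + of_real (p / real d) * of_bool (i = j) * (\<Sum>i'<d. ampl m F \<sigma> (i',k) (i',l))"
proof -
  define G where "G = (\<lambda>i' j'. \<Sum>k'<m. \<Sum>l'<m. \<sigma> $$ (i' * m + k', j' * m + l') * F (matunit m k' l') $$ (k,l))"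
  have G: "ampl m F \<sigma> (i',k) (j',l) = G i' j'" for i' j'
    unfolding G_def by (rule ampl_expand[OF lin lt(3,4)])
  have "tensor_map d m (depol d p) F \<sigma> $$ (i * m + k, j * m + l)
     = (\<Sum>i'<d. \<Sum>j'<d. depol d p (matunit d i' j') $$ (i,j) * G i' j')"
    using lt pair_index_less[OF lt(1,3)] pair_index_less[OF lt(2,4)] unfolding tensor_map_def G_def
    by (simp add: sum_distrib_left algebra_simps)
  also have "\<dots> = (\<Sum>i'<d. \<Sum>j'<d. of_real (1 - p) * (of_bool (i' = i) * (of_bool (j' = j) * G i' j'))
     + of_real (p / real d) * (of_bool (i = j) * (of_bool (i' = j') * G i' j')))"
    using lt by (intro sum.cong refl) (simp add: depol_matunit algebra_simps)
  also have "\<dots> = of_real (1 - p) * G i j + of_real (p / real d) * of_bool (i = j) * (\<Sum>i'<d. G i' i')"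
    using lt by (simp add: sum.distrib sum_distrib_left[symmetric] del: of_real_divide)
  finally show ?thesis unfolding G .
qed

text \<open>\<open>rot d e w\<close> is \<open>w\<close> written in the basis \<open>e\<close> of the first factor.\<close>

definition rot :: "nat \<Rightarrow> (nat \<Rightarrow> nat \<Rightarrow> complex) \<Rightarrow> (nat \<times> nat \<Rightarrow> nat \<times> nat \<Rightarrow> complex) \<Rightarrow> nat \<times> nat \<Rightarrow> nat \<times> nat \<Rightarrow> complex" where
  "rot d e w x y = (\<Sum>i<d. \<Sum>j<d. cnj (e (fst x) i) * e (fst y) j * w (i, snd x) (j, snd y))"

lemma onb_tens_std:
  assumes "onb {..<d} {..<d} e"
  shows "onb ({..<d} \<times> {..<m}) ({..<d} \<times> {..<m}) (\<lambda>x. tens (e (fst x)) (\<lambda>k. of_bool (k = snd x)))"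
    (is "onb ?I ?I ?\<eta>")
  unfolding onb_def
proof (intro conjI ballI)
  fix x y assume xy: "x \<in> ?I" "y \<in> ?I"
  have "ip ?I (?\<eta> x) (?\<eta> y) = ip {..<d} (e (fst x)) (e (fst y)) * (\<Sum>k<m. of_bool (k = snd x) * of_bool (k = snd y))"
    unfolding ip_def sum.cartesian_product' sum_product tens_def by (simp add: algebra_simps)
  then show "ip ?I (?\<eta> x) (?\<eta> y) = of_bool (x = y)"
    using xy onb_ip[OF assms, of "fst x" "fst y"] by (auto simp: prod_eq_iff)
next
  fix x y assume xy: "x \<in> ?I" "y \<in> ?I"
  have "(\<Sum>z\<in>?I. ?\<eta> z x * cnj (?\<eta> z y)) = (\<Sum>j<d. e j (fst x) * cnj (e j (fst y))) * (\<Sum>k<m. of_bool (snd x = k) * of_bool (snd y = k))"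
    unfolding sum.cartesian_product' sum_product tens_def by (simp add: algebra_simps)
  then show "(\<Sum>z\<in>?I. ?\<eta> z x * cnj (?\<eta> z y)) = of_bool (x = y)"
    using xy onb_complete[OF assms, of "fst x" "fst y"] by (auto simp: prod_eq_iff)
qed simp_all

lemma rot_form:
  assumes "x \<in> {..<d} \<times> {..<m}" "y \<in> {..<d} \<times> {..<m}"
  shows "rot d e w x y = form ({..<d} \<times> {..<m}) w
    (tens (e (fst x)) (\<lambda>k. of_bool (k = snd x))) (tens (e (fst y)) (\<lambda>k. of_bool (k = snd y)))"
proof -
  have "form ({..<d} \<times> {..<m}) w (tens (e (fst x)) (\<lambda>k. of_bool (k = snd x))) (tens (e (fst y)) (\<lambda>k. of_bool (k = snd y)))
     = (\<Sum>i<d. \<Sum>k<m. of_bool (k = snd x) * (\<Sum>j<d. \<Sum>l<m. of_bool (l = snd y) *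
         (cnj (e (fst x) i) * e (fst y) j * w (i,k) (j,l))))"
    unfolding form_def sum.cartesian_product' tens_def sum_distrib_left by (simp add: algebra_simps)
  then show ?thesis using assms by (auto simp: rot_def)
qed

lemma psd_rot:
  assumes "psd_on ({..<d} \<times> {..<m}) w"
  shows "psd_on ({..<d} \<times> {..<m}) (rot d e w)"
proof -
  let ?I = "{..<d} \<times> {..<m}"
  let ?\<eta> = "\<lambda>x. tens (e (fst x)) (\<lambda>k. of_bool (k = snd x))"
  have "form ?I (rot d e w) v v = form ?I w (\<lambda>z. \<Sum>x\<in>?I. v x * ?\<eta> x z) (\<lambda>z. \<Sum>x\<in>?I. v x * ?\<eta> x z)" for v
  proof -
    have "form ?I (rot d e w) v v = (\<Sum>x\<in>?I. \<Sum>y\<in>?I. cnj (v x) * form ?I w (?\<eta> x) (?\<eta> y) * v y)"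
      unfolding form_def[of ?I "rot d e w"] by (intro sum.cong refl) (simp only: rot_form)
    then show ?thesis unfolding form_sum_left form_sum_right
      by (simp add: sum_distrib_left algebra_simps)
  qed
  then show ?thesis using assms by (simp add: psd_on_def)
qed

lemma trace_rot:
  assumes "onb {..<d} {..<d} e"
  shows "(\<Sum>x\<in>{..<d} \<times> {..<m}. rot d e w x x) = (\<Sum>x\<in>{..<d} \<times> {..<m}. w x x)"
  unfolding onb_trace[OF onb_tens_std[OF assms], of m w, symmetric] by (intro sum.cong refl rot_form)

text \<open>Rotating the operator amounts to rotating the vector; this is how bases unbiased to the
  standard basis become bases unbiased to \<open>e\<close>.\<close>

lemma block_rot: "block d (rot d e w) f k l = block d w (\<lambda>i. \<Sum>j<d. f j * e j i) k l"
proof -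
  have "block d (rot d e w) f k l = (\<Sum>j<d. \<Sum>j'<d. \<Sum>i<d. \<Sum>i'<d. cnj (f j) * cnj (e j i) * (f j' * e j' i') * w (i,k) (i',l))"
    unfolding block_def rot_def by (simp add: sum_distrib_left algebra_simps)
  also have "\<dots> = (\<Sum>j<d. \<Sum>i<d. \<Sum>j'<d. \<Sum>i'<d. cnj (f j) * cnj (e j i) * (f j' * e j' i') * w (i,k) (i',l))"
    by (rule sum.cong[OF refl], rule sum.swap)
  also have "\<dots> = (\<Sum>i<d. \<Sum>j<d. \<Sum>j'<d. \<Sum>i'<d. cnj (f j) * cnj (e j i) * (f j' * e j' i') * w (i,k) (i',l))"
    by (rule sum.swap)
  also have "\<dots> = (\<Sum>i<d. \<Sum>j<d. \<Sum>i'<d. \<Sum>j'<d. cnj (f j) * cnj (e j i) * (f j' * e j' i') * w (i,k) (i',l))"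
    by (rule sum.cong[OF refl], rule sum.cong[OF refl], rule sum.swap)
  also have "\<dots> = (\<Sum>i<d. \<Sum>i'<d. \<Sum>j<d. \<Sum>j'<d. cnj (f j) * cnj (e j i) * (f j' * e j' i') * w (i,k) (i',l))"
    by (rule sum.cong[OF refl], rule sum.swap)
  also have "\<dots> = block d w (\<lambda>i. \<Sum>j<d. f j * e j i) k l"
    unfolding block_def cnj_sum sum_product by (simp add: sum_distrib_right)
  finally show ?thesis .
qed

lemma rot_add_scale:
  "rot d e (\<lambda>x y. a * w x y + b * w' x y) x y = a * rot d e w x y + b * rot d e w' x y"
  unfolding rot_def by (simp add: sum.distrib sum_distrib_left algebra_simps)

text \<open>With \<open>ptrace_rot\<close> this gives the unitary covariance of the depolarizing
  channel: the identity on the first factor looks the same in every basis.\<close>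

lemma rot_id_tensor:
  assumes "onb {..<d} {..<d} e" "i < d" "j < d"
  shows "rot d e (\<lambda>x y. of_bool (fst x = fst y) * u (snd x) (snd y)) (i,k) (j,l) = of_bool (i = j) * u k l"
proof -
  have "rot d e (\<lambda>x y. of_bool (fst x = fst y) * u (snd x) (snd y)) (i,k) (j,l)
     = (\<Sum>a<d. \<Sum>b<d. of_bool (a = b) * (cnj (e i a) * e j b * u k l))"
    unfolding rot_def by (simp add: algebra_simps)
  also have "\<dots> = ip {..<d} (e i) (e j) * u k l"
    unfolding ip_def sum_distrib_right by simp
  finally show ?thesis using assms by (simp add: onb_ip[OF assms(1)])
qed

lemma ptrace_rot:
  assumes "onb {..<d} {..<d} e"
  shows "(\<Sum>j<d. rot d e w (j,k) (j,l)) = (\<Sum>i<d. w (i,k) (i,l))"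
proof -
  have "(\<Sum>j<d. rot d e w (j,k) (j,l)) = (\<Sum>a<d. \<Sum>j<d. \<Sum>b<d. cnj (e j a) * e j b * w (a,k) (b,l))"
    unfolding rot_def fst_conv snd_conv by (rule sum.swap)
  also have "\<dots> = (\<Sum>a<d. \<Sum>b<d. \<Sum>j<d. cnj (e j a) * e j b * w (a,k) (b,l))"
    by (rule sum.cong[OF refl], rule sum.swap)
  also have "\<dots> = (\<Sum>a<d. \<Sum>b<d. (\<Sum>j<d. e j b * cnj (e j a)) * w (a,k) (b,l))"
    unfolding sum_distrib_right by (simp add: mult.commute mult.left_commute)
  also have "\<dots> = (\<Sum>a<d. \<Sum>b<d. of_bool (b = a) * w (a,k) (b,l))"
    by (intro sum.cong refl) (simp add: onb_complete[OF assms])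
  finally show ?thesis by simp
qed

lemma psd_pairs:
  assumes "psd (d * m) \<sigma>"
  shows "psd_on ({..<d} \<times> {..<m}) (\<lambda>x y. \<sigma> $$ (fst x * m + snd x, fst y * m + snd y))"
  using psd_on_reindex[OF bij_pair_index[where d = d and m = m], of "\<lambda>x y. \<sigma> $$ (x,y)"] assms
  by (simp add: psd_iff_psd_on case_prod_unfold)

section \<open>States, reduced states and the bound for one state\<close>

lemma density_ptrace2:
  assumes "density (d * m) \<sigma>"
  shows "density d (ptrace2 d m \<sigma>)"
proof -
  let ?I = "{..<d} \<times> {..<m}"
  let ?s = "\<lambda>x y. \<sigma> $$ (fst x * m + snd x, fst y * m + snd y)"
  have p: "psd_on ?I ?s" and c: "\<sigma> \<in> carrier_mat (d * m) (d * m)"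
    using assms psd_pairs[of d m \<sigma>] by (auto simp: density_def psd_def)
  have eq: "form {..<d} (\<lambda>x y. ptrace2 d m \<sigma> $$ (x,y)) v v
     = (\<Sum>k<m. form ?I ?s (tens v (\<lambda>l. of_bool (l = k))) (tens v (\<lambda>l. of_bool (l = k))))" for v
  proof -
    have "form ?I ?s (tens v (\<lambda>l. of_bool (l = k))) (tens v (\<lambda>l. of_bool (l = k)))
       = (\<Sum>i<d. \<Sum>j<d. cnj (v i) * \<sigma> $$ (i * m + k, j * m + k) * v j)" if "k < m" for k
      unfolding form_tens using that by (simp add: form_of_bool block_def algebra_simps)
    then have "(\<Sum>k<m. form ?I ?s (tens v (\<lambda>l. of_bool (l = k))) (tens v (\<lambda>l. of_bool (l = k))))
       = (\<Sum>k<m. \<Sum>i<d. \<Sum>j<d. cnj (v i) * \<sigma> $$ (i * m + k, j * m + k) * v j)" by simp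
    also have "\<dots> = (\<Sum>i<d. \<Sum>j<d. \<Sum>k<m. cnj (v i) * \<sigma> $$ (i * m + k, j * m + k) * v j)"
      by (subst sum.swap, rule sum.cong[OF refl], rule sum.swap)
    also have "\<dots> = form {..<d} (\<lambda>x y. ptrace2 d m \<sigma> $$ (x,y)) v v"
      unfolding form_def by (simp add: ptrace2_def sum_distrib_left sum_distrib_right)
    finally show ?thesis by simp
  qed
  have "psd d (ptrace2 d m \<sigma>)"
    unfolding psd_iff_psd_on psd_on_def eq using p
    by (auto simp: psd_on_def ptrace2_def intro!: sum_nonneg)
  moreover have "mtrace (ptrace2 d m \<sigma>) = mtrace \<sigma>"
    using c by (simp add: mtrace_def ptrace2_def sum_pair_index)
  ultimately show ?thesis using assms by (simp add: density_def)
qed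

lemma density_spectral:
  assumes "density n A"
  shows "\<exists>\<phi> a. spectral {..<n} {..<n} (\<lambda>x y. A $$ (x,y)) \<phi> a \<and> (\<forall>k<n. a k \<ge> 0) \<and> (\<Sum>k<n. a k) = 1"
proof -
  have p: "psd_on {..<n} (\<lambda>x y. A $$ (x,y))" and c: "A \<in> carrier_mat n n" and t: "mtrace A = 1"
    using assms by (auto simp: density_def psd_iff_psd_on)
  obtain \<phi> a where s: "spectral {..<n} {..<n} (\<lambda>x y. A $$ (x,y)) \<phi> a" "\<forall>k\<in>{..<n}. a k \<ge> 0"
    using psd_spectral[OF _ p] by blast
  have o: "onb {..<n} {..<n} \<phi>" using s by (simp add: spectral_def)
  have "of_real (\<Sum>k<n. a k) = (\<Sum>k<n. form {..<n} (\<lambda>x y. A $$ (x,y)) (\<phi> k) (\<phi> k))"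
    using spectral_eigenform(3)[OF s(1)] by simp
  also have "\<dots> = 1" unfolding onb_trace[OF o] using t c by (simp add: mtrace_def)
  finally have "(\<Sum>k<n. a k) = 1" using of_real_eq_1_iff by blast
  then show ?thesis using s by auto
qed

lemma entropy_nonneg:
  assumes A: "A \<in> carrier_mat n n" and s: "spectral {..<n} K (\<lambda>x y. A $$ (x,y)) \<phi> a"
    and a: "\<And>k. k \<in> K \<Longrightarrow> a k \<ge> 0" "(\<Sum>k\<in>K. a k) = 1"
  shows "vn_entropy A \<ge> 0"
proof -
  have K: "finite K" using s by (simp add: spectral_def onb_def)
  have "a k * ln (a k) \<le> 0" if "k \<in> K" for k
  proof -
    have "a k \<le> 1" using member_le_sum[OF that, of a] a K by auto
    then show ?thesis using a(1)[OF that] by (cases "a k = 0") (auto intro: mult_nonneg_nonpos)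
  qed
  then show ?thesis unfolding vn_entropy_spectral[OF A s] using sum_nonpos[of K "\<lambda>k. a k * ln (a k)"] by simp
qed

text \<open>Positivity is complete positivity with a one-dimensional ancilla, hence
  \<open>psd (1 * m) A\<close>: the block of \<open>ampl\<close> at the constant vector 1 is the
  output itself.\<close>

lemma channel_density:
  assumes ch: "channel m F" and A: "density m A"
  shows "density m (F A)"
proof -
  have c: "A \<in> carrier_mat m m" "psd (1 * m) A" "mtrace A = 1" using A by (auto simp: density_def psd_def)
  have FA: "F A \<in> carrier_mat m m" "mtrace (F A) = 1"
    using ch c by (auto simp: channel_def linear_map_on_def)
  have AA: "mat m m (($$) A) = A" using c(1) by (intro eq_matI) auto
  have "psd_on {..<m} (block 1 (ampl m F A) (\<lambda>_. 1))"
    by (rule psd_block[OF ampl_psd[OF ch c(2)]])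
  also have "block 1 (ampl m F A) (\<lambda>_. 1) = (\<lambda>k l. F A $$ (k,l))"
    by (intro ext) (simp add: block_def ampl_def AA)
  finally show ?thesis using FA by (simp add: density_def psd_iff_psd_on)
qed

lemma vn_entropy_density_nonneg:
  assumes "density n A"
  shows "vn_entropy A \<ge> 0"
proof -
  obtain \<phi> a where s: "spectral {..<n} {..<n} (\<lambda>x y. A $$ (x,y)) \<phi> a" "\<forall>k<n. a k \<ge> 0" "(\<Sum>k<n. a k) = 1"
    using density_spectral[OF assms] by blast
  then show ?thesis using entropy_nonneg[OF _ s(1)] assms by (simp add: density_def psd_def)
qed

text \<open>The ensemble is what a measurement of the first factor leaves on the second:
  \<open>\<tau> t n\<close> is the normalised state for outcome \<open>n\<close>. It is exhibited
  explicitly so that the ensembles of all members of a decomposition can be merged later.\<close>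

lemma superadditive_state:
  assumes d: "d \<ge> 1" and ch: "channel m \<Omega>" and \<sigma>: "density (d * m) \<sigma>"
    and q: "q0 > 0" "q1 \<ge> 0" "q0 + (real d - 1) * q1 = 1"
    and cp: "q0 + (real d - 1) * (q0 - q1) \<ge> 0"
    and p: "1 - p = q0 - q1" "p / real d = q1"
  shows "\<exists>s. (\<forall>n<d. density m (s n)) \<and>
    ptrace1 d m \<sigma> = mat m m (\<lambda>ab. \<Sum>n<d. of_real (1 / real d) * s n $$ ab) \<and>
    - (q0 * ln q0 + (real d - 1) * (q1 * ln q1)) + (\<Sum>n<d. 1 / real d * vn_entropy (\<Omega> (s n)))
      \<le> vn_entropy (tensor_map d m (depol d p) \<Omega> \<sigma>)"
proof -
  let ?I = "{..<d} \<times> {..<m}"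
  define C where "C = tensor_map d m (depol d p) \<Omega> \<sigma>"
  define w where "w = ampl m \<Omega> \<sigma>"
  define \<sigma>' where "\<sigma>' = (\<lambda>x y. \<sigma> $$ (fst x * m + snd x, fst y * m + snd y))"
  have lin: "linear_map_on m \<Omega>" and tp: "\<And>A. A \<in> carrier_mat m m \<Longrightarrow> mtrace (\<Omega> A) = mtrace A"
    using ch by (auto simp: channel_def)
  have \<sigma>c: "\<sigma> \<in> carrier_mat (d * m) (d * m)" "psd (d * m) \<sigma>" "mtrace \<sigma> = 1"
    using \<sigma> by (auto simp: density_def psd_def)
  have wpsd: "psd_on ?I w" unfolding w_def by (rule ampl_psd[OF ch \<sigma>c(2)])
  have wtr: "(\<Sum>x\<in>?I. w x x) = 1" unfolding w_def ampl_trace[OF ch \<sigma>c(1)] by (rule \<sigma>c)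
  have \<sigma>psd: "psd_on ?I \<sigma>'" unfolding \<sigma>'_def by (rule psd_pairs[OF \<sigma>c(2)])
  obtain e s where e: "spectral {..<d} {..<d} (\<lambda>x y. ptrace2 d m \<sigma> $$ (x,y)) e s" and s1: "(\<Sum>k<d. s k) = 1"
    using density_spectral[OF density_ptrace2[OF \<sigma>]] by blast
  have oe: "onb {..<d} {..<d} e" using e by (simp add: spectral_def)
  obtain N :: nat and f where N: "N > 0" and f: "\<And>t. onb {..<d} {..<d} (f t)"
    and fmod: "\<And>t n i. (cmod (f t n i))\<^sup>2 = 1 / real d"
    and avg: "\<And>i j i' j'. i < d \<Longrightarrow> j < d \<Longrightarrow> i' < d \<Longrightarrow> j' < d \<Longrightarrow>
      (\<Sum>t<N. \<Sum>n<d. f t n i * cnj (f t n j) * (cnj (f t n i') * f t n j'))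
        = of_nat N / of_nat d * of_bool (i = j \<and> i' = j' \<or> i = i' \<and> j = j')"
    using unbiased_bases_exist[OF d] by blast
  \<comment> \<open>\<open>f t\<close> gives coordinates with respect to the eigenbasis
    \<open>e\<close> of the reduced state; \<open>F t\<close> is the same basis in standard
    coordinates.\<close>
  define F where "F = (\<lambda>t n i. \<Sum>j<d. f t n j * e j i)"
  have oF: "onb {..<d} {..<d} (F t)" for t unfolding F_def by (rule onb_compose[OF oe f])
  define \<tau> where "\<tau> = (\<lambda>t n. mat m m (\<lambda>(k,l). of_nat d * block d \<sigma>' (F t n) k l))"
  define w' where "w' = rot d e w"
  have w'psd: "psd_on ?I w'" unfolding w'_def by (rule psd_rot[OF wpsd])
  have w'tr: "(\<Sum>x\<in>?I. w' x x) = 1" unfolding w'_def trace_rot[OF oe] by (rule wtr)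
  have bl: "block d w' (f t n) = block d w (F t n)" for t n
    unfolding w'_def F_def by (intro ext block_rot)
  have "\<forall>t n. \<exists>\<chi> \<beta>. spectral {..<m} {..<m} (block d w' (f t n)) \<chi> \<beta> \<and> (\<forall>l\<in>{..<m}. \<beta> l \<ge> 0)"
    using psd_spectral[OF _ psd_block[OF w'psd]] by blast
  then obtain \<chi> \<beta> where \<chi>: "\<And>t n. spectral {..<m} {..<m} (block d w' (f t n)) (\<chi> t n) (\<beta> t n)"
    and \<beta>: "\<And>t n l. l < m \<Longrightarrow> \<beta> t n l \<ge> 0" by (metis lessThan_iff)

  have Cent: "C $$ (i * m + k, j * m + l) = of_real (q0 - q1) * w (i,k) (j,l)
      + of_real q1 * (of_bool (i = j) * (\<Sum>i'<d. w (i',k) (i',l)))"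
    if "i < d" "j < d" "k < m" "l < m" for i j k l
    unfolding C_def w_def tensor_depol[OF lin that] p by (simp add: mult.assoc)
  define Cp where "Cp = (\<lambda>x y. of_real (q0 - q1) * w x y
      + of_real q1 * (of_bool (fst x = fst y) * (\<Sum>i'<d. w (i',snd x) (i',snd y))))"
  define C' where "C' = rot d e Cp"
  have C': "C' (i,k) (j,l) = of_real (q0 - q1) * w' (i,k) (j,l) + of_real q1 * of_bool (i = j) * (\<Sum>i'<d. w' (i',k) (i',l))"
    if "i < d" "j < d" for i j k l
    unfolding C'_def Cp_def w'_def rot_add_scale
    using rot_id_tensor[OF oe that, of "\<lambda>k l. \<Sum>i'<d. w (i',k) (i',l)" k l] ptrace_rot[OF oe] by simp
  have C'h: "C' y x = cnj (C' x y)" if "x \<in> ?I" "y \<in> ?I" for x y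
  proof -
    have h: "w' b a = cnj (w' a b)" if "a \<in> ?I" "b \<in> ?I" for a b
      by (rule psd_on_hermitian[OF _ w'psd that]) simp
    obtain i k j l where x: "x = (i,k)" "y = (j,l)" by (metis surj_pair)
    have lt: "i < d" "j < d" "k < m" "l < m" using that x by auto
    have "(\<Sum>i'<d. w' (i',l) (i',k)) = cnj (\<Sum>i'<d. w' (i',k) (i',l))"
      unfolding cnj_sum using lt by (intro sum.cong refl h) auto
    moreover have "w' (j,l) (i,k) = cnj (w' (i,k) (j,l))" using lt by (intro h) auto
    moreover have "of_bool (j = i) = (of_bool (i = j) :: complex)" by (cases "i = j") auto
    ultimately show ?thesis unfolding x C'[OF lt(1,2)] C'[OF lt(2,1)]
      by (simp only: complex_cnj_add complex_cnj_mult complex_cnj_complex_of_real cnj_of_bool)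
  qed
  obtain \<phi> c where \<phi>: "spectral ?I ?I C' \<phi> c"
    using spectral_theorem[of ?I C'] C'h by blast
  have Cc: "C \<in> carrier_mat (d * m) (d * m)" by (simp add: C_def tensor_map_def)
  \<comment> \<open>\<open>C'\<close> is \<open>C\<close> written in the basis \<open>e\<close>; its
    eigenvectors are rotated back, so \<open>c\<close> is also the spectrum of
    \<open>C\<close>.\<close>
  define \<phi>1 where "\<phi>1 = (\<lambda>k x. \<Sum>y\<in>?I. \<phi> k y * tens (e (fst y)) (\<lambda>k. of_bool (k = snd y)) x)"
  have "spectral ?I ?I Cp \<phi>1 c"
    unfolding \<phi>1_def by (rule spectral_rotate[OF onb_tens_std[OF oe] _ \<phi>]) (simp only: C'_def rot_form)
  moreover have "Cp x y = C $$ ((\<lambda>(i,k). i * m + k) x, (\<lambda>(i,k). i * m + k) y)" if "x \<in> ?I" "y \<in> ?I" for x y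
    using that Cent by (auto simp: Cp_def)
  ultimately have "spectral ?I ?I (\<lambda>x y. C $$ ((\<lambda>(i,k). i * m + k) x, (\<lambda>(i,k). i * m + k) y)) \<phi>1 c"
    unfolding spectral_def by simp
  from vn_entropy_spectral[OF Cc spectral_reindex[OF bij_pair_index this]]
  have SC: "vn_entropy C = - (\<Sum>k\<in>?I. c k * ln (c k))" .
  obtain t where t: "(\<Sum>k\<in>?I. c k * ln (c k)) \<le> (\<Sum>n<d. \<Sum>l<m. \<beta> t n l * ln (\<beta> t n l))
     + (q0 * ln q0 + (real d - 1) * (q1 * ln q1) + ln (real d))"
    using depolarized_entropy[OF d w'psd w'tr q cp N f avg \<chi> \<beta> \<phi> C'] by blast

  \<comment> \<open>Blocks concern the first factor and \<open>\<Omega>\<close> the second; by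
    linearity the two operations commute.\<close>
  have \<Omega>\<tau>: "\<Omega> (\<tau> t n) = mat m m (\<lambda>(k,l). of_nat d * block d w (F t n) k l)" for n
  proof -
    define M where "M = (\<lambda>ij. mat m m (\<lambda>(k,l). \<sigma> $$ (fst ij * m + k, snd ij * m + l)))"
    define a where "a = (\<lambda>ij. of_nat d * (cnj (F t n (fst ij)) * F t n (snd ij)))"
    have "\<tau> t n = mat m m (\<lambda>kl. \<Sum>ij\<in>{..<d} \<times> {..<d}. a ij * M ij $$ kl)"
      unfolding \<tau>_def block_def \<sigma>'_def a_def M_def
      by (intro eq_matI) (auto simp: sum.cartesian_product' sum_distrib_left mult.assoc)
    then have "\<Omega> (\<tau> t n) = mat m m (\<lambda>kl. \<Sum>ij\<in>{..<d} \<times> {..<d}. a ij * \<Omega> (M ij) $$ kl)"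
      using linear_map_on_sum[OF lin, of "{..<d} \<times> {..<d}" M a] by (simp add: M_def)
    also have "\<dots> = mat m m (\<lambda>(k,l). of_nat d * block d w (F t n) k l)"
      unfolding block_def w_def ampl_def a_def M_def
      by (intro eq_matI) (auto simp: sum.cartesian_product' sum_distrib_left mult.assoc)
    finally show ?thesis .
  qed
  have \<tau>tr: "mtrace (\<tau> t n) = 1" if n: "n < d" for n
  proof -
    \<comment> \<open>Unbiasedness enters here: the probability of outcome \<open>n\<close> is the
      sum of the \<open>s j\<close> times the squared overlaps \<open>1 / d\<close>, and the
      \<open>s j\<close> sum to 1.\<close>
    have ipF: "ip {..<d} (F t n) (e j) = cnj (f t n j)" if "j < d" for j
      unfolding F_def ip_sum_left using that by (simp add: onb_ip[OF oe])
    have "(\<Sum>k<m. block d \<sigma>' (F t n) k k) = (\<Sum>i<d. \<Sum>j<d. \<Sum>k<m. cnj (F t n i) * F t n j * \<sigma>' (i,k) (j,k))"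
      unfolding block_def by (subst sum.swap, rule sum.cong[OF refl], rule sum.swap)
    also have "\<dots> = form {..<d} (\<lambda>x y. ptrace2 d m \<sigma> $$ (x,y)) (F t n) (F t n)"
      unfolding form_def by (simp add: ptrace2_def \<sigma>'_def sum_distrib_left sum_distrib_right algebra_simps)
    also have "\<dots> = of_real (\<Sum>j<d. s j * (1 / real d))"
      unfolding spectral_form_self[OF e] by (simp add: ipF fmod)
    also have "\<dots> = 1 / of_nat d" unfolding sum_distrib_right[symmetric] s1 by simp
    finally show ?thesis using d by (simp add: mtrace_def \<tau>_def sum_distrib_left[symmetric])
  qed
  have \<tau>d: "density m (\<tau> t n)" if n: "n < d" for n
  proof -
    have "psd_on {..<m} (\<lambda>k l. of_nat d * block d \<sigma>' (F t n) k l)"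
      using psd_block[OF \<sigma>psd, of "F t n"] unfolding psd_on_def form_scale_mat by simp
    then have "psd_on {..<m} (\<lambda>k l. \<tau> t n $$ (k,l))"
      by (subst psd_on_cong[where W' = "\<lambda>k l. of_nat d * block d \<sigma>' (F t n) k l"]) (simp_all add: \<tau>_def)
    then show ?thesis using \<tau>tr[OF n] by (simp add: density_def psd_iff_psd_on \<tau>_def)
  qed
  \<comment> \<open>Normalising scales the eigenvalues of the block by \<open>d\<close>, at a cost
    of \<open>ln d / d\<close> per outcome; in total this cancels the \<open>ln d\<close> in fact
    \<open>t\<close>.\<close>
  have S\<Omega>: "1 / real d * vn_entropy (\<Omega> (\<tau> t n)) = - (\<Sum>l<m. \<beta> t n l * ln (\<beta> t n l)) - ln (real d) / real d"
    if n: "n < d" for n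
  proof -
    have \<Omega>c: "\<Omega> (\<tau> t n) \<in> carrier_mat m m" unfolding \<Omega>\<tau> by simp
    have "spectral {..<m} {..<m} (\<lambda>k l. \<Omega> (\<tau> t n) $$ (k,l)) (\<chi> t n) (\<lambda>l. real d * \<beta> t n l)"
      using \<chi>[of t n] unfolding bl spectral_def \<Omega>\<tau> by (simp add: sum_distrib_left mult.assoc)
    note S = vn_entropy_spectral[OF \<Omega>c this]
    have o: "onb {..<m} {..<m} (\<chi> t n)" using \<chi>[of t n] by (simp add: spectral_def)
    have "mtrace (\<Omega> (\<tau> t n)) = 1" using tp[of "\<tau> t n"] \<tau>tr[OF n] by (simp add: \<tau>_def)
    then have "of_nat d * (\<Sum>k<m. block d w' (f t n) k k) = 1"
      unfolding \<Omega>\<tau> bl by (simp add: mtrace_def sum_distrib_left)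
    moreover have "(\<Sum>k<m. block d w' (f t n) k k) = of_real (\<Sum>l<m. \<beta> t n l)"
      unfolding onb_trace[OF o, symmetric] using spectral_eigenform(3)[OF \<chi>] by simp
    ultimately have "of_real (real d * (\<Sum>l<m. \<beta> t n l)) = (1::complex)" by simp
    then have \<beta>1: "real d * (\<Sum>l<m. \<beta> t n l) = 1" using of_real_eq_1_iff by blast
    have "real d * \<beta> t n l * ln (real d * \<beta> t n l) = real d * (\<beta> t n l * ln (\<beta> t n l)) + ln (real d) * (real d * \<beta> t n l)" if "l < m" for l
      using d \<beta>[OF that, of t n] by (cases "\<beta> t n l = 0") (auto simp: ln_mult algebra_simps)
    then have "vn_entropy (\<Omega> (\<tau> t n)) = - (real d * (\<Sum>l<m. \<beta> t n l * ln (\<beta> t n l)) + ln (real d) * (real d * (\<Sum>l<m. \<beta> t n l)))"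
      unfolding S by (simp add: sum.distrib sum_distrib_left)
    then show ?thesis unfolding \<beta>1 using d by (simp add: field_simps)
  qed
  have "(\<Sum>n<d. 1 / real d * vn_entropy (\<Omega> (\<tau> t n))) = - (\<Sum>n<d. \<Sum>l<m. \<beta> t n l * ln (\<beta> t n l)) - ln (real d)"
    using d by (simp add: S\<Omega> sum_subtractf sum_negf del: times_divide_eq_left)
  then have ent: "- (q0 * ln q0 + (real d - 1) * (q1 * ln q1)) + (\<Sum>n<d. 1 / real d * vn_entropy (\<Omega> (\<tau> t n))) \<le> vn_entropy C"
    unfolding SC using t by linarith
  have pt: "ptrace1 d m \<sigma> = mat m m (\<lambda>ab. \<Sum>n<d. of_real (1 / real d) * \<tau> t n $$ ab)"
  proof (rule eq_matI)
    fix k l assume "k < dim_row (mat m m (\<lambda>ab. \<Sum>n<d. of_real (1 / real d) * \<tau> t n $$ ab))"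
      "l < dim_col (mat m m (\<lambda>ab. \<Sum>n<d. of_real (1 / real d) * \<tau> t n $$ ab))"
    then have kl: "k < m" "l < m" by auto
    have "(\<Sum>n<d. of_real (1 / real d) * \<tau> t n $$ (k,l)) = (\<Sum>n<d. \<Sum>i<d. \<Sum>j<d. cnj (F t n i) * F t n j * \<sigma>' (i,k) (j,l))"
      using kl d by (simp add: \<tau>_def block_def)
    also have "\<dots> = (\<Sum>i<d. \<Sum>j<d. \<Sum>n<d. cnj (F t n i) * F t n j * \<sigma>' (i,k) (j,l))"
      by (subst sum.swap, rule sum.cong[OF refl], rule sum.swap)
    also have "\<dots> = (\<Sum>i<d. \<Sum>j<d. (\<Sum>n<d. F t n j * cnj (F t n i)) * \<sigma>' (i,k) (j,l))"
      unfolding sum_distrib_right by (simp add: mult.commute)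
    also have "\<dots> = (\<Sum>i<d. \<sigma>' (i,k) (i,l))"
      by (simp add: onb_complete[OF oF])
    finally show "ptrace1 d m \<sigma> $$ (k,l) = mat m m (\<lambda>ab. \<Sum>n<d. of_real (1 / real d) * \<tau> t n $$ ab) $$ (k,l)"
      using kl by (simp add: ptrace1_def \<sigma>'_def)
  qed (simp_all add: ptrace1_def)
  show ?thesis using \<tau>d pt ent unfolding C_def by blast
qed

section \<open>Decompositions and the final inequality\<close>

text \<open>A real \<open>Inf\<close> is a lower bound only for a set bounded below; the nonnegative
  output entropies supply the bound 0.\<close>

lemma Hmin_le:
  fixes N :: nat
  assumes nonneg: "\<And>A. density n A \<Longrightarrow> vn_entropy (\<Psi> A) \<ge> 0"
    and \<pi>: "\<And>j. j < N \<Longrightarrow> \<pi> j \<ge> 0 \<and> density n (s j)" "(\<Sum>j<N. \<pi> j) = 1"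
    and \<sigma>: "\<sigma> = mat n n (\<lambda>ab. \<Sum>j<N. complex_of_real (\<pi> j) * s j $$ ab)"
  shows "Hmin n \<Psi> \<sigma> \<le> (\<Sum>j<N. \<pi> j * vn_entropy (\<Psi> (s j)))"
  unfolding Hmin_def
proof (rule cInf_lower)
  show "bdd_below {\<Sum>j<N. \<pi> j * vn_entropy (\<Psi> (s j)) | (N::nat) \<pi> s.
      (\<forall>j<N. \<pi> j \<ge> 0 \<and> density n (s j)) \<and> (\<Sum>j<N. \<pi> j) = 1 \<and>
      \<sigma> = mat n n (\<lambda>ab. \<Sum>j<N. complex_of_real (\<pi> j) * s j $$ ab)}"
    by (rule bdd_belowI[of _ 0]) (auto intro!: sum_nonneg mult_nonneg_nonneg nonneg)
qed (use \<pi> \<sigma> in blast)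

lemma depol_spectral:
  assumes c: "A \<in> carrier_mat d d" and t: "mtrace A = 1"
    and s: "spectral {..<d} {..<d} (\<lambda>x y. A $$ (x,y)) \<phi> a"
  shows "spectral {..<d} {..<d} (\<lambda>x y. depol d p A $$ (x,y)) \<phi> (\<lambda>k. (1 - p) * a k + p / real d)"
proof -
  have o: "onb {..<d} {..<d} \<phi>" using s by (simp add: spectral_def)
  have "depol d p A $$ (x,y) = (\<Sum>k<d. of_real ((1 - p) * a k + p / real d) * \<phi> k x * cnj (\<phi> k y))"
    if xy: "x < d" "y < d" for x y
  proof -
    have "(\<Sum>k<d. of_real ((1 - p) * a k + p / real d) * \<phi> k x * cnj (\<phi> k y))
       = of_real (1 - p) * (\<Sum>k<d. of_real (a k) * \<phi> k x * cnj (\<phi> k y)) + of_real (p / real d) * (\<Sum>k<d. \<phi> k x * cnj (\<phi> k y))"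
      unfolding sum_distrib_left sum.distrib[symmetric] by (intro sum.cong refl) (simp add: algebra_simps)
    also have "\<dots> = of_real (1 - p) * A $$ (x,y) + of_real (p / real d) * of_bool (x = y)"
      using s xy by (simp add: spectral_def onb_complete[OF o] del: of_real_divide)
    finally show ?thesis using xy c t by (auto simp: depol_def)
  qed
  then show ?thesis using o by (simp add: spectral_def)
qed

lemma vn_entropy_depol_nonneg:
  assumes d: "d \<ge> 1" and q: "1 - p + p / real d \<ge> 0" "p \<ge> 0" and A: "density d A"
  shows "vn_entropy (depol d p A) \<ge> 0"
proof -
  obtain \<phi> a where s: "spectral {..<d} {..<d} (\<lambda>x y. A $$ (x,y)) \<phi> a" "\<forall>k<d. a k \<ge> 0" "(\<Sum>k<d. a k) = 1"
    using density_spectral[OF A] by blast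
  have A': "A \<in> carrier_mat d d" "mtrace A = 1" using A by (auto simp: density_def psd_def)
  have nn: "(1 - p) * a k + p / real d \<ge> 0" if "k < d" for k
  proof -
    have "a k \<le> (\<Sum>k<d. a k)" using s(2) that by (intro member_le_sum) auto
    then have "a k \<le> 1" using s(3) by simp
    \<comment> \<open>The eigenvalue is a convex combination of \<open>1 - p + p / d\<close> and
      \<open>p / d\<close>, hence nonnegative even for \<open>p > 1\<close>.\<close>
    then have "0 \<le> a k * (1 - p + p / real d) + (1 - a k) * (p / real d)"
      using s(2) q that by (intro add_nonneg_nonneg[OF mult_nonneg_nonneg mult_nonneg_nonneg]) auto
    also have "\<dots> = (1 - p) * a k + p / real d" by (simp add: algebra_simps diff_divide_distrib)
    finally show ?thesis .
  qed
  show ?thesis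
  proof (rule entropy_nonneg[OF _ depol_spectral[OF A' s(1)]])
    show "depol d p A \<in> carrier_mat d d" using A' by (simp add: depol_def)
    show "(\<Sum>k<d. (1 - p) * a k + p / real d) = 1"
      using d by (simp add: sum.distrib sum_distrib_left[symmetric] s(3))
  qed (use nn in auto)
qed

text \<open>The eigenprojections \<open>E j\<close> of \<open>A\<close> form an admissible ensemble,
  and every output has the eigenvalue \<open>1 - p + p / d\<close> once and \<open>p / d\<close>
  with multiplicity \<open>d - 1\<close>.\<close>

lemma Hmin_depol_le:
  assumes d: "d \<ge> 1" and q: "1 - p + p / real d \<ge> 0" "p \<ge> 0" and A: "density d A"
  shows "Hmin d (depol d p) A \<le> - ((1 - p + p / real d) * ln (1 - p + p / real d)
    + (real d - 1) * (p / real d * ln (p / real d)))" (is "_ \<le> ?h")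
proof -
  obtain \<phi> a where s: "spectral {..<d} {..<d} (\<lambda>x y. A $$ (x,y)) \<phi> a" "\<forall>k<d. a k \<ge> 0" "(\<Sum>k<d. a k) = 1"
    using density_spectral[OF A] by blast
  have Ac: "A \<in> carrier_mat d d" using A by (auto simp: density_def psd_def)
  have o: "onb {..<d} {..<d} \<phi>" using s by (simp add: spectral_def)
  define E where "E = (\<lambda>j. mat d d (\<lambda>(x,y). \<phi> j x * cnj (\<phi> j y)))"
  have Ec: "E j \<in> carrier_mat d d" for j by (simp add: E_def)
  have Es: "spectral {..<d} {..<d} (\<lambda>x y. E j $$ (x,y)) \<phi> (\<lambda>k. of_bool (k = j))" if "j < d" for j
  proof -
    have "(\<Sum>k<d. of_real (of_bool (k = j)) * \<phi> k x * cnj (\<phi> k y)) = \<phi> j x * cnj (\<phi> j y)" for x y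
    proof -
      have "(\<Sum>k<d. of_real (of_bool (k = j)) * \<phi> k x * cnj (\<phi> k y)) = (\<Sum>k<d. of_bool (k = j) * (\<phi> k x * cnj (\<phi> k y)))"
        by (intro sum.cong refl) auto
      then show ?thesis using that by simp
    qed
    then show ?thesis using o by (simp add: spectral_def E_def)
  qed
  have Ed: "density d (E j)" if "j < d" for j
  proof -
    have "mtrace (E j) = ip {..<d} (\<phi> j) (\<phi> j)" by (simp add: mtrace_def E_def ip_def mult.commute)
    moreover have "psd_on {..<d} (\<lambda>x y. E j $$ (x,y))"
      unfolding psd_on_def spectral_form_self[OF Es[OF that]] by (auto intro!: sum_nonneg)
    ultimately show ?thesis using that Ec by (simp add: density_def psd_iff_psd_on onb_ip[OF o])
  qed
  have S: "vn_entropy (depol d p (E j)) = ?h" if j: "j < d" for j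
  proof -
    have c: "depol d p (E j) \<in> carrier_mat d d" using Ec by (simp add: depol_def)
    have t: "mtrace (E j) = 1" using Ed[OF j] by (simp add: density_def)
    define g where "g = (\<lambda>k. ((1 - p) * of_bool (k = j) + p / real d) * ln ((1 - p) * of_bool (k = j) + p / real d))"
    have "vn_entropy (depol d p (E j)) = - (\<Sum>k<d. g k)"
      unfolding g_def by (rule vn_entropy_spectral[OF c depol_spectral[OF Ec t Es[OF j]]])
    also have "(\<Sum>k<d. g k) = g j + (\<Sum>k\<in>{..<d} - {j}. g k)" using j by (intro sum.remove) auto
    also have "(\<Sum>k\<in>{..<d} - {j}. g k) = (\<Sum>k\<in>{..<d} - {j}. p / real d * ln (p / real d))"
      by (intro sum.cong refl) (auto simp: g_def)
    also have "\<dots> = (real d - 1) * (p / real d * ln (p / real d))"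
      using j d by (simp add: of_nat_diff)
    finally show ?thesis by (simp add: g_def)
  qed
  have "Hmin d (depol d p) A \<le> (\<Sum>j<d. a j * vn_entropy (depol d p (E j)))"
  proof (rule Hmin_le)
    show "A = mat d d (\<lambda>ab. \<Sum>j<d. complex_of_real (a j) * E j $$ ab)"
      using Ac s(1) by (intro eq_matI) (auto simp: spectral_def E_def mult.assoc)
  qed (use vn_entropy_depol_nonneg[OF d q] s Ed in auto)
  also have "\<dots> = ?h" using S s(3) by (simp add: sum_distrib_right[symmetric])
  finally show ?thesis .
qed

theorem theorem7:
  fixes d m :: nat and p :: real
    and \<Omega> :: "complex mat \<Rightarrow> complex mat" and \<rho> :: "complex mat"
  assumes "d \<ge> 1" and "m \<ge> 1"
    and "0 \<le> p" and "p * (real d ^ 2 - 1) \<le> real d ^ 2"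
    and "channel m \<Omega>"
    and "density (d * m) \<rho>"
  shows "Hmin (d * m) (tensor_map d m (depol d p) \<Omega>) \<rho>
           \<ge> Hmin d (depol d p) (ptrace2 d m \<rho>) + Hmin m \<Omega> (ptrace1 d m \<rho>)"
proof -
  note d = assms(1) and ch = assms(5) and \<rho> = assms(6)
  define q1 where "q1 = p / real d"
  define q0 where "q0 = 1 - p + q1"
  define h where "h = - (q0 * ln q0 + (real d - 1) * (q1 * ln q1))"
  have q1: "q1 \<ge> 0" using assms(3) by (simp add: q1_def)
  have q01: "q0 + (real d - 1) * q1 = 1" using d by (simp add: q0_def q1_def field_simps)
  \<comment> \<open>The upper bound on \<open>p\<close>, divided by \<open>d\<close>, in the form
    that makes the weights in \<open>depolarized_entropy\<close> nonnegative.\<close>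
  have cp: "q0 + (real d - 1) * (q0 - q1) \<ge> 0"
  proof -
    have "real d * (q0 + (real d - 1) * (q0 - q1)) = real d ^ 2 - p * (real d ^ 2 - 1)"
      using d by (simp add: q0_def q1_def field_simps power2_eq_square)
    then have "0 \<le> real d * (q0 + (real d - 1) * (q0 - q1))" using assms(4) by simp
    then show ?thesis using d by (simp add: zero_le_mult_iff)
  qed
  have q0: "q0 > 0"
  proof (cases "d = 1")
    case False
    then have d2: "real d \<ge> 2" using d by linarith
    \<comment> \<open>The factor \<open>d + 1\<close> produces \<open>p * (d^2 - 1)\<close>, and the
      bound on \<open>p\<close> then leaves at least \<open>d\<close>. For \<open>d = 1\<close> that
      bound is void, but \<open>q0 = 1\<close>.\<close>
    have "(real d + 1) * (real d * q0) = real d * (real d + 1) - p * (real d ^ 2 - 1)"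
      using d by (simp add: q0_def q1_def field_simps power2_eq_square)
    also have "\<dots> \<ge> real d" using assms(4) by (simp add: power2_eq_square algebra_simps)
    finally have "0 < (real d + 1) * (real d * q0)" using d2 by linarith
    then show ?thesis using d2 by (simp add: zero_less_mult_iff)
  qed (simp add: q0_def q1_def)
  have H1: "Hmin d (depol d p) (ptrace2 d m \<rho>) \<le> h"
    using Hmin_depol_le[OF d _ assms(3) density_ptrace2[OF \<rho>]] q0 unfolding h_def q0_def q1_def by simp
  have "h + Hmin m \<Omega> (ptrace1 d m \<rho>) \<le> (\<Sum>j<N. \<pi> j * vn_entropy (tensor_map d m (depol d p) \<Omega> (s j)))"
    if \<pi>: "\<And>j. j < N \<Longrightarrow> \<pi> j \<ge> 0 \<and> density (d * m) (s j)" "(\<Sum>j<N. \<pi> j) = 1"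
      and \<rho>s: "\<rho> = mat (d * m) (d * m) (\<lambda>ab. \<Sum>j<N. complex_of_real (\<pi> j) * s j $$ ab)"
    for N and \<pi> :: "nat \<Rightarrow> real" and s
  proof -
    have "\<forall>j\<in>{..<N}. \<exists>r. (\<forall>n<d. density m (r n)) \<and>
        ptrace1 d m (s j) = mat m m (\<lambda>ab. \<Sum>n<d. of_real (1 / real d) * r n $$ ab) \<and>
        h + (\<Sum>n<d. 1 / real d * vn_entropy (\<Omega> (r n))) \<le> vn_entropy (tensor_map d m (depol d p) \<Omega> (s j))"
      using superadditive_state[OF d ch _ q0 q1 q01 cp] \<pi> unfolding h_def by (simp add: q0_def q1_def)
    from bchoice[OF this] obtain r where r: "\<And>j n. j < N \<Longrightarrow> n < d \<Longrightarrow> density m (r j n)"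
      "\<And>j. j < N \<Longrightarrow> ptrace1 d m (s j) = mat m m (\<lambda>ab. \<Sum>n<d. of_real (1 / real d) * r j n $$ ab)"
      "\<And>j. j < N \<Longrightarrow> h + (\<Sum>n<d. 1 / real d * vn_entropy (\<Omega> (r j n))) \<le> vn_entropy (tensor_map d m (depol d p) \<Omega> (s j))"
      by auto
    \<comment> \<open>The ensembles of all \<open>s j\<close> are concatenated into one of
      \<open>N * d\<close> states, with index \<open>j * d + n\<close>.\<close>
    define \<pi>' where "\<pi>' = (\<lambda>a. \<pi> (a div d) * (1 / real d))"
    define r' where "r' = (\<lambda>a. r (a div d) (a mod d))"
    have ix: "\<pi>' (j * d + n) = \<pi> j * (1 / real d)" "r' (j * d + n) = r j n" if "n < d" for j n
      using that by (simp_all add: \<pi>'_def r'_def)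
    have "Hmin m \<Omega> (ptrace1 d m \<rho>) \<le> (\<Sum>a<N * d. \<pi>' a * vn_entropy (\<Omega> (r' a)))"
    proof (rule Hmin_le)
      show "vn_entropy (\<Omega> A) \<ge> 0" if "density m A" for A
        by (rule vn_entropy_density_nonneg[OF channel_density[OF ch that]])
      show "\<pi>' a \<ge> 0 \<and> density m (r' a)" if "a < N * d" for a
        using that d \<pi>(1) r(1) less_mult_imp_div_less[OF that] by (simp add: \<pi>'_def r'_def)
      show "(\<Sum>a<N * d. \<pi>' a) = 1"
        unfolding sum_pair_index using d \<pi>(2) by (simp add: ix)
      show "ptrace1 d m \<rho> = mat m m (\<lambda>ab. \<Sum>a<N * d. complex_of_real (\<pi>' a) * r' a $$ ab)"
      proof (rule eq_matI)
        fix k l assume "k < dim_row (mat m m (\<lambda>ab. \<Sum>a<N * d. complex_of_real (\<pi>' a) * r' a $$ ab))"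
          "l < dim_col (mat m m (\<lambda>ab. \<Sum>a<N * d. complex_of_real (\<pi>' a) * r' a $$ ab))"
        then have kl: "k < m" "l < m" by auto
        have "ptrace1 d m \<rho> $$ (k,l) = (\<Sum>i<d. \<Sum>j<N. of_real (\<pi> j) * s j $$ (i * m + k, i * m + l))"
          using kl by (simp add: ptrace1_def \<rho>s pair_index_less)
        also have "\<dots> = (\<Sum>j<N. of_real (\<pi> j) * ptrace1 d m (s j) $$ (k,l))"
          using kl by (subst sum.swap) (simp add: ptrace1_def sum_distrib_left)
        also have "\<dots> = (\<Sum>j<N. of_real (\<pi> j) * (\<Sum>n<d. of_real (1 / real d) * r j n $$ (k,l)))"
          using kl by (intro sum.cong refl) (simp add: r(2))
        also have "\<dots> = (\<Sum>j<N. \<Sum>n<d. of_real (\<pi>' (j * d + n)) * r' (j * d + n) $$ (k,l))"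
          unfolding sum_distrib_left by (intro sum.cong refl) (simp add: ix)
        finally show "ptrace1 d m \<rho> $$ (k,l) = mat m m (\<lambda>ab. \<Sum>a<N * d. complex_of_real (\<pi>' a) * r' a $$ ab) $$ (k,l)"
          using kl by (simp add: sum_pair_index)
      qed (simp_all add: ptrace1_def)
    qed
    also have "\<dots> = (\<Sum>j<N. \<pi> j * (\<Sum>n<d. 1 / real d * vn_entropy (\<Omega> (r j n))))"
      unfolding sum_pair_index sum_distrib_left by (intro sum.cong refl) (simp add: ix)
    finally have "h + Hmin m \<Omega> (ptrace1 d m \<rho>) \<le> (\<Sum>j<N. \<pi> j) * h + (\<Sum>j<N. \<pi> j * (\<Sum>n<d. 1 / real d * vn_entropy (\<Omega> (r j n))))"
      using \<pi>(2) by simp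
    also have "\<dots> = (\<Sum>j<N. \<pi> j * (h + (\<Sum>n<d. 1 / real d * vn_entropy (\<Omega> (r j n)))))"
      unfolding sum_distrib_right sum.distrib[symmetric] distrib_left ..
    also have "\<dots> \<le> (\<Sum>j<N. \<pi> j * vn_entropy (tensor_map d m (depol d p) \<Omega> (s j)))"
      using \<pi>(1) r(3) by (intro sum_mono mult_left_mono) auto
    finally show ?thesis .
  qed
  note bound = this
  have "h + Hmin m \<Omega> (ptrace1 d m \<rho>) \<le> Hmin (d * m) (tensor_map d m (depol d p) \<Omega>) \<rho>"
    unfolding Hmin_def[of "d * m"]
  proof (rule cInf_greatest)
    \<comment> \<open>The trivial decomposition shows that the set is nonempty, as
      \<open>cInf_greatest\<close> demands.\<close>
    have "\<rho> = mat (d * m) (d * m) (\<lambda>ab. \<Sum>j<1::nat. complex_of_real 1 * \<rho> $$ ab)"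
      using \<rho> by (intro eq_matI) (auto simp: density_def psd_def)
    then show "{\<Sum>j<N. \<pi> j * vn_entropy (tensor_map d m (depol d p) \<Omega> (s j)) |(N::nat) \<pi> s.
        (\<forall>j<N. 0 \<le> \<pi> j \<and> density (d * m) (s j)) \<and> sum \<pi> {..<N} = 1 \<and>
        \<rho> = mat (d * m) (d * m) (\<lambda>ab. \<Sum>j<N. complex_of_real (\<pi> j) * s j $$ ab)} \<noteq> {}"
      using \<rho> by (auto intro!: exI[of _ "1::nat"] exI[of _ "\<lambda>_. 1::real"] exI[of _ "\<lambda>_. \<rho>"])
  qed (use bound in blast)
  then show ?thesis using H1 by linarith
qed

end
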